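(* Let $s\ge 1$ be an integer. There exists a constant $C_s>0$, depending only on $s$, such that for every $\varepsilon>0$, every $T$ with $0<T<2\pi\varepsilon$, and every real-valued $a\in H^s(\mathbb{T})$ satisfying $$|a-\bar a|_{H^s}\le C_s\,(2\pi\varepsilon-T),$$ the initial datum $u(0,x)=a(x)$ generates a unique solution $u\in L^\infty([0,T],H^s(\mathbb{T}))$ to $$\partial_tu+u\,\partial_xu-\varepsilon\,\partial_x^2u=i,$$ and there holds $$|u(t)-it-\bar a|_{H^s}\le|a-\bar a|_{H^s}\qquad\text{for all }t\in[0,T].$$
   Context: $\mathbb{T}=\mathbb{R}/\mathbb{Z}$. The unknown $u(t,x)\in\mathbb{C}$ is complex-valued, with $t\ge 0$, $x\in\mathbb{T}$. $\bar a=\int_{\mathbb{T}}a(x)\,dx$ denotes the mean value of $a$. $H^s(\mathbb{T})$ is the $L^2$-based Sobolev space with norm $|w|_{H^s}^2=\sum_{0\le j\le s}|\partial_x^jw|_{L^2(\mathbb{T})}^2$. *)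

theory Defs
  imports "HOL-Analysis.Analysis"
begin

text \<open>
  Functions on the circle \<open>\<real>/\<int>\<close> are 1-periodic functions on \<open>\<real>\<close>, integrated over one period.
  Elements of Lebesgue and Sobolev spaces are represented by Borel functions (every class modulo
  null sets contains one).
\<close>

definition periodic1 :: "(real \<Rightarrow> 'a) \<Rightarrow> bool"
  where "periodic1 f \<longleftrightarrow> (\<forall>x. f (x + 1) = f x)"

definition torus_mean :: "(real \<Rightarrow> real) \<Rightarrow> real"
  where "torus_mean a = (LINT x:{0..1}|lborel. a x)"

definition torus_L2 :: "(real \<Rightarrow> complex) \<Rightarrow> bool"
  where "torus_L2 f \<longleftrightarrow> periodic1 f \<and> f \<in> borel_measurable borel \<and>
     set_integrable lborel {0..1} (\<lambda>x. (cmod (f x))\<^sup>2)"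

definition L2_norm_torus :: "(real \<Rightarrow> complex) \<Rightarrow> real"
  where "L2_norm_torus f = sqrt (LINT x:{0..1}|lborel. (cmod (f x))\<^sup>2)"

definition torus_test_function :: "(real \<Rightarrow> real) \<Rightarrow> bool"
  where "torus_test_function \<phi> \<longleftrightarrow>
     periodic1 \<phi> \<and> (\<forall>k x. (deriv ^^ k) \<phi> differentiable (at x))"

text \<open>Derivatives in the sense of distributions on the circle that are square integrable.\<close>

definition is_weak_deriv :: "nat \<Rightarrow> (real \<Rightarrow> complex) \<Rightarrow> (real \<Rightarrow> complex) \<Rightarrow> bool"
  where "is_weak_deriv j w v \<longleftrightarrow> torus_L2 v \<and>
     (\<forall>\<phi>. torus_test_function \<phi> \<longrightarrow>
        (LINT x:{0..1}|lborel. w x * complex_of_real ((deriv ^^ j) \<phi> x)) =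
        (-1) ^ j * (LINT x:{0..1}|lborel. v x * complex_of_real (\<phi> x)))"

text \<open>Unique up to null sets; only used below where it exists.\<close>

definition weak_deriv :: "nat \<Rightarrow> (real \<Rightarrow> complex) \<Rightarrow> real \<Rightarrow> complex"
  where "weak_deriv j w = (SOME v. is_weak_deriv j w v)"

definition sobolev_H :: "nat \<Rightarrow> (real \<Rightarrow> complex) set"
  where "sobolev_H s = {w. torus_L2 w \<and> (\<forall>j\<le>s. \<exists>v. is_weak_deriv j w v)}"

definition sobolev_norm :: "nat \<Rightarrow> (real \<Rightarrow> complex) \<Rightarrow> real"
  where "sobolev_norm s w = sqrt (\<Sum>j\<le>s. (L2_norm_torus (weak_deriv j w))\<^sup>2)"

text \<open>
  Joint measurability expresses Bochner measurability of \<open>t \<mapsto> u t\<close>: since \<open>H\<^sup>s\<close> is separable,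
  weak and strong measurability agree.
\<close>

definition Linf_sobolev :: "real \<Rightarrow> nat \<Rightarrow> (real \<Rightarrow> real \<Rightarrow> complex) set"
  where "Linf_sobolev T s = {u.
     set_borel_measurable borel ({0..T} \<times> UNIV) (\<lambda>(t, x). u t x) \<and>
     (\<exists>M. AE t in lborel. t \<in> {0..T} \<longrightarrow> u t \<in> sobolev_H s \<and> sobolev_norm s (u t) \<le> M)}"

definition L2_continuous_in_time :: "real \<Rightarrow> (real \<Rightarrow> real \<Rightarrow> complex) \<Rightarrow> bool"
  where "L2_continuous_in_time T u \<longleftrightarrow>
     (\<forall>t\<in>{0..T}. torus_L2 (u t)) \<and>
     (\<forall>t\<in>{0..T}. ((\<lambda>\<tau>. L2_norm_torus (\<lambda>x. u \<tau> x - u t x)) \<longlongrightarrow> 0) (at t within {0..T}))"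

definition Dt :: "(real \<Rightarrow> real \<Rightarrow> real) \<Rightarrow> real \<Rightarrow> real \<Rightarrow> real"
  where "Dt \<phi> t x = deriv (\<lambda>\<tau>. \<phi> \<tau> x) t"

definition Dx :: "(real \<Rightarrow> real \<Rightarrow> real) \<Rightarrow> real \<Rightarrow> real \<Rightarrow> real"
  where "Dx \<phi> t x = deriv (\<lambda>y. \<phi> t y) x"

text \<open>\<open>C\<^sup>\<infinity>\<close> on the plane: all iterated partial derivatives exist and are continuous.\<close>

coinductive smooth_plane :: "(real \<Rightarrow> real \<Rightarrow> real) \<Rightarrow> bool"
  where "\<lbrakk> continuous_on UNIV (\<lambda>(t, x). \<phi> t x);
           \<And>t x. (\<lambda>\<tau>. \<phi> \<tau> x) differentiable (at t);
           \<And>t x. (\<lambda>y. \<phi> t y) differentiable (at x);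
           smooth_plane (Dt \<phi>); smooth_plane (Dx \<phi>) \<rbrakk> \<Longrightarrow> smooth_plane \<phi>"

text \<open>
  Test functions on \<open>[0,T) \<times> \<real>/\<int>\<close>; they need not vanish at \<open>t = 0\<close>, and their values for
  \<open>t < 0\<close> are irrelevant.
\<close>

definition spacetime_test_function :: "real \<Rightarrow> (real \<Rightarrow> real \<Rightarrow> real) \<Rightarrow> bool"
  where "spacetime_test_function T \<phi> \<longleftrightarrow> smooth_plane \<phi> \<and> (\<forall>t. periodic1 (\<phi> t)) \<and>
     (\<exists>T'<T. \<forall>t\<ge>T'. \<forall>x. \<phi> t x = 0)"

text \<open>
  Solutions in \<open>L\<^sup>\<infinity>([0,T], H\<^sup>s)\<close>, \<open>s \<ge> 1\<close>, of
  \<open>\<partial>\<^sub>t u + u \<partial>\<^sub>x u - \<epsilon> \<partial>\<^sub>x\<^sup>2 u = \<i>\<close>, \<open>u(0) = a\<close>, in the sense of distributions. An element of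
  \<open>L\<^sup>\<infinity>([0,T], H\<^sup>s)\<close> has no value at \<open>t = 0\<close>, so the datum enters through the boundary term of
  the integration by parts in time.
\<close>

definition burgers_solution ::
    "nat \<Rightarrow> real \<Rightarrow> real \<Rightarrow> (real \<Rightarrow> complex) \<Rightarrow> (real \<Rightarrow> real \<Rightarrow> complex) \<Rightarrow> bool"
  where "burgers_solution s \<epsilon> T a u \<longleftrightarrow> u \<in> Linf_sobolev T s \<and>
     (\<forall>\<phi>. spacetime_test_function T \<phi> \<longrightarrow>
        - (LINT x:{0..1}|lborel. a x * complex_of_real (\<phi> 0 x))
        + (LINT t:{0..T}|lborel. LINT x:{0..1}|lborel.
             - u t x * complex_of_real (Dt \<phi> t x)
             + u t x * weak_deriv 1 (u t) x * complex_of_real (\<phi> t x)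
             - complex_of_real \<epsilon> * u t x * complex_of_real (Dx (Dx \<phi>) t x))
        = (LINT t:{0..T}|lborel. LINT x:{0..1}|lborel. \<i> * complex_of_real (\<phi> t x)))"

end

theory Submission
  imports Defs
begin

text \<open>
  With \<open>u = \<i> t + m + w\<close>, where \<open>m\<close> is the mean of the datum, the forcing disappears and \<open>w\<close> has mean
  zero. Its Fourier coefficients satisfy \<open>w\<^sub>k' = (2 \<pi> k t - 4 \<pi>\<^sup>2 \<epsilon> k\<^sup>2 - 2 \<pi> \<i> k m) w\<^sub>k - \<pi> \<i> k (w * w)\<^sub>k\<close>.
  For \<open>t \<le> T\<close> the real part of the linear coefficient is at most \<open>- 2 \<pi> \<delta> k\<^sup>2\<close> with
  \<open>\<delta> = 2 \<pi> \<epsilon> - T\<close>, so a problem that looks elliptic in time is dissipative up to time \<open>T\<close>, and it is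
  treated as a small-data parabolic equation in sequence spaces.

  Existence. The norm is \<open>\<Sum> sup\<^sub>t e\<^bsup>\<pi>\<delta>\<bar>k\<bar>t\<^esup> \<bar>w\<^sub>k(t)\<bar>\<close>. In Duhamel's formula the factor \<open>k\<close> of the nonlinearity
  is absorbed by the time integral (\<open>Duhamel_bound\<close>), and if \<open>\<Sum>\<^sub>k \<bar>w\<^sub>k(0)\<bar> \<le> \<delta> / 8\<close> the Picard iterates are
  dominated by those of a numerical quadratic equation (\<open>Phi_compare\<close>, \<open>Maj_ball\<close>). The increments of
  the iterates are dominated by the increments of the majorants, which converge because they are
  monotone and bounded. The weight makes the solution analytic for positive time, so that all its weak derivatives
  are given by absolutely convergent series.

  Monotonicity of the norm. For finitely many modes the \<open>H\<^sup>s\<close> energy is differentiable. The nonlinear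
  term is at most \<open>C \<Sum>\<^sub>k \<bar>w\<^sub>k\<bar>\<close> times the dissipated quantity (\<open>trilinear_estimate\<close>), so the energy
  decreases if \<open>\<Sum>\<^sub>k \<bar>w\<^sub>k\<bar>\<close> is small compared with \<open>\<delta>\<close> (\<open>galerkin_energy\<close>). The truncated solutions converge
  to the full one mode by mode, again by comparison of majorants, and the bound passes to the
  limit (\<open>sol_energy\<close>). The embedding \<open>\<Sum>\<^sub>k \<bar>w\<^sub>k(0)\<bar> \<le> \<bar>w(0)\<bar>\<^bsub>H\<^sup>s\<^esub>\<close> (\<open>sobolev_fc_summable\<close>) turns the smallness
  of the datum in \<open>H\<^sup>s\<close> into the two smallness conditions.

  Uniqueness. Testing with a smooth function of time that vanishes near \<open>T\<close>, times a trigonometric function of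
  space, shows that the Fourier coefficients of any weak solution satisfy the integrated equations
  (\<open>coefficient_equation\<close>). For the difference of two solutions the dissipation absorbs the
  derivative in the nonlinearity, and Bessel's inequality, Parseval's identity and Gronwall's lemma conclude
  (\<open>weak_solution_unique\<close>).

  The dictionary between functions and coefficients rests on the uniqueness of Fourier coefficients
  (\<open>AE_zero_if_fc_zero\<close>), which makes weak derivatives unique and identifies a function that has
  absolutely summable coefficients with its Fourier series.
\<close>

section \<open>Integration over bounded intervals\<close>

text \<open>Integrals over \<open>{0..T}\<close> are taken with respect to a finite measure of their own, so that
  bounded measurable functions are integrable.\<close>

definition LI :: "real \<Rightarrow> real measure"
  where "LI T = restrict_space lborel {0..T}"

lemma space_LI [simp]: "space (LI T) = {0..T}"
  by (simp add: LI_def space_restrict_space)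

lemma measurable_LI: "f \<in> borel_measurable borel \<Longrightarrow> f \<in> borel_measurable (LI T)"
  unfolding LI_def by (rule measurable_restrict_space1) simp

lemma measurable_LI_iff:
  fixes f :: "real \<Rightarrow> 'a::real_normed_vector"
  shows "f \<in> borel_measurable (LI T) \<longleftrightarrow> (\<lambda>x. indicator {0..T} x *\<^sub>R f x) \<in> borel_measurable borel"
  unfolding LI_def by (subst borel_measurable_restrict_space_iff) auto

lemma measurable_LI_continuous:
  fixes f :: "real \<Rightarrow> 'a::{real_normed_vector,second_countable_topology}"
  assumes "continuous_on {0..T} f"
  shows "f \<in> borel_measurable (LI T)"
  unfolding measurable_LI_iff by (rule borel_measurable_continuous_on_indicator) (use assms in auto)

lemma finite_measure_LI [simp, intro]: "finite_measure (LI T)"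
  by (rule finite_measureI) (simp add: LI_def emeasure_restrict_space space_restrict_space emeasure_lborel_Icc_eq)

interpretation LI: finite_measure "LI T" for T
  by (rule finite_measure_LI)

lemma sigma_finite_LI [simp, intro]: "sigma_finite_measure (LI T)"
  by unfold_locales

lemma measure_LI: "0 \<le> T \<Longrightarrow> measure (LI T) {0..T} = T"
  unfolding LI_def by (subst measure_restrict_space) auto

lemma set_lint_LI:
  fixes f :: "real \<Rightarrow> 'a::{banach,second_countable_topology}"
  shows "(LINT x:{0..T}|lborel. f x) = integral\<^sup>L (LI T) f"
  unfolding LI_def set_lebesgue_integral_def by (subst integral_restrict_space) auto

lemma set_integrable_LI:
  fixes f :: "real \<Rightarrow> 'a::{banach,second_countable_topology}"
  shows "set_integrable lborel {0..T} f \<longleftrightarrow> integrable (LI T) f"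
  unfolding LI_def set_integrable_def by (subst integrable_restrict_space) auto

lemma AE_LI: "(AE x in LI T. P x) \<longleftrightarrow> (AE x in lborel. x \<in> {0..T} \<longrightarrow> P x)"
  unfolding LI_def by (rule AE_restrict_space_iff) simp

lemma AE_LI_gt0: "AE x in LI T. 0 < x"
  unfolding AE_LI using AE_lborel_singleton[of "0::real"] by eventually_elim auto

lemma integrable_LI_continuous:
  fixes f :: "real \<Rightarrow> 'a::{banach,second_countable_topology}"
  assumes "continuous_on {0..T} f"
  shows "integrable (LI T) f"
  using borel_integrable_atLeastAtMost'[OF assms] by (simp add: set_integrable_LI)

lemma integral_LI_HK:
  fixes f :: "real \<Rightarrow> 'a::euclidean_space"
  assumes "continuous_on {0..T} f"
  shows "integral\<^sup>L (LI T) f = integral {0..T} f"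
  using set_borel_integral_eq_integral(2)[of "{0..T}" f] integrable_LI_continuous[OF assms]
  by (simp add: set_lint_LI set_integrable_LI)

lemma norm_integral_LI_le:
  fixes f :: "real \<Rightarrow> 'a::{banach,second_countable_topology}"
  assumes "AE x in LI T. norm (f x) \<le> B" "0 \<le> T" "0 \<le> B"
  shows "norm (integral\<^sup>L (LI T) f) \<le> B * T"
proof (cases "integrable (LI T) f")
  case True
  have "norm (integral\<^sup>L (LI T) f) \<le> (\<integral>x. norm (f x) \<partial>LI T)"
    by (rule integral_norm_bound)
  also have "\<dots> \<le> (\<integral>x. B \<partial>LI T)"
    by (rule integral_mono_AE) (use True assms in auto)
  also have "\<dots> = B * T" using assms by (simp add: measure_LI)
  finally show ?thesis .
next
  case False
  then show ?thesis using assms by (simp add: not_integrable_integral_eq)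
qed

text \<open>The test sets \<open>{0..b}\<close> generate the Borel sets of the interval, so a density that integrates
  to zero over each of them vanishes.\<close>

lemma AE_zero_if_integrals_zero_real:
  fixes F :: "real \<Rightarrow> real"
  assumes int: "integrable (LI T) F"
    and zero: "\<And>b. 0 < b \<Longrightarrow> b < T \<Longrightarrow> integral\<^sup>L (LI b) F = 0"
  shows "AE x in LI T. F x = 0"
proof -
  define G where "G x = indicator {0..<T} x * F x" for x
  have GF: "integrable lborel (\<lambda>x. indicator {0..T} x * F x)"
    using int unfolding LI_def by (subst (asm) integrable_restrict_space) auto
  have G: "integrable lborel G"
  proof -
    have "integrable lborel (\<lambda>x. indicator {0..<T} x *\<^sub>R (indicator {0..T} x * F x))"
      by (rule integrable_mult_indicator) (use GF in auto)
    moreover have "(\<lambda>x. indicator {0..<T} x *\<^sub>R (indicator {0..T} x * F x)) = G"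
      by (auto simp: G_def fun_eq_iff indicator_def)
    ultimately show ?thesis by simp
  qed
  have Gi: "integrable lborel (\<lambda>x. indicator A x * G x)" if "A \<in> sets borel" for A
    using integrable_mult_indicator[of A lborel G] G that by simp
  have below: "(\<integral>x. indicator {..b} x * G x \<partial>lborel) = 0" if "b < T" for b
  proof (cases "0 < b")
    case True
    have "(\<integral>x. indicator {..b} x * G x \<partial>lborel) = (\<integral>x. indicator {0..b} x *\<^sub>R F x \<partial>lborel)"
      by (rule Bochner_Integration.integral_cong) (use that in \<open>auto simp: G_def indicator_def\<close>)
    also have "\<dots> = integral\<^sup>L (LI b) F"
      unfolding LI_def by (subst integral_restrict_space) auto
    finally show ?thesis using zero[OF True that] by simp
  next
    case False
    have "AE x in lborel. indicator {..b} x * G x = 0"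
      using AE_lborel_singleton[of "0::real"]
      by eventually_elim (use False in \<open>auto simp: G_def indicator_def\<close>)
    then show ?thesis by (simp add: integral_eq_zero_AE)
  qed
  have total: "(\<integral>x. G x \<partial>lborel) = 0"
  proof -
    have "(\<lambda>n. \<integral>x. indicator {..T - 1 / real (Suc n)} x * G x \<partial>lborel) \<longlonglongrightarrow> (\<integral>x. G x \<partial>lborel)"
    proof (rule integral_dominated_convergence[where w="\<lambda>x. norm (G x)"])
      show "AE x in lborel. (\<lambda>n. indicator {..T - 1 / real (Suc n)} x * G x) \<longlonglongrightarrow> G x"
      proof (rule AE_I2)
        fix x :: real
        show "(\<lambda>n. indicator {..T - 1 / real (Suc n)} x * G x) \<longlonglongrightarrow> G x"
        proof (cases "x < T")
          case True
          have lim: "(\<lambda>n. T - 1 / real (Suc n)) \<longlonglongrightarrow> T - 0"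
            by (intro tendsto_intros LIMSEQ_Suc lim_1_over_n)
          have "\<forall>\<^sub>F n in sequentially. x < T - 1 / real (Suc n)"
            using order_tendstoD(1)[OF lim, of x] True by simp
          then have "\<forall>\<^sub>F n in sequentially. indicator {..T - 1 / real (Suc n)} x * G x = G x"
            by eventually_elim auto
          then show ?thesis by (rule tendsto_eventually)
        qed (simp add: G_def)
      qed
    qed (use G in \<open>auto simp: indicator_def\<close>)
    moreover have "(\<integral>x. indicator {..T - 1 / real (Suc n)} x * G x \<partial>lborel) = 0" for n
      by (rule below) simp
    ultimately have "(\<lambda>n. 0 :: real) \<longlonglongrightarrow> (\<integral>x. G x \<partial>lborel)" by simp
    then show ?thesis using LIMSEQ_unique tendsto_const by blast
  qed
  have all_below: "(\<integral>x. indicator {..b} x * G x \<partial>lborel) = 0" for b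
  proof (cases "b < T")
    case False
    then have "(\<integral>x. indicator {..b} x * G x \<partial>lborel) = (\<integral>x. G x \<partial>lborel)"
      by (intro Bochner_Integration.integral_cong) (auto simp: G_def indicator_def)
    then show ?thesis using total by simp
  qed (rule below)
  have sets: "(\<integral>x. indicator A x * G x \<partial>lborel) = 0" if "A \<in> sets borel" for A
    using that
  proof (induction rule: borel_set_induct)
    case (interval a b)
    have "(\<integral>x. indicator {a..b} x * G x \<partial>lborel)
        = (\<integral>x. indicator {..b} x * G x - indicator {..a} x * G x \<partial>lborel)"
    proof (rule integral_cong_AE)
      show "AE x in lborel. indicator {a..b} x * G x = indicator {..b} x * G x - indicator {..a} x * G x"
        using AE_lborel_singleton[of a]
        by eventually_elim (use interval in \<open>auto simp: indicator_def\<close>)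
    qed (use G in auto)
    also have "\<dots> = 0"
      by (subst Bochner_Integration.integral_diff) (auto intro: Gi simp: all_below)
    finally show ?case .
  next
    case (compl A)
    have "(\<integral>x. indicator (-A) x * G x \<partial>lborel) = (\<integral>x. G x - indicator A x * G x \<partial>lborel)"
      by (rule Bochner_Integration.integral_cong) (auto simp: indicator_def)
    also have "\<dots> = 0"
      by (subst Bochner_Integration.integral_diff) (use G Gi compl total in auto)
    finally show ?case .
  next
    case (union f)
    have "(\<integral>x. indicator (\<Union>i. f i) x *\<^sub>R G x \<partial>lborel) = (\<Sum>i. (\<integral>x. indicator (f i) x *\<^sub>R G x \<partial>lborel))"
      using lebesgue_integral_countable_add[of f lborel G] union Gi[of "\<Union>i. f i"]
      by (simp add: set_lebesgue_integral_def set_integrable_def disjoint_family_on_def)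
    then show ?case using union by simp
  qed auto
  have "AE x in lborel. G x = 0"
    by (rule density_unique_real) (use G sets in \<open>auto simp: set_lebesgue_integral_def\<close>)
  moreover have "AE x in lborel. x \<noteq> T" by (rule AE_lborel_singleton)
  ultimately show ?thesis
    unfolding AE_LI by eventually_elim (auto simp: G_def indicator_def)
qed

lemma AE_zero_if_integrals_zero:
  fixes F :: "real \<Rightarrow> complex"
  assumes int: "integrable (LI T) F"
    and zero: "\<And>b. 0 < b \<Longrightarrow> b < T \<Longrightarrow> integral\<^sup>L (LI b) F = 0"
  shows "AE x in LI T. F x = 0"
proof -
  have i: "integrable (LI b) F" if "b < T" for b
    unfolding set_integrable_LI[symmetric]
    by (rule set_integrable_subset[where A="{0..T}"]) (use int that in \<open>simp_all add: set_integrable_LI\<close>)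
  have "AE x in LI T. Re (F x) = 0"
  proof (rule AE_zero_if_integrals_zero_real)
    show "integrable (LI T) (\<lambda>x. Re (F x))"
      by (rule integrable_Re[OF int])
    show "integral\<^sup>L (LI b) (\<lambda>x. Re (F x)) = 0" if "0 < b" "b < T" for b
      by (subst integral_Re[OF i[OF that(2)]]) (simp add: zero[OF that])
  qed
  moreover have "AE x in LI T. Im (F x) = 0"
  proof (rule AE_zero_if_integrals_zero_real)
    show "integrable (LI T) (\<lambda>x. Im (F x))"
      by (rule integrable_Im[OF int])
    show "integral\<^sup>L (LI b) (\<lambda>x. Im (F x)) = 0" if "0 < b" "b < T" for b
      by (subst integral_Im[OF i[OF that(2)]]) (simp add: zero[OF that])
  qed
  ultimately show ?thesis by eventually_elim (simp add: complex_eq_iff)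
qed

lemma integral_LI_restrict:
  fixes f :: "real \<Rightarrow> complex"
  assumes b: "b \<in> {0..T}" and f: "f \<in> borel_measurable (LI T)" and P: "Measurable.pred borel P"
    and inside: "\<And>x. 0 < x \<Longrightarrow> x < b \<Longrightarrow> P x" and outside: "\<And>x. b < x \<Longrightarrow> \<not> P x"
  shows "(\<integral>x. of_bool (P x) * f x \<partial>LI T) = integral\<^sup>L (LI b) f"
proof -
  have m: "(\<lambda>x. of_bool (Q x) * f x) \<in> borel_measurable (LI T)" if [measurable]: "Measurable.pred borel Q" for Q
    by (rule borel_measurable_times[OF measurable_LI f]) measurable
  have "(\<integral>x. of_bool (P x) * f x \<partial>LI T) = (\<integral>x. of_bool (x \<le> b) * f x \<partial>LI T)"
  proof (rule integral_cong_AE)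
    show "AE x in LI T. of_bool (P x) * f x = of_bool (x \<le> b) * f x"
      unfolding AE_LI using AE_lborel_singleton[of 0] AE_lborel_singleton[of b]
      by eventually_elim (use inside outside in \<open>auto simp: not_le less_le\<close>)
  qed (intro m P, intro m, measurable)
  also have "\<dots> = (\<integral>x. indicator {0..T} x *\<^sub>R (of_bool (x \<le> b) * f x) \<partial>lborel)"
    unfolding LI_def by (subst integral_restrict_space) auto
  also have "\<dots> = (\<integral>x. indicator {0..b} x *\<^sub>R f x \<partial>lborel)"
    by (rule Bochner_Integration.integral_cong) (use b in \<open>auto simp: indicator_def\<close>)
  finally show ?thesis unfolding LI_def by (subst integral_restrict_space) auto
qed

text \<open>Integration by parts for absolutely continuous functions: both sides are integrals of
  \<open>p(\<sigma>) q(\<tau>)\<close> over the square, which the diagonal cuts into two triangles.\<close>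

lemma product_of_integrals:
  fixes p q :: "real \<Rightarrow> complex"
  assumes p: "integrable (LI t) p" and q: "integrable (LI t) q"
  shows "integral\<^sup>L (LI t) p * integral\<^sup>L (LI t) q =
      (\<integral>\<tau>. p \<tau> * integral\<^sup>L (LI \<tau>) q + integral\<^sup>L (LI \<tau>) p * q \<tau> \<partial>LI t)"
    and "integrable (LI t) (\<lambda>\<tau>. integral\<^sup>L (LI \<tau>) p * q \<tau>)"
proof -
  interpret pair_sigma_finite "LI t" "LI t" by (rule pair_sigma_finite.intro) auto
  have [measurable]: "p \<in> borel_measurable (LI t)" "q \<in> borel_measurable (LI t)"
    using p q by auto
  have [measurable]: "(\<lambda>x. x) \<in> borel_measurable (LI t)"
    by (rule measurable_LI) simp
  have pq: "integrable (LI t \<Otimes>\<^sub>M LI t) (\<lambda>(x, y). p x * q y)"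
  proof (rule Fubini_integrable)
    show "integrable (LI t) (\<lambda>x. \<integral>y. norm (case (x, y) of (x, y) \<Rightarrow> p x * q y) \<partial>LI t)"
      using p by (simp add: norm_mult)
    show "AE x in LI t. integrable (LI t) (\<lambda>y. case (x, y) of (x, y) \<Rightarrow> p x * q y)"
      using q by simp
  qed simp
  have tri1: "integrable (LI t \<Otimes>\<^sub>M LI t) (\<lambda>(x, y). of_bool (x \<le> y) * (p x * q y))"
    by (rule Bochner_Integration.integrable_bound[OF pq]) (auto simp: split_beta')
  have tri2: "integrable (LI t \<Otimes>\<^sub>M LI t) (\<lambda>(x, y). of_bool (y \<le> x) * (p x * q y))"
    by (rule Bochner_Integration.integrable_bound[OF pq]) (auto simp: split_beta')
  have cut: "(\<integral>x. of_bool (x \<le> \<tau>) * f x \<partial>LI t) = integral\<^sup>L (LI \<tau>) f"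
    if "\<tau> \<in> {0..t}" "f \<in> borel_measurable (LI t)" for \<tau> and f :: "real \<Rightarrow> complex"
    by (rule integral_LI_restrict[OF that]) auto
  have i1: "integrable (LI t) (\<lambda>\<tau>. \<integral>x. of_bool (x \<le> \<tau>) * (p x * q \<tau>) \<partial>LI t)"
    using integrable_snd[OF tri1] by simp
  have e1: "(\<integral>x. of_bool (x \<le> \<tau>) * (p x * q \<tau>) \<partial>LI t) = integral\<^sup>L (LI \<tau>) p * q \<tau>"
    if "\<tau> \<in> space (LI t)" for \<tau>
    using cut[of \<tau> p] that by (simp add: mult.assoc[symmetric])
  show i1': "integrable (LI t) (\<lambda>\<tau>. integral\<^sup>L (LI \<tau>) p * q \<tau>)"
    using i1 by (rule Bochner_Integration.integrable_cong[THEN iffD1, rotated -1]) (auto simp: e1)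
  have i2: "integrable (LI t) (\<lambda>\<tau>. \<integral>y. of_bool (y \<le> \<tau>) * (p \<tau> * q y) \<partial>LI t)"
    using integrable_fst[OF tri2] by simp
  have e2: "(\<integral>y. of_bool (y \<le> \<tau>) * (p \<tau> * q y) \<partial>LI t) = p \<tau> * integral\<^sup>L (LI \<tau>) q"
    if "\<tau> \<in> space (LI t)" for \<tau>
    using cut[of \<tau> q] that by (simp add: mult.left_commute)
  have i2': "integrable (LI t) (\<lambda>\<tau>. p \<tau> * integral\<^sup>L (LI \<tau>) q)"
    using i2 by (rule Bochner_Integration.integrable_cong[THEN iffD1, rotated -1]) (auto simp: e2)
  have "integral\<^sup>L (LI t) p * integral\<^sup>L (LI t) q = (\<integral>x. \<integral>y. p x * q y \<partial>LI t \<partial>LI t)"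
    by simp
  also have "\<dots> = integral\<^sup>L (LI t \<Otimes>\<^sub>M LI t) (\<lambda>(x, y). p x * q y)"
    using integral_fst[OF pq] by simp
  also have "\<dots> = integral\<^sup>L (LI t \<Otimes>\<^sub>M LI t) (\<lambda>z. (\<lambda>(x, y). of_bool (x \<le> y) * (p x * q y)) z
      + (\<lambda>(x, y). of_bool (y \<le> x) * (p x * q y)) z)"
  proof (rule integral_cong_AE)
    have "AE x in LI t. AE y in LI t. x \<noteq> y"
    proof (rule AE_I2)
      fix x
      show "AE y in LI t. x \<noteq> y"
        unfolding AE_LI using AE_lborel_singleton[of x] by eventually_elim auto
    qed
    then have "AE z in LI t \<Otimes>\<^sub>M LI t. fst z \<noteq> snd z"
      by (subst AE_pair_iff[symmetric]) auto
    then show "AE z in LI t \<Otimes>\<^sub>M LI t. (\<lambda>(x, y). p x * q y) z = (\<lambda>(x, y). of_bool (x \<le> y) * (p x * q y)) z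
      + (\<lambda>(x, y). of_bool (y \<le> x) * (p x * q y)) z"
      by eventually_elim auto
  qed (auto simp: split_beta')
  also have "\<dots> = (\<integral>\<tau>. \<integral>x. of_bool (x \<le> \<tau>) * (p x * q \<tau>) \<partial>LI t \<partial>LI t)
      + (\<integral>\<tau>. \<integral>y. of_bool (y \<le> \<tau>) * (p \<tau> * q y) \<partial>LI t \<partial>LI t)"
    using integral_snd[OF tri1] integral_fst[OF tri2] tri1 tri2 by simp
  also have "\<dots> = (\<integral>\<tau>. integral\<^sup>L (LI \<tau>) p * q \<tau> \<partial>LI t) + (\<integral>\<tau>. p \<tau> * integral\<^sup>L (LI \<tau>) q \<partial>LI t)"
    by (intro arg_cong2[where f="(+)"] Bochner_Integration.integral_cong refl e1 e2)
  also have "\<dots> = (\<integral>\<tau>. p \<tau> * integral\<^sup>L (LI \<tau>) q + integral\<^sup>L (LI \<tau>) p * q \<tau> \<partial>LI t)"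
    using i1' i2' by (simp add: add.commute)
  finally show "integral\<^sup>L (LI t) p * integral\<^sup>L (LI t) q =
      (\<integral>\<tau>. p \<tau> * integral\<^sup>L (LI \<tau>) q + integral\<^sup>L (LI \<tau>) p * q \<tau> \<partial>LI t)" .
qed

section \<open>Absolutely summable families over the integers\<close>

lemma infsum_int_suminf:
  fixes f :: "int \<Rightarrow> 'a::banach"
  assumes "(\<lambda>k. norm (f k)) summable_on UNIV"
  shows "infsum f UNIV = (\<Sum>n. f (int_decode n))" "summable (\<lambda>n. norm (f (int_decode n)))"
proof -
  have b: "bij_betw int_decode UNIV UNIV" by (rule bij_int_decode)
  have s: "(\<lambda>n. norm (f (int_decode n))) summable_on UNIV"
    using assms summable_on_reindex_bij_betw[OF b, of "\<lambda>k. norm (f k)"] by simp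
  then show "summable (\<lambda>n. norm (f (int_decode n)))"
    by (rule summable_on_imp_summable)
  have "infsum f UNIV = infsum (\<lambda>n. f (int_decode n)) UNIV"
    using infsum_reindex_bij_betw[OF b, of f] by simp
  moreover
  have "((\<lambda>n. f (int_decode n)) has_sum infsum (\<lambda>n. f (int_decode n)) UNIV) UNIV"
    by (rule has_sum_infsum) (rule abs_summable_summable[OF s])
  from sums_unique[OF has_sum_imp_sums[OF this]]
  have "infsum (\<lambda>n. f (int_decode n)) UNIV = (\<Sum>n. f (int_decode n))" .
  ultimately show "infsum f UNIV = (\<Sum>n. f (int_decode n))" by simp
qed

lemma infsum_norm_mono:
  fixes f :: "int \<Rightarrow> 'a::banach"
  assumes "\<And>k. norm (f k) \<le> B k" "B summable_on UNIV"
  shows "(\<lambda>k. norm (f k)) summable_on UNIV" "f summable_on UNIV" "norm (infsum f UNIV) \<le> infsum B UNIV"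
proof -
  show s: "(\<lambda>k. norm (f k)) summable_on UNIV"
    by (rule summable_on_comparison_test[OF assms(2)]) (use assms in auto)
  then show "f summable_on UNIV" by (rule abs_summable_summable)
  have "norm (infsum f UNIV) \<le> infsum (\<lambda>k. norm (f k)) UNIV"
    using s by (rule norm_infsum_bound)
  also have "\<dots> \<le> infsum B UNIV"
    using s assms by (intro infsum_mono)
  finally show "norm (infsum f UNIV) \<le> infsum B UNIV" .
qed

text \<open>The majorant is a summable sequence times an integrable function, and not just a summable
  sequence, because Fourier series are also multiplied by unbounded square integrable functions.\<close>

lemma integral_infsum:
  fixes f :: "int \<Rightarrow> 'a \<Rightarrow> complex"
  assumes meas: "\<And>k. f k \<in> borel_measurable M"
    and bound: "\<And>k x. x \<in> space M \<Longrightarrow> norm (f k x) \<le> B k * g x"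
    and B: "B summable_on UNIV"
    and g: "integrable M g"
  shows "integral\<^sup>L M (\<lambda>x. \<Sum>\<^sub>\<infinity>k. f k x) = (\<Sum>\<^sub>\<infinity>k. integral\<^sup>L M (f k))"
    and "integrable M (\<lambda>x. \<Sum>\<^sub>\<infinity>k. f k x)"
    and "(\<lambda>k. norm (integral\<^sup>L M (f k))) summable_on UNIV"
proof -
  have Bn: "(\<lambda>k. norm (B k)) summable_on UNIV"
    using B summable_on_iff_abs_summable_on_real[of B UNIV] by blast
  have bound': "norm (f k x) \<le> norm (B k) * norm (g x)" if "x \<in> space M" for k x
    using bound[OF that, of k] by (metis abs_ge_self norm_mult order_trans real_norm_def)
  have int: "integrable M (f k)" for k
    by (rule Bochner_Integration.integrable_bound[of _ "\<lambda>x. B k * norm (g x)"])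
       (use bound' meas g in \<open>auto simp: abs_mult\<close>)
  have ns: "(\<lambda>k. norm (f k x)) summable_on UNIV" if "x \<in> space M" for x
    by (rule infsum_norm_mono(1)[OF bound'[OF that]]) (intro summable_on_cmult_left Bn)
  have le: "norm (integral\<^sup>L M (\<lambda>x. norm (f k x))) \<le> norm (B k) * integral\<^sup>L M (\<lambda>x. norm (g x))" for k
  proof -
    have "integral\<^sup>L M (\<lambda>x. norm (f k x)) \<le> integral\<^sup>L M (\<lambda>x. norm (B k) * norm (g x))"
      by (rule integral_mono) (use int bound' g in auto)
    then show ?thesis by simp
  qed
  have BG: "(\<lambda>k. norm (B k) * integral\<^sup>L M (\<lambda>x. norm (g x))) summable_on UNIV"
    by (intro summable_on_cmult_left Bn)
  have s2: "summable (\<lambda>n. integral\<^sup>L M (\<lambda>x. norm (f (int_decode n) x)))"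
    using infsum_int_suminf(2)[OF infsum_norm_mono(1)[OF le BG]] by simp
  have eq: "(\<Sum>\<^sub>\<infinity>k. f k x) = (\<Sum>n. f (int_decode n) x)" if "x \<in> space M" for x
    by (rule infsum_int_suminf(1)[OF ns[OF that]])
  have ai: "integrable M (\<lambda>x. \<Sum>n. f (int_decode n) x)"
    by (rule integrable_suminf) (use int s2 infsum_int_suminf(2)[OF ns] in auto)
  show "integrable M (\<lambda>x. \<Sum>\<^sub>\<infinity>k. f k x)"
    by (rule Bochner_Integration.integrable_cong[THEN iffD1, OF refl _ ai]) (simp add: eq)
  have lek: "norm (integral\<^sup>L M (f k)) \<le> norm (B k) * integral\<^sup>L M (\<lambda>x. norm (g x))" for k
    using order_trans[OF integral_norm_bound[of M "f k"]] le[of k] by simp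
  then show ak: "(\<lambda>k. norm (integral\<^sup>L M (f k))) summable_on UNIV"
    by (rule infsum_norm_mono(1)) (rule BG)
  have "integral\<^sup>L M (\<lambda>x. \<Sum>\<^sub>\<infinity>k. f k x) = integral\<^sup>L M (\<lambda>x. \<Sum>n. f (int_decode n) x)"
    by (rule Bochner_Integration.integral_cong) (simp_all add: eq)
  also have "\<dots> = (\<Sum>n. integral\<^sup>L M (f (int_decode n)))"
    by (rule integral_suminf) (use int s2 infsum_int_suminf(2)[OF ns] in auto)
  also have "\<dots> = (\<Sum>\<^sub>\<infinity>k. integral\<^sup>L M (f k))"
    by (rule infsum_int_suminf(1)[OF ak, symmetric])
  finally show "integral\<^sup>L M (\<lambda>x. \<Sum>\<^sub>\<infinity>k. f k x) = (\<Sum>\<^sub>\<infinity>k. integral\<^sup>L M (f k))" .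
qed

text \<open>Tannery's theorem.\<close>

lemma tendsto_infsum_dominated:
  fixes f :: "'b \<Rightarrow> int \<Rightarrow> 'a::banach"
  assumes lim: "\<And>k. ((\<lambda>x. f x k) \<longlongrightarrow> g k) F"
    and bound: "eventually (\<lambda>x. \<forall>k. norm (f x k) \<le> B k) F"
    and B: "B summable_on UNIV"
  shows "((\<lambda>x. infsum (f x) UNIV) \<longlongrightarrow> infsum g UNIV) F"
proof (cases "F = bot")
  case False
  define S where "S = {x. \<forall>k. norm (f x k) \<le> B k}"
  have gB: "norm (g k) \<le> B k" for k
  proof (rule tendsto_upperbound[OF tendsto_norm[OF lim[of k]] _ False])
    show "\<forall>\<^sub>F x in F. norm (f x k) \<le> B k" using bound by eventually_elim blast
  qed
  have "uniform_limit S (\<lambda>X x. \<Sum>k\<in>X. f x k) (\<lambda>x. infsum (f x) UNIV) (finite_subsets_at_top UNIV)"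
    by (rule Weierstrass_m_test_general[OF _ B]) (auto simp: S_def)
  moreover have "((\<lambda>X. \<Sum>k\<in>X. g k) \<longlongrightarrow> infsum g UNIV) (finite_subsets_at_top UNIV)"
    by (rule infsum_tendsto) (rule infsum_norm_mono(2)[OF gB B])
  moreover have "\<forall>\<^sub>F x in F. x \<in> S" using bound by (simp add: S_def)
  ultimately show ?thesis
    by (intro swap_uniform_limit'[where f="\<lambda>X x. \<Sum>k\<in>X. f x k"]) (auto intro!: always_eventually tendsto_sum lim)
qed simp

lemma continuous_on_infsum:
  fixes f :: "'b::topological_space \<Rightarrow> int \<Rightarrow> 'a::banach"
  assumes "\<And>k. continuous_on S (\<lambda>x. f x k)"
    and "\<And>x k. x \<in> S \<Longrightarrow> norm (f x k) \<le> B k"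
    and "B summable_on UNIV"
  shows "continuous_on S (\<lambda>x. infsum (f x) UNIV)"
  unfolding continuous_on_def
proof (intro ballI tendsto_infsum_dominated[where B=B])
  fix x assume "x \<in> S"
  show "((\<lambda>y. f y k) \<longlongrightarrow> f x k) (at x within S)" for k
    using assms(1)[of k] \<open>x \<in> S\<close> by (auto simp: continuous_on_def)
  show "\<forall>\<^sub>F x in at x within S. \<forall>k. norm (f x k) \<le> B k"
    using assms(2) by (auto simp: eventually_at_filter)
qed (rule assms(3))

text \<open>The coefficients of the product of two Fourier series.\<close>

definition conv :: "(int \<Rightarrow> 'a) \<Rightarrow> (int \<Rightarrow> 'a) \<Rightarrow> int \<Rightarrow> 'a::{real_normed_field,banach}"
  where "conv f g k = (\<Sum>\<^sub>\<infinity>j. f (k - j) * g j)"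

context
  fixes f g :: "int \<Rightarrow> 'a::{real_normed_field,banach}"
  assumes f: "(\<lambda>k. norm (f k)) summable_on UNIV" and g: "(\<lambda>k. norm (g k)) summable_on UNIV"
begin

lemma conv_bij: "bij_betw (\<lambda>(k, j). (k - j, j)) (UNIV :: (int \<times> int) set) UNIV"
  by (rule bij_betwI[where g="\<lambda>(i, j). (i + j, j)"]) auto

lemma abs_summable_Times: "(\<lambda>(i, j). norm (f i * g j)) summable_on UNIV \<times> UNIV"
proof -
  have "(\<lambda>x. norm (case x of (i, j) \<Rightarrow> f i * g j)) summable_on UNIV \<times> UNIV"
    unfolding Infinite_Sum.abs_summable_on_Sigma_iff
  proof (intro conjI ballI)
    show "(\<lambda>y. norm (case (x, y) of (i, j) \<Rightarrow> f i * g j)) summable_on UNIV" for x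
      using summable_on_cmult_right[OF g, of "norm (f x)"] by (simp add: norm_mult)
    have "(\<lambda>x. norm (f x) * infsum (\<lambda>y. norm (g y)) UNIV) summable_on UNIV"
      by (intro summable_on_cmult_left f)
    moreover have "norm (infsum (\<lambda>y. norm (case (x, y) of (i, j) \<Rightarrow> f i * g j)) UNIV)
        = norm (f x) * infsum (\<lambda>y. norm (g y)) UNIV" for x
    proof -
      have "infsum (\<lambda>y. norm (g y)) UNIV \<ge> 0" by (rule infsum_nonneg) simp
      then show ?thesis by (simp add: norm_mult infsum_cmult_right' abs_mult)
    qed
    ultimately show "(\<lambda>x. norm (infsum (\<lambda>y. norm (case (x, y) of (i, j) \<Rightarrow> f i * g j)) UNIV)) summable_on UNIV"
      by simp
  qed
  then show ?thesis by (simp add: case_prod_unfold)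
qed

lemma conv_abs_summable_Times: "(\<lambda>(k, j). norm (f (k - j) * g j)) summable_on UNIV \<times> UNIV"
proof -
  have "(\<lambda>x. (\<lambda>(i, j). norm (f i * g j)) ((\<lambda>(k, j). (k - j, j)) x)) summable_on UNIV"
    by (rule iffD2[OF summable_on_reindex_bij_betw[OF conv_bij]]) (use abs_summable_Times in simp)
  then show ?thesis by (simp add: case_prod_unfold)
qed

lemma conv_summable_Times: "(\<lambda>(k, j). f (k - j) * g j) summable_on UNIV \<times> UNIV"
proof (rule abs_summable_summable)
  show "(\<lambda>x. norm (case x of (k, j) \<Rightarrow> f (k - j) * g j)) summable_on UNIV \<times> UNIV"
    using conv_abs_summable_Times by (simp add: case_prod_unfold)
qed

lemma conv_term_summable: "(\<lambda>j. norm (f (k - j) * g j)) summable_on UNIV"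
proof -
  have "(\<lambda>x. norm (case x of (k, j) \<Rightarrow> f (k - j) * g j)) summable_on UNIV \<times> UNIV"
    using conv_abs_summable_Times by (simp add: case_prod_unfold)
  from Infinite_Sum.abs_summable_on_Sigma_iff[THEN iffD1, OF this] show ?thesis by simp
qed

lemma conv_abs_summable: "(\<lambda>k. norm (conv f g k)) summable_on UNIV"
proof (rule infsum_norm_mono(1))
  show "norm (conv f g k) \<le> infsum (\<lambda>j. norm (f (k - j) * g j)) UNIV" for k
    unfolding conv_def by (rule norm_infsum_bound) (rule conv_term_summable)
  show "(\<lambda>k. infsum (\<lambda>j. norm (f (k - j) * g j)) UNIV) summable_on UNIV"
    using summable_on_Sigma_banach[OF conv_abs_summable_Times] .
qed

lemma infsum_conv: "infsum (conv f g) UNIV = infsum f UNIV * infsum g UNIV"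
proof -
  have "infsum (conv f g) UNIV = infsum (\<lambda>(k, j). f (k - j) * g j) (UNIV \<times> UNIV)"
    unfolding conv_def using infsum_Sigma'_banach[OF conv_summable_Times] .
  also have "\<dots> = infsum (\<lambda>(i, j). f i * g j) (UNIV \<times> UNIV)"
    using infsum_reindex_bij_betw[OF conv_bij, of "\<lambda>(i, j). f i * g j"]
    by (simp add: case_prod_unfold)
  also have "\<dots> = infsum (\<lambda>i. infsum (\<lambda>j. f i * g j) UNIV) UNIV"
  proof (rule infsum_Sigma'_banach[symmetric])
    show "(\<lambda>(i, j). f i * g j) summable_on UNIV \<times> UNIV"
    proof (rule abs_summable_summable)
      show "(\<lambda>x. norm (case x of (i, j) \<Rightarrow> f i * g j)) summable_on UNIV \<times> UNIV"
        using abs_summable_Times by (simp add: case_prod_unfold)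
    qed
  qed
  also have "\<dots> = infsum f UNIV * infsum g UNIV"
    by (simp add: infsum_cmult_right' infsum_cmult_left')
  finally show ?thesis .
qed

end

section \<open>Fourier series on the circle\<close>

definition fe :: "int \<Rightarrow> real \<Rightarrow> complex"
  where "fe k x = cis (2 * pi * of_int k * x)"

definition fc :: "(real \<Rightarrow> complex) \<Rightarrow> int \<Rightarrow> complex"
  where "fc f k = (\<integral>x. f x * fe (- k) x \<partial>LI 1)"

definition fs :: "(int \<Rightarrow> complex) \<Rightarrow> real \<Rightarrow> complex"
  where "fs c x = (\<Sum>\<^sub>\<infinity>k. c k * fe k x)"

abbreviation fsym :: "int \<Rightarrow> complex"
  where "fsym k \<equiv> 2 * of_real pi * \<i> * of_int k"

lemma norm_fe [simp]: "norm (fe k x) = 1"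
  by (simp add: fe_def)

lemma fe_0 [simp]: "fe 0 x = 1"
  by (simp add: fe_def)

lemma fe_add: "fe (k + l) x = fe k x * fe l x"
  by (simp add: fe_def cis_mult algebra_simps)

lemma fe_minus: "fe (- k) x = cnj (fe k x)"
  by (simp add: fe_def cis_cnj)

lemma fe_period [simp]: "fe k (x + 1) = fe k x"
proof -
  have "fe k (x + 1) = fe k x * cis (2 * pi * of_int k)"
    by (simp add: fe_def cis_mult algebra_simps)
  also have "cis (2 * pi * of_int k) = 1"
    using cis_multiple_2pi[of "of_int k"] by (simp add: mult.commute)
  finally show ?thesis by simp
qed

lemma continuous_on_fe [continuous_intros]: "continuous_on S (fe k)"
  unfolding fe_def by (intro continuous_intros)

lemma measurable_fe [measurable]: "fe k \<in> borel_measurable borel"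
  by (rule borel_measurable_continuous_onI) (rule continuous_on_fe)

lemma has_vector_derivative_fe:
  "((\<lambda>x. fe k x) has_vector_derivative (fsym k) * fe k x) (at x within S)"
proof -
  have "((\<lambda>z. exp (fsym k * z)) has_field_derivative
      (fsym k) * exp (fsym k * of_real x)) (at (of_real x))"
    by (auto intro!: derivative_eq_intros)
  then have "((\<lambda>x. exp (fsym k * of_real x)) has_vector_derivative
      (fsym k) * exp (fsym k * of_real x)) (at x within S)"
    by (rule has_vector_derivative_real_field)
  then show ?thesis by (simp add: fe_def cis_conv_exp mult_ac)
qed

lemma integrable_mult_bounded:
  fixes f g :: "'a \<Rightarrow> complex"
  assumes f: "integrable M f" and g: "g \<in> borel_measurable M"
    and B: "\<And>x. x \<in> space M \<Longrightarrow> norm (g x) \<le> B"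
  shows "integrable M (\<lambda>x. f x * g x)"
proof (rule Bochner_Integration.integrable_bound)
  show "integrable M (\<lambda>x. f x * complex_of_real B)" using f by simp
  show "(\<lambda>x. f x * g x) \<in> borel_measurable M"
    using f g by (intro borel_measurable_times) auto
  have "norm (f x) * norm (g x) \<le> norm (f x) * \<bar>B\<bar>" if "x \<in> space M" for x
    using B[OF that] by (intro mult_left_mono) auto
  then show "AE x in M. norm (f x * g x) \<le> norm (f x * complex_of_real B)"
    by (intro AE_I2) (simp add: norm_mult)
qed

lemma integrable_mult_fe: "integrable (LI 1) f \<Longrightarrow> integrable (LI 1) (\<lambda>x. f x * fe k x)"
  by (rule integrable_mult_bounded[where B=1]) (auto intro: measurable_LI)

lemma integral_fe: "integral\<^sup>L (LI 1) (fe k) = of_bool (k = 0)"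
proof (cases "k = 0")
  case True
  have "fe 0 = (\<lambda>_. 1)" by (rule ext) simp
  then show ?thesis using True by (simp add: measure_LI)
next
  case False
  have "integral\<^sup>L (LI 1) (fe k) = integral {0..1} (fe k)"
    by (rule integral_LI_HK) (rule continuous_on_fe)
  also have "\<dots> = fe k 1 / (fsym k) - fe k 0 / (fsym k)"
  proof (rule integral_unique, rule fundamental_theorem_of_calculus)
    fix x :: real
    have "((\<lambda>x. fe k x / (fsym k)) has_vector_derivative
        ((fsym k) * fe k x) / (fsym k)) (at x within {0..1})"
      by (rule has_vector_derivative_divide) (rule has_vector_derivative_fe)
    then show "((\<lambda>x. fe k x / (fsym k)) has_vector_derivative fe k x) (at x within {0..1})"
      using False by simp
  qed simp
  also have "\<dots> = 0" using fe_period[of k 0] by simp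
  finally show ?thesis using False by simp
qed

subsection \<open>Uniqueness of Fourier coefficients\<close>

text \<open>Products of trigonometric polynomials are trigonometric polynomials, so every real polynomial
  in the point \<open>cis (2 \<pi> x)\<close> of the circle is one.\<close>

inductive trig_poly :: "(real \<Rightarrow> complex) \<Rightarrow> bool" where
  mono: "trig_poly (\<lambda>x. c * fe k x)"
| add: "trig_poly f \<Longrightarrow> trig_poly g \<Longrightarrow> trig_poly (\<lambda>x. f x + g x)"

lemma trig_poly_mult_fe: "trig_poly f \<Longrightarrow> trig_poly (\<lambda>x. c * fe k x * f x)"
proof (induction rule: trig_poly.induct)
  case (mono d l)
  then show ?case using trig_poly.mono[of "c * d" "k + l"] by (simp add: fe_add mult_ac)
next
  case (add f g)
  then show ?case using trig_poly.add by (simp add: distrib_left)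
qed

lemma trig_poly_mult: "trig_poly f \<Longrightarrow> trig_poly g \<Longrightarrow> trig_poly (\<lambda>x. f x * g x)"
proof (induction rule: trig_poly.induct)
  case (mono c k)
  then show ?case by (rule trig_poly_mult_fe)
next
  case (add f h)
  then show ?case using trig_poly.add[of "\<lambda>x. f x * g x" "\<lambda>x. h x * g x"]
    by (simp add: distrib_right)
qed

lemma trig_poly_real_polynomial:
  assumes "real_polynomial_function p"
  shows "trig_poly (\<lambda>x. complex_of_real (p (cis (2 * pi * x))))"
  using assms
proof (induction rule: real_polynomial_function.induct)
  case (linear f)
  interpret bounded_linear f by (rule linear)
  have "complex_of_real (f (cis (2 * pi * x)))
      = (f 1 / 2 + f \<i> / (2 * \<i>)) * fe 1 x + (f 1 / 2 - f \<i> / (2 * \<i>)) * fe (- 1) x" for x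
  proof -
    have "f (cis (2 * pi * x)) = f (cos (2 * pi * x) *\<^sub>R 1 + sin (2 * pi * x) *\<^sub>R \<i>)"
      by (rule arg_cong[where f=f]) (simp add: complex_eq_iff)
    also have "\<dots> = cos (2 * pi * x) * f 1 + sin (2 * pi * x) * f \<i>"
      by (simp only: add scaleR) simp
    finally show ?thesis
      by (simp add: fe_def complex_eq_iff field_simps)
  qed
  then show ?case using trig_poly.add[OF trig_poly.mono trig_poly.mono] by simp
next
  case (const c)
  then show ?case using trig_poly.mono[of "of_real c" 0] by simp
next
  case (add f g)
  then show ?case using trig_poly.add by simp
next
  case (mult f g)
  then show ?case using trig_poly_mult by simp
qed

lemma integral_mult_trig_poly:
  assumes f: "integrable (LI 1) f" and zero: "\<And>k. fc f k = 0" and "trig_poly p"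
  shows "integrable (LI 1) (\<lambda>x. f x * p x) \<and> (\<integral>x. f x * p x \<partial>LI 1) = 0"
  using assms(3)
proof (induction rule: trig_poly.induct)
  case (mono c k)
  have i: "integrable (LI 1) (\<lambda>x. f x * fe k x)"
    by (rule integrable_mult_fe[OF f])
  have "(\<integral>x. c * (f x * fe k x) \<partial>LI 1) = 0"
    using zero[of "- k"] by (simp add: fc_def)
  moreover have "integrable (LI 1) (\<lambda>x. c * (f x * fe k x))" using i by simp
  ultimately show ?case by (simp add: mult_ac)
next
  case (add p q)
  then show ?case by (simp add: distrib_left)
qed

lemma integral_mult_continuous_circle:
  fixes h :: "complex \<Rightarrow> real"
  assumes f: "integrable (LI 1) f" and zero: "\<And>k. fc f k = 0"
    and h: "continuous_on UNIV h"
  shows "(\<integral>x. f x * complex_of_real (h (cis (2 * pi * x))) \<partial>LI 1) = 0"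
proof -
  define N where "N = (\<integral>x. norm (f x) \<partial>LI 1)"
  have hm [measurable]: "h \<in> borel_measurable borel" using h by (rule borel_measurable_continuous_onI)
  have "norm (\<integral>x. f x * complex_of_real (h (cis (2 * pi * x))) \<partial>LI 1) \<le> e" if "e > 0" for e
  proof -
    have N: "N \<ge> 0" by (simp add: N_def)
    have "0 < e / (N + 1)" using that N by simp
    then obtain p where p: "real_polynomial_function p"
      and hp: "\<And>z. z \<in> sphere 0 1 \<Longrightarrow> \<bar>h z - p z\<bar> < e / (N + 1)"
      by (rule Stone_Weierstrass_real_polynomial_function[of "sphere (0::complex) 1" h "e / (N + 1)",
            OF compact_sphere continuous_on_subset[OF h subset_UNIV]]) blast
    define P where "P x = complex_of_real (p (cis (2 * pi * x)))" for x
    define H where "H x = complex_of_real (h (cis (2 * pi * x)))" for x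
    have P: "integrable (LI 1) (\<lambda>x. f x * P x)" "(\<integral>x. f x * P x \<partial>LI 1) = 0"
      using integral_mult_trig_poly[OF f zero trig_poly_real_polynomial[OF p]] by (auto simp: P_def)
    have Hm: "H \<in> borel_measurable (LI 1)"
      unfolding H_def by (rule measurable_LI_continuous)
        (intro continuous_intros continuous_on_compose2[OF h], auto)
    have dH: "norm (H x - P x) \<le> e / (N + 1)" for x
      unfolding H_def P_def of_real_diff[symmetric] norm_of_real
      using hp[of "cis (2 * pi * x)"] by simp
    have dint: "integrable (LI 1) (\<lambda>x. f x * (H x - P x))"
    proof (rule Bochner_Integration.integrable_bound)
      show "integrable (LI 1) (\<lambda>x. f x * complex_of_real (e / (N + 1)))" using f by simp
      have "(\<lambda>x. f x * (H x) - f x * P x) \<in> borel_measurable (LI 1)"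
        using borel_measurable_diff[OF borel_measurable_times[OF borel_measurable_integrable[OF f] Hm]
            borel_measurable_integrable[OF P(1)]] .
      then show "(\<lambda>x. f x * (H x - P x)) \<in> borel_measurable (LI 1)"
        by (simp add: right_diff_distrib)
      show "AE x in LI 1. norm (f x * (H x - P x)) \<le> norm (f x * complex_of_real (e / (N + 1)))"
      proof (rule AE_I2)
        fix x
        have "norm (complex_of_real (e / (N + 1))) = e / (N + 1)"
          unfolding norm_of_real using that N by simp
        then show "norm (f x * (H x - P x)) \<le> norm (f x * complex_of_real (e / (N + 1)))"
          unfolding norm_mult by (intro mult_left_mono) (use dH in auto)
      qed
    qed
    have "(\<integral>x. f x * H x \<partial>LI 1) = (\<integral>x. f x * (H x - P x) + f x * P x \<partial>LI 1)"
      by (simp add: right_diff_distrib)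
    also have "\<dots> = (\<integral>x. f x * (H x - P x) \<partial>LI 1)"
      using dint P by simp
    finally have "norm (\<integral>x. f x * H x \<partial>LI 1) \<le> (\<integral>x. norm (f x * (H x - P x)) \<partial>LI 1)"
      using integral_norm_bound by simp
    also have "\<dots> \<le> (\<integral>x. norm (f x) * (e / (N + 1)) \<partial>LI 1)"
    proof (rule integral_mono)
      show "norm (f x * (H x - P x)) \<le> norm (f x) * (e / (N + 1))" for x
        unfolding norm_mult by (intro mult_left_mono dH) simp
    qed (intro integrable_norm dint integrable_mult_left f)+
    also have "\<dots> = N * (e / (N + 1))" by (simp add: N_def)
    also have "\<dots> \<le> e" using that N by (simp add: field_simps)
    finally show ?thesis by (simp add: H_def)
  qed
  then have "norm (\<integral>x. f x * complex_of_real (h (cis (2 * pi * x))) \<partial>LI 1) \<le> 0"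
    by (rule field_le_epsilon) simp
  then show ?thesis by simp
qed

text \<open>The points with parameter in \<open>{0<..<b}\<close> are those beyond the chord that joins the endpoints.\<close>

lemma cos_arc:
  assumes "0 < b" "b < 1" "0 \<le> x" "x \<le> 1"
  shows "cos (pi * b) < cos (2 * pi * x - pi * b) \<longleftrightarrow> 0 < x \<and> x < b"
proof -
  define y where "y = 2 * pi * x - pi * b"
  have pb: "0 < pi * b" "pi * b < pi" using assms by simp_all
  show ?thesis
  proof (cases "0 < x \<and> x < b")
    case True
    have "\<bar>y\<bar> < pi * b"
    proof -
      have "pi * x < pi * b" "0 < pi * x" using True by simp_all
      then show ?thesis by (auto simp: y_def abs_if)
    qed
    then have "cos (pi * b) < cos \<bar>y\<bar>"
      using pb by (intro cos_monotone_0_pi) auto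
    then show ?thesis using True by (simp add: y_def)
  next
    case False
    have "cos y \<le> cos (pi * b)"
    proof (cases "x = 0")
      case False
      then have "pi * b \<le> pi * x" "pi * x \<le> pi" using \<open>\<not> (0 < x \<and> x < b)\<close> assms by auto
      then have y: "pi * b \<le> y" "y \<le> 2 * pi - pi * b" by (auto simp: y_def)
      show ?thesis
      proof (cases "y \<le> pi")
        case True
        then show ?thesis using y pb by (intro cos_monotone_0_pi_le) auto
      next
        case False
        have "cos y = cos (2 * pi - y)" by (simp add: cos_diff)
        also have "\<dots> \<le> cos (pi * b)" using False y pb by (intro cos_monotone_0_pi_le) auto
        finally show ?thesis .
      qed
    qed (simp add: y_def)
    then show ?thesis using False by (auto simp: y_def)
  qed
qed

text \<open>Countably many translates of a null set cover the exceptional set.\<close>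

lemma AE_periodic:
  assumes "AE x in LI 1. P x" and per: "\<And>x::real. P (x + 1) \<longleftrightarrow> P x"
  shows "AE x in lborel. P x"
proof -
  obtain N where N: "N \<in> null_sets lborel" "{x. \<not> (x \<in> {0..1} \<longrightarrow> P x)} \<subseteq> N"
    using assms(1)[unfolded AE_LI] unfolding eventually_ae_filter by auto
  have shift: "P (x + of_int n) \<longleftrightarrow> P x" for x and n :: int
  proof (induction n rule: int_induct[where k=0])
    case (step1 i)
    then show ?case using per[of "x + of_int i"] by (simp add: add.assoc)
  next
    case (step2 i)
    then show ?case using per[of "x + of_int (i - 1)"] by (simp add: algebra_simps)
  qed simp
  have "AE x in lborel. \<forall>n::int. x + of_int n \<notin> N"
  proof (subst AE_all_countable, intro allI)
    fix n :: int
    have [measurable]: "N \<in> sets borel" using N(1) by (auto simp: null_sets_def)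
    have "AE y in distr lborel borel ((+) (of_int n)). y \<notin> N"
      unfolding lborel_distr_plus using N(1) by (rule AE_not_in)
    then have "AE x in lborel. of_int n + x \<notin> N"
      by (subst (asm) AE_distr_iff) auto
    then show "AE x in lborel. x + of_int n \<notin> N" by (simp add: add.commute)
  qed
  then show ?thesis
  proof eventually_elim
    case (elim x)
    have "x + of_int (- \<lfloor>x\<rfloor>) \<in> {0..1}"
      by simp linarith
    moreover have "x + of_int (- \<lfloor>x\<rfloor>) \<notin> N" using elim by blast
    ultimately have "P (x + of_int (- \<lfloor>x\<rfloor>))" using N(2) by blast
    then show ?case unfolding shift .
  qed
qed

text \<open>Stone--Weierstrass on the unit circle makes \<open>f\<close> orthogonal to every continuous function of
  \<open>cis (2 \<pi> x)\<close>. An arc is where the height over a chord is positive, so its indicator is a bounded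
  limit of such functions, and \<open>f\<close> integrates to zero over every \<open>{0..b}\<close>.\<close>

lemma AE_zero_if_fc_zero:
  assumes f: "integrable (LI 1) f" and zero: "\<And>k. fc f k = 0"
  shows "AE x in LI 1. f x = 0"
proof (rule AE_zero_if_integrals_zero[OF f])
  fix b :: real assume b: "0 < b" "b < 1"
  define h where "h n z = min 1 (real n * max 0 (Re (z * cis (- pi * b)) - cos (pi * b)))" for n z
  have h_cont: "continuous_on UNIV (h n)" for n
    unfolding h_def by (intro continuous_intros)
  have "(\<lambda>n. \<integral>x. f x * complex_of_real (h n (cis (2 * pi * x))) \<partial>LI 1)
      \<longlonglongrightarrow> (\<integral>x. f x * of_bool (0 < x \<and> x < b) \<partial>LI 1)"
  proof (rule integral_dominated_convergence[where w="\<lambda>x. norm (f x)"])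
    show "(\<lambda>x. f x * of_bool (0 < x \<and> x < b)) \<in> borel_measurable (LI 1)"
      by (rule borel_measurable_times[OF borel_measurable_integrable[OF f] measurable_LI]) measurable
    show "(\<lambda>x. f x * complex_of_real (h n (cis (2 * pi * x)))) \<in> borel_measurable (LI 1)" for n
      by (rule borel_measurable_times[OF borel_measurable_integrable[OF f] measurable_LI_continuous])
        (intro continuous_intros continuous_on_compose2[OF h_cont], auto)
    have h01: "0 \<le> h n z" "h n z \<le> 1" for n z by (auto simp: h_def)
    show "AE x in LI 1. norm (f x * complex_of_real (h n (cis (2 * pi * x)))) \<le> norm (f x)" for n
      using h01 by (intro AE_I2) (auto simp: norm_mult intro!: mult_right_le_one_le)
    show "AE x in LI 1. (\<lambda>n. f x * complex_of_real (h n (cis (2 * pi * x))))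
        \<longlonglongrightarrow> f x * of_bool (0 < x \<and> x < b)"
    proof (rule AE_I2)
      fix x assume x: "x \<in> space (LI 1)"
      define d where "d = cos (2 * pi * x - pi * b) - cos (pi * b)"
      have d: "0 < d \<longleftrightarrow> 0 < x \<and> x < b" using cos_arc[OF b] x by (auto simp: d_def)
      have hd: "h n (cis (2 * pi * x)) = min 1 (real n * max 0 d)" for n
        by (simp add: h_def cis_mult d_def)
      have "(\<lambda>n. h n (cis (2 * pi * x))) \<longlonglongrightarrow> of_bool (0 < x \<and> x < b)"
      proof (cases "0 < d")
        case True
        obtain m :: nat where m: "1 / d < real m" using reals_Archimedean2 by blast
        have "\<forall>\<^sub>F n in sequentially. h n (cis (2 * pi * x)) = of_bool (0 < x \<and> x < b)"
        proof (rule eventually_sequentiallyI)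
          fix n assume "m \<le> n"
          then have "1 / d < real n" using m by linarith
          then have "1 < real n * d" using True by (simp add: field_simps)
          then show "h n (cis (2 * pi * x)) = of_bool (0 < x \<and> x < b)"
            using True d by (simp add: hd max_def min_def)
        qed
        then show ?thesis by (rule tendsto_eventually)
      next
        case False
        then have "max 0 d = 0" "\<not> (0 < x \<and> x < b)" using d by auto
        then show ?thesis by (simp only: hd) simp
      qed
      then have "(\<lambda>n. complex_of_real (h n (cis (2 * pi * x)))) \<longlonglongrightarrow> complex_of_real (of_bool (0 < x \<and> x < b))"
        by (rule tendsto_of_real)
      moreover have "complex_of_real (of_bool (0 < x \<and> x < b)) = of_bool (0 < x \<and> x < b)"
        by (simp add: of_bool_def)
      ultimately have "(\<lambda>n. complex_of_real (h n (cis (2 * pi * x)))) \<longlonglongrightarrow> of_bool (0 < x \<and> x < b)"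
        by (simp only:)
      then show "(\<lambda>n. f x * complex_of_real (h n (cis (2 * pi * x)))) \<longlonglongrightarrow> f x * of_bool (0 < x \<and> x < b)"
        by (rule tendsto_mult_left)
    qed
  qed (use f in auto)
  then have "(\<integral>x. f x * of_bool (0 < x \<and> x < b) \<partial>LI 1) = 0"
    unfolding integral_mult_continuous_circle[OF f zero h_cont]
    by (metis LIMSEQ_unique tendsto_const)
  also have "(\<integral>x. f x * of_bool (0 < x \<and> x < b) \<partial>LI 1) = integral\<^sup>L (LI b) f"
    unfolding mult.commute[of "f _"]
    by (rule integral_LI_restrict[OF _ borel_measurable_integrable[OF f]]) (use b in auto)
  finally show "integral\<^sup>L (LI b) f = 0" by simp
qed


lemma torus_L2_diff_const:
  assumes "torus_L2 w"
  shows "torus_L2 (\<lambda>x. w x - c)"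
proof -
  have m: "w \<in> borel_measurable borel" and i: "integrable (LI 1) (\<lambda>x. (cmod (w x))\<^sup>2)"
    and p: "periodic1 w"
    using assms by (auto simp: torus_L2_def set_integrable_LI)
  have "integrable (LI 1) (\<lambda>x. (cmod (w x - c))\<^sup>2)"
  proof (rule Bochner_Integration.integrable_bound)
    show "integrable (LI 1) (\<lambda>x. 2 * (cmod (w x))\<^sup>2 + 2 * (cmod c)\<^sup>2)" using i by simp
    show "(\<lambda>x. (cmod (w x - c))\<^sup>2) \<in> borel_measurable (LI 1)"
    proof -
      note [measurable] = m
      show ?thesis by (rule measurable_LI) measurable
    qed
    have "(cmod (z - c))\<^sup>2 \<le> 2 * (cmod z)\<^sup>2 + 2 * (cmod c)\<^sup>2" for z
    proof -
      have "(cmod (z - c))\<^sup>2 \<le> (cmod z + cmod c)\<^sup>2"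
        by (intro power_mono norm_triangle_ineq4) simp
      also have "\<dots> \<le> 2 * (cmod z)\<^sup>2 + 2 * (cmod c)\<^sup>2"
        using zero_le_power2[of "cmod z - cmod c"] by (simp add: power2_eq_square algebra_simps)
      finally show ?thesis .
    qed
    then show "AE x in LI 1. norm ((cmod (w x - c))\<^sup>2) \<le> norm (2 * (cmod (w x))\<^sup>2 + 2 * (cmod c)\<^sup>2)"
      by simp
  qed
  then show ?thesis
    using m p by (auto simp: torus_L2_def set_integrable_LI periodic1_def)
qed

lemma torus_L2_D:
  assumes "torus_L2 w"
  shows "w \<in> borel_measurable borel" "w \<in> borel_measurable (LI 1)"
    "integrable (LI 1) (\<lambda>x. (cmod (w x))\<^sup>2)" "integrable (LI 1) w" "w (x + 1) = w x"
proof -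
  show m: "w \<in> borel_measurable borel" and i: "integrable (LI 1) (\<lambda>x. (cmod (w x))\<^sup>2)"
    and "w (x + 1) = w x"
    using assms by (auto simp: torus_L2_def set_integrable_LI periodic1_def)
  show "w \<in> borel_measurable (LI 1)" using m by (rule measurable_LI)
  then show "integrable (LI 1) w"
  proof (rule Bochner_Integration.integrable_bound[rotated])
    show "integrable (LI 1) (\<lambda>x. 1 + (cmod (w x))\<^sup>2)" using i by simp
    have "r \<le> 1 + r\<^sup>2" for r :: real
      using zero_le_power2[of "r - 1/2"] by (simp add: power2_eq_square algebra_simps)
    then show "AE x in LI 1. norm (w x) \<le> norm (1 + (cmod (w x))\<^sup>2)" by simp
  qed
qed

lemma L2_norm_torus_LI: "L2_norm_torus f = sqrt (\<integral>x. (cmod (f x))\<^sup>2 \<partial>LI 1)"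
  unfolding L2_norm_torus_def set_lint_LI ..

lemma L2_norm_torus_sq: "(L2_norm_torus f)\<^sup>2 = (\<integral>x. (cmod (f x))\<^sup>2 \<partial>LI 1)"
  unfolding L2_norm_torus_LI by simp

lemma fc_diff:
  assumes "integrable (LI 1) f" "integrable (LI 1) g"
  shows "fc (\<lambda>x. f x - g x) k = fc f k - fc g k"
  unfolding fc_def left_diff_distrib
  by (rule Bochner_Integration.integral_diff) (intro integrable_mult_fe assms)+

lemma fc_const: "fc (\<lambda>_. c) k = (if k = 0 then c else 0)"
  using integral_fe[of "- k"] by (simp add: fc_def)

lemma AE_eq_if_fc_eq:
  assumes "torus_L2 f" "torus_L2 g" "\<And>k. fc f k = fc g k"
  shows "AE x in lborel. f x = g x"
proof (rule AE_periodic)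
  have "AE x in LI 1. f x - g x = 0"
    by (rule AE_zero_if_fc_zero) (use assms torus_L2_D(4) in \<open>auto simp: fc_diff\<close>)
  then show "AE x in LI 1. f x = g x" by simp
qed (simp add: torus_L2_D(5)[OF assms(1)] torus_L2_D(5)[OF assms(2)])

text \<open>Expand the square of the distance from \<open>f\<close> to its Fourier polynomial \<open>p\<close>.\<close>

lemma Bessel:
  assumes f: "f \<in> borel_measurable (LI 1)" "integrable (LI 1) (\<lambda>x. (cmod (f x))\<^sup>2)" "integrable (LI 1) f"
    and K: "finite K"
  shows "(\<Sum>k\<in>K. (cmod (fc f k))\<^sup>2) \<le> (\<integral>x. (cmod (f x))\<^sup>2 \<partial>LI 1)"
proof -
  define p where "p x = (\<Sum>k\<in>K. fc f k * fe k x)" for x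
  define S where "S = (\<Sum>k\<in>K. (cmod (fc f k))\<^sup>2)"
  have p_cont: "continuous_on A p" for A
    unfolding p_def by (intro continuous_intros continuous_on_fe)
  have p_bound: "norm (cnj (p x)) \<le> (\<Sum>k\<in>K. norm (fc f k))" for x
    unfolding p_def complex_mod_cnj
    by (rule order_trans[OF norm_sum]) (simp add: norm_mult)
  have fp: "integrable (LI 1) (\<lambda>x. f x * cnj (p x))"
    by (rule integrable_mult_bounded[OF f(3) _ p_bound])
       (intro measurable_LI_continuous continuous_intros p_cont)
  have pp: "integrable (LI 1) (\<lambda>x. p x * cnj (p x))"
    by (intro integrable_LI_continuous continuous_intros p_cont)
  have cross: "(\<integral>x. g x * cnj (p x) \<partial>LI 1) = (\<Sum>k\<in>K. cnj (fc f k) * fc g k)"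
    if g: "integrable (LI 1) g" for g
  proof -
    have "(\<integral>x. g x * cnj (p x) \<partial>LI 1) = (\<integral>x. (\<Sum>k\<in>K. cnj (fc f k) * (g x * fe (- k) x)) \<partial>LI 1)"
      by (rule Bochner_Integration.integral_cong)
         (simp_all add: p_def sum_distrib_left fe_minus mult_ac)
    also have "\<dots> = (\<Sum>k\<in>K. \<integral>x. cnj (fc f k) * (g x * fe (- k) x) \<partial>LI 1)"
      by (rule Bochner_Integration.integral_sum) (intro integrable_mult_right integrable_mult_fe g)
    also have "\<dots> = (\<Sum>k\<in>K. cnj (fc f k) * fc g k)" by (simp add: fc_def)
    finally show ?thesis .
  qed
  have fcp: "fc p k = fc f k" if "k \<in> K" for k
  proof -
    have "fc p k = (\<integral>x. (\<Sum>l\<in>K. fc f l * fe (l - k) x) \<partial>LI 1)"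
      unfolding fc_def[of p] p_def sum_distrib_right
      by (rule Bochner_Integration.integral_cong) (simp_all add: fe_add[symmetric] mult.assoc)
    also have "\<dots> = (\<Sum>l\<in>K. \<integral>x. fc f l * fe (l - k) x \<partial>LI 1)"
      by (rule Bochner_Integration.integral_sum)
         (intro integrable_mult_right integrable_LI_continuous continuous_on_fe)
    also have "\<dots> = (\<Sum>l\<in>K. fc f l * of_bool (l - k = 0))"
      using integral_fe by simp
    also have "\<dots> = fc f k" using that K by (simp add: sum.remove of_bool_def if_distrib cong: if_cong)
    finally show ?thesis .
  qed
  have S1: "(\<integral>x. f x * cnj (p x) \<partial>LI 1) = of_real S"
    unfolding cross[OF f(3)] S_def of_real_sum
    by (rule sum.cong) (simp_all only: complex_norm_square mult.commute)
  have "(\<integral>x. p x * cnj (p x) \<partial>LI 1) = of_real S"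
    unfolding cross[OF integrable_LI_continuous[OF p_cont]] S_def of_real_sum
    by (rule sum.cong) (simp_all only: fcp complex_norm_square mult.commute)
  then have S2: "(\<integral>x. Re (p x * cnj (p x)) \<partial>LI 1) = S"
    using integral_Re[OF pp] by simp
  have S1': "(\<integral>x. Re (f x * cnj (p x)) \<partial>LI 1) = S"
    using integral_Re[OF fp] S1 by simp
  have "(cmod (f x - p x))\<^sup>2 = (cmod (f x))\<^sup>2 - 2 * Re (f x * cnj (p x)) + Re (p x * cnj (p x))" for x
    unfolding cmod_power2 by (simp add: power2_eq_square algebra_simps)
  then have "0 \<le> (\<integral>x. (cmod (f x))\<^sup>2 - 2 * Re (f x * cnj (p x)) + Re (p x * cnj (p x)) \<partial>LI 1)"
    by (metis (no_types, lifting) Bochner_Integration.integral_nonneg zero_le_power2)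
  also have "\<dots> = (\<integral>x. (cmod (f x))\<^sup>2 \<partial>LI 1) - 2 * S + S"
    using f(2) integrable_Re[OF fp] integrable_Re[OF pp] S1' S2
    by (simp del: times_complex.sel)
  finally show ?thesis by (simp add: S_def)
qed

subsection \<open>Absolutely convergent Fourier series\<close>

context
  fixes c :: "int \<Rightarrow> complex"
  assumes c: "(\<lambda>k. norm (c k)) summable_on UNIV"
begin

lemma continuous_on_fs: "continuous_on S (fs c)"
  unfolding fs_def
  by (rule continuous_on_infsum[where B="\<lambda>k. norm (c k)"])
     (auto simp: norm_mult c intro!: continuous_intros continuous_on_fe)

lemma norm_fs_le: "norm (fs c x) \<le> (\<Sum>\<^sub>\<infinity>k. norm (c k))"
  unfolding fs_def by (rule infsum_norm_mono(3)) (auto simp: norm_mult c)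

lemma fs_period: "fs c (x + 1) = fs c x"
  by (simp add: fs_def)

lemma torus_L2_fs: "torus_L2 (fs c)"
  unfolding torus_L2_def periodic1_def set_integrable_LI
  by (intro conjI allI fs_period borel_measurable_continuous_onI continuous_on_fs
      integrable_LI_continuous continuous_intros)

lemma integral_fs_mult:
  assumes g: "integrable (LI 1) g"
  shows "(\<integral>x. fs c x * g x \<partial>LI 1) = (\<Sum>\<^sub>\<infinity>k. c k * (\<integral>x. fe k x * g x \<partial>LI 1))"
    and "integrable (LI 1) (\<lambda>x. fs c x * g x)"
    and "(\<lambda>k. norm (c k * (\<integral>x. fe k x * g x \<partial>LI 1))) summable_on UNIV"
proof -
  have e: "fs c x * g x = (\<Sum>\<^sub>\<infinity>k. c k * (fe k x * g x))" for x
    by (simp add: fs_def infsum_cmult_left' mult.assoc[symmetric])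
  have m: "(\<lambda>x. c k * (fe k x * g x)) \<in> borel_measurable (LI 1)" for k
    using g by (intro borel_measurable_times borel_measurable_const measurable_LI measurable_fe borel_measurable_integrable)
  have b: "norm (c k * (fe k x * g x)) \<le> norm (c k) * norm (g x)" for k x by (simp add: norm_mult)
  note I = integral_infsum[of "\<lambda>k x. c k * (fe k x * g x)" "LI 1" "\<lambda>k. norm (c k)" "\<lambda>x. norm (g x)",
      OF m b c integrable_norm[OF g]]
  show "(\<integral>x. fs c x * g x \<partial>LI 1) = (\<Sum>\<^sub>\<infinity>k. c k * (\<integral>x. fe k x * g x \<partial>LI 1))"
    using I(1) by (simp add: e)
  show "integrable (LI 1) (\<lambda>x. fs c x * g x)"
    using I(2) by (simp add: e)
  show "(\<lambda>k. norm (c k * (\<integral>x. fe k x * g x \<partial>LI 1))) summable_on UNIV"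
    using I(3) by simp
qed

lemma fc_fs: "fc (fs c) k = c k"
proof -
  have "fc (fs c) k = (\<Sum>\<^sub>\<infinity>l. c l * (\<integral>x. fe l x * fe (- k) x \<partial>LI 1))"
    unfolding fc_def by (rule integral_fs_mult(1)) (intro integrable_LI_continuous continuous_on_fe)
  also have "\<dots> = (\<Sum>\<^sub>\<infinity>l\<in>{k}. c l)"
    by (rule infsum_cong_neutral) (auto simp: fe_add[symmetric] integral_fe measure_LI)
  finally show ?thesis by simp
qed

text \<open>Parseval's identity.\<close>

lemma integral_norm_fs: "(\<integral>x. (cmod (fs c x))\<^sup>2 \<partial>LI 1) = (\<Sum>\<^sub>\<infinity>k. (cmod (c k))\<^sup>2)"
    "(\<lambda>k. (cmod (c k))\<^sup>2) summable_on UNIV"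
proof -
  have i: "integrable (LI 1) (\<lambda>x. cnj (fs c x))"
    by (intro integrable_LI_continuous continuous_intros continuous_on_fs)
  have e: "(\<integral>x. fe k x * cnj (fs c x) \<partial>LI 1) = cnj (c k)" for k
  proof -
    have "(\<integral>x. fe k x * cnj (fs c x) \<partial>LI 1) = (\<integral>x. cnj (fs c x * fe (- k) x) \<partial>LI 1)"
      by (simp add: fe_minus mult.commute)
    also have "\<dots> = cnj (fc (fs c) k)"
      unfolding fc_def by (rule Bochner_Integration.integral_cnj)
    finally have "(\<integral>x. fe k x * cnj (fs c x) \<partial>LI 1) = cnj (fc (fs c) k)" .
    then show ?thesis by (simp add: fc_fs)
  qed
  have sq: "c k * cnj (c k) = complex_of_real ((cmod (c k))\<^sup>2)" for k
    by (rule complex_norm_square[symmetric])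
  have s: "(\<lambda>k. complex_of_real ((cmod (c k))\<^sup>2)) summable_on UNIV"
    using abs_summable_summable[OF integral_fs_mult(3)[OF i]] unfolding e sq .
  show s': "(\<lambda>k. (cmod (c k))\<^sup>2) summable_on UNIV"
    using summable_on_Re[OF s] by simp
  have "complex_of_real (\<integral>x. (cmod (fs c x))\<^sup>2 \<partial>LI 1) = (\<integral>x. fs c x * cnj (fs c x) \<partial>LI 1)"
    unfolding complex_norm_square[symmetric] by (rule integral_complex_of_real[symmetric])
  also have "\<dots> = (\<Sum>\<^sub>\<infinity>k. complex_of_real ((cmod (c k))\<^sup>2))"
    unfolding integral_fs_mult(1)[OF i] e sq ..
  also have "\<dots> = complex_of_real (\<Sum>\<^sub>\<infinity>k. (cmod (c k))\<^sup>2)"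
    using has_sum_of_real[OF has_sum_infsum[OF s']] by (rule infsumI)
  finally show "(\<integral>x. (cmod (fs c x))\<^sup>2 \<partial>LI 1) = (\<Sum>\<^sub>\<infinity>k. (cmod (c k))\<^sup>2)"
    by (simp only: of_real_eq_iff)
qed

end

lemma AE_eq_fs:
  assumes "torus_L2 f" "(\<lambda>k. norm (fc f k)) summable_on UNIV"
  shows "AE x in lborel. f x = fs (fc f) x"
  by (rule AE_eq_if_fc_eq) (use assms torus_L2_fs fc_fs in auto)

lemma fs_mult:
  assumes c: "(\<lambda>k. norm (c k)) summable_on UNIV" and d: "(\<lambda>k. norm (d k)) summable_on UNIV"
  shows "fs c x * fs d x = fs (conv c d) x"
proof -
  have "fs c x * fs d x = infsum (conv (\<lambda>k. c k * fe k x) (\<lambda>k. d k * fe k x)) UNIV"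
    unfolding fs_def using c d by (subst infsum_conv) (simp_all add: norm_mult)
  also have "conv (\<lambda>k. c k * fe k x) (\<lambda>k. d k * fe k x) = (\<lambda>k. conv c d k * fe k x)"
  proof
    fix k
    have "c (k - j) * fe (k - j) x * (d j * fe j x) = c (k - j) * d j * fe k x" for j
    proof -
      have "fe k x = fe (k - j) x * fe j x" using fe_add[of "k - j" j x] by simp
      then show ?thesis by (simp only: mult_ac)
    qed
    then show "conv (\<lambda>k. c k * fe k x) (\<lambda>k. d k * fe k x) k = conv c d k * fe k x"
      unfolding conv_def by (simp only: infsum_cmult_left')
  qed
  finally show ?thesis by (simp add: fs_def)
qed

section \<open>Weak derivatives and Sobolev norms in terms of Fourier coefficients\<close>

text \<open>The multiplier of the squared \<open>H\<^sup>s\<close> norm on the Fourier side.\<close>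

definition sweight :: "nat \<Rightarrow> int \<Rightarrow> real"
  where "sweight s k = (\<Sum>j\<le>s. (cmod (fsym k ^ j))\<^sup>2)"

lemma norm_fsym: "norm (fsym k) = 2 * pi * \<bar>real_of_int k\<bar>"
  by (simp add: norm_mult)

lemma sweight_nonneg: "0 \<le> sweight s k"
  by (simp add: sweight_def sum_nonneg)

subsection \<open>Integration by parts and test functions\<close>

lemma DERIV_Re_fe: "((\<lambda>x. Re (z * fe k x)) has_real_derivative Re (z * fsym k * fe k x)) (at x within S)"
proof -
  have "((\<lambda>x. Re (z * fe k x)) has_vector_derivative Re (z * (fsym k * fe k x))) (at x within S)"
    by (intro bounded_linear.has_vector_derivative[OF bounded_linear_Re]
        bounded_linear.has_vector_derivative[OF bounded_linear_mult_right]) (rule has_vector_derivative_fe)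
  then show ?thesis
    by (simp only: has_real_derivative_iff_has_vector_derivative mult.assoc)
qed

lemma deriv_iter_Re_fe: "(deriv ^^ j) (\<lambda>x. Re (z * fe k x)) = (\<lambda>x. Re (z * fsym k ^ j * fe k x))"
proof (induction j arbitrary: z)
  case (Suc j)
  have "deriv (\<lambda>x. Re (z * fsym k ^ j * fe k x)) = (\<lambda>x. Re (z * fsym k ^ j * fsym k * fe k x))"
    by (rule ext, rule DERIV_imp_deriv, rule DERIV_Re_fe)
  then show ?case by (simp only: funpow.simps comp_def Suc power_Suc mult.assoc mult.commute mult.left_commute)
qed simp

lemma torus_test_function_Re_fe: "torus_test_function (\<lambda>x. Re (z * fe k x))"
  unfolding torus_test_function_def deriv_iter_Re_fe periodic1_def
proof (intro conjI allI)
  show "Re (z * fe k (x + 1)) = Re (z * fe k x)" for x by (simp only: fe_period)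
  show "(\<lambda>x. Re (z * fsym k ^ j * fe k x)) differentiable (at x)" for j x
    unfolding real_differentiable_def by (intro exI) (rule DERIV_Re_fe)
qed

lemma circle_integration_by_parts:
  fixes \<psi> \<psi>' :: "real \<Rightarrow> real"
  assumes d: "\<And>x. (\<psi> has_real_derivative \<psi>' x) (at x)"
    and c: "continuous_on UNIV \<psi>'" and p: "\<psi> 1 = \<psi> 0"
  shows "(\<integral>x. fe k x * complex_of_real (\<psi>' x) \<partial>LI 1)
      = - fsym k * (\<integral>x. fe k x * complex_of_real (\<psi> x) \<partial>LI 1)"
proof -
  have c\<psi>: "continuous_on S \<psi>" for S
    using d by (meson DERIV_continuous continuous_at_imp_continuous_on)
  have c': "continuous_on S \<psi>'" for S using c by (rule continuous_on_subset) simp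
  define F where "F x = fe k x * complex_of_real (\<psi> x)" for x
  define G where "G x = fe k x * complex_of_real (\<psi>' x) + fsym k * fe k x * complex_of_real (\<psi> x)" for x
  have "(F has_vector_derivative G x) (at x within {0..1})" for x
  proof -
    have "((\<lambda>x. complex_of_real (\<psi> x)) has_vector_derivative complex_of_real (\<psi>' x)) (at x within {0..1})"
      by (rule has_vector_derivative_of_real)
        (rule has_field_derivative_at_within[OF d])
    from has_vector_derivative_mult[OF has_vector_derivative_fe this]
    show ?thesis unfolding F_def G_def .
  qed
  then have "(G has_integral (F 1 - F 0)) {0..1}"
    by (intro fundamental_theorem_of_calculus) auto
  moreover have "F 1 - F 0 = 0" using p fe_period[of k 0] by (simp add: F_def)
  ultimately have "integral {0..1} G = 0" by (simp add: integral_unique)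
  moreover have "integral\<^sup>L (LI 1) G = integral {0..1} G"
    unfolding G_def by (intro integral_LI_HK continuous_intros continuous_on_fe c' c\<psi>)
  ultimately have "integral\<^sup>L (LI 1) G = 0" by simp
  moreover have "integral\<^sup>L (LI 1) G = (\<integral>x. fe k x * complex_of_real (\<psi>' x) \<partial>LI 1)
      + (\<integral>x. fsym k * (fe k x * complex_of_real (\<psi> x)) \<partial>LI 1)"
    unfolding G_def mult.assoc[of "fsym k"]
    by (intro Bochner_Integration.integral_add integrable_LI_continuous continuous_intros continuous_on_fe c' c\<psi>)
  ultimately show ?thesis by (simp add: add_eq_0_iff2)
qed

lemma torus_test_function_deriv: "torus_test_function \<phi> \<Longrightarrow> torus_test_function (deriv \<phi>)"
proof -
  assume \<phi>: "torus_test_function \<phi>"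
  have 0: "\<phi> differentiable (at x)" for x
    using \<phi> by (simp add: torus_test_function_def) (metis funpow_0)
  have "deriv \<phi> (x + 1) = deriv \<phi> x" for x
  proof (rule DERIV_imp_deriv)
    have "(\<phi> has_real_derivative deriv \<phi> x) (at x)"
      using 0 by (simp add: DERIV_deriv_iff_real_differentiable)
    moreover have "\<phi> = (\<lambda>y. \<phi> (y + 1))"
      using \<phi> by (auto simp: torus_test_function_def periodic1_def)
    ultimately have "((\<lambda>y. \<phi> (y + 1)) has_real_derivative deriv \<phi> x) (at x)" by metis
    then show "(\<phi> has_real_derivative deriv \<phi> x) (at (x + 1))"
      by (simp only: DERIV_shift)
  qed
  moreover have "(deriv ^^ j) (deriv \<phi>) differentiable (at x)" for j x
    using \<phi> funpow_swap1[of deriv j \<phi>] unfolding torus_test_function_def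
    by (metis funpow_simps_right(2) o_apply)
  ultimately show ?thesis by (simp add: torus_test_function_def periodic1_def)
qed

lemma torus_test_function_DERIV:
  assumes "torus_test_function \<phi>"
  shows "(\<phi> has_real_derivative deriv \<phi> x) (at x)" "continuous_on S \<phi>" "\<phi> (x + 1) = \<phi> x"
proof -
  have 0: "\<phi> differentiable (at x)" for x
    using assms by (simp add: torus_test_function_def) (metis funpow_0)
  then show D: "(\<phi> has_real_derivative deriv \<phi> x) (at x)" for x
    by (simp add: DERIV_deriv_iff_real_differentiable)
  then show "continuous_on S \<phi>"
    by (meson DERIV_continuous continuous_at_imp_continuous_on)
  show "\<phi> (x + 1) = \<phi> x" using assms by (auto simp: torus_test_function_def periodic1_def)
qed

lemma integral_fe_deriv_iter:
  assumes "torus_test_function \<phi>"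
  shows "(\<integral>x. fe k x * complex_of_real ((deriv ^^ j) \<phi> x) \<partial>LI 1)
      = (- fsym k) ^ j * (\<integral>x. fe k x * complex_of_real (\<phi> x) \<partial>LI 1)"
  using assms
proof (induction j arbitrary: \<phi>)
  case (Suc j)
  note D = torus_test_function_deriv[OF Suc.prems]
  have "(deriv ^^ Suc j) \<phi> = (deriv ^^ j) (deriv \<phi>)" by (simp only: funpow_Suc_right o_apply)
  then have "(\<integral>x. fe k x * complex_of_real ((deriv ^^ Suc j) \<phi> x) \<partial>LI 1)
      = (- fsym k) ^ j * (\<integral>x. fe k x * complex_of_real (deriv \<phi> x) \<partial>LI 1)"
    using Suc.IH[OF D] by simp
  also have "(\<integral>x. fe k x * complex_of_real (deriv \<phi> x) \<partial>LI 1)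
      = - fsym k * (\<integral>x. fe k x * complex_of_real (\<phi> x) \<partial>LI 1)"
    using torus_test_function_DERIV[OF Suc.prems] torus_test_function_DERIV(2)[OF D] torus_test_function_DERIV(3)[OF Suc.prems, of 0]
    by (intro circle_integration_by_parts) auto
  finally show ?case by (simp only: power_Suc2 mult.assoc)
qed simp

subsection \<open>Coefficients of weak derivatives\<close>

text \<open>Test functions are real. Testing with \<open>Re (z * fe (- k))\<close> for \<open>z = 1\<close> and for \<open>z = - \<i>\<close>
  amounts to testing with the complex exponential.\<close>

lemma fc_weak_deriv:
  assumes v: "is_weak_deriv j w v" and w: "integrable (LI 1) w"
  shows "fc v k = fsym k ^ j * fc w k"
proof -
  have v2: "torus_L2 v" and eq: "\<And>\<phi>. torus_test_function \<phi> \<Longrightarrow>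
      (\<integral>x. w x * complex_of_real ((deriv ^^ j) \<phi> x) \<partial>LI 1) = (- 1) ^ j * (\<integral>x. v x * complex_of_real (\<phi> x) \<partial>LI 1)"
    using v unfolding is_weak_deriv_def set_lint_LI by auto
  have vi: "integrable (LI 1) v" using v2 by (rule torus_L2_D)
  have split: "(\<integral>x. g x * (a * fe l x) \<partial>LI 1) = (\<integral>x. g x * complex_of_real (Re (a * fe l x)) \<partial>LI 1)
      + \<i> * (\<integral>x. g x * complex_of_real (Re (- \<i> * a * fe l x)) \<partial>LI 1)"
    if g: "integrable (LI 1) g" for g a l
  proof -
    have i: "integrable (LI 1) (\<lambda>x. g x * complex_of_real (Re (b * fe l x)))" for b
    proof (rule integrable_mult_bounded[OF g, where B="norm b"])
      show "(\<lambda>x. complex_of_real (Re (b * fe l x))) \<in> borel_measurable (LI 1)"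
        by (intro measurable_LI_continuous continuous_intros continuous_on_fe)
      have "\<bar>Re (b * fe l x)\<bar> \<le> norm (b * fe l x)" for x by (rule abs_Re_le_cmod)
      then show "norm (complex_of_real (Re (b * fe l x))) \<le> norm b" for x
        by (simp only: norm_of_real norm_mult norm_fe mult_1_right)
    qed
    have Z: "Z = complex_of_real (Re Z) + \<i> * complex_of_real (Re (- \<i> * Z))" for Z
      by (simp add: complex_eq_iff)
    have "(\<integral>x. g x * (a * fe l x) \<partial>LI 1)
        = (\<integral>x. g x * complex_of_real (Re (a * fe l x)) + \<i> * (g x * complex_of_real (Re (- \<i> * a * fe l x))) \<partial>LI 1)"
      by (rule Bochner_Integration.integral_cong[OF refl], subst Z)
         (simp only: distrib_left mult.assoc mult.left_commute)
    also have "\<dots> = (\<integral>x. g x * complex_of_real (Re (a * fe l x)) \<partial>LI 1)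
        + (\<integral>x. \<i> * (g x * complex_of_real (Re (- \<i> * a * fe l x))) \<partial>LI 1)"
      by (intro Bochner_Integration.integral_add integrable_mult_right i)
    finally show ?thesis by simp
  qed
  have I: "(\<integral>x. w x * complex_of_real (Re (z * fsym (- k) ^ j * fe (- k) x)) \<partial>LI 1)
      = (- 1) ^ j * (\<integral>x. v x * complex_of_real (Re (z * fe (- k) x)) \<partial>LI 1)" for z
    using eq[OF torus_test_function_Re_fe[of z "- k"]] unfolding deriv_iter_Re_fe .
  have "fsym (- k) ^ j * fc w k = (\<integral>x. w x * (fsym (- k) ^ j * fe (- k) x) \<partial>LI 1)"
    unfolding fc_def mult.left_commute[of "w _"] by (rule integral_mult_right_zero[symmetric])
  also have "\<dots> = (- 1) ^ j * (\<integral>x. v x * (1 * fe (- k) x) \<partial>LI 1)"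
    unfolding split[OF w] split[OF vi] using I[of 1] I[of "- \<i>"] by (simp add: algebra_simps)
  finally have "fsym (- k) ^ j * fc w k = (- 1) ^ j * fc v k" by (simp add: fc_def)
  moreover have "fsym (- k) ^ j = (- 1) ^ j * fsym k ^ j"
    by (simp add: power_mult_distrib[symmetric])
  ultimately have "(- 1) ^ j * (fc v k) = (- 1) ^ j * (fsym k ^ j * fc w k)" by (simp only: mult.assoc)
  then show ?thesis by simp
qed

lemma weak_deriv_unique_fc:
  assumes "is_weak_deriv j w v" "is_weak_deriv j w v'" "integrable (LI 1) w"
  shows "AE x in lborel. v x = v' x"
  by (rule AE_eq_if_fc_eq)
     (use assms fc_weak_deriv[OF assms(1,3)] fc_weak_deriv[OF assms(2,3)] in \<open>auto simp: is_weak_deriv_def\<close>)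

lemma sobolev_H_D:
  assumes "w \<in> sobolev_H s"
  shows "torus_L2 w" "integrable (LI 1) w" "j \<le> s \<Longrightarrow> is_weak_deriv j w (weak_deriv j w)"
    "j \<le> s \<Longrightarrow> torus_L2 (weak_deriv j w)" "j \<le> s \<Longrightarrow> fc (weak_deriv j w) k = fsym k ^ j * fc w k"
proof -
  show w: "torus_L2 w" and wi: "integrable (LI 1) w"
    using assms torus_L2_D(4) by (auto simp: sobolev_H_def)
  show d: "is_weak_deriv j w (weak_deriv j w)" if "j \<le> s"
  proof -
    have "\<exists>v. is_weak_deriv j w v" using assms that by (auto simp: sobolev_H_def)
    then show ?thesis unfolding weak_deriv_def by (rule someI_ex)
  qed
  show "torus_L2 (weak_deriv j w)" if "j \<le> s"
    using d[OF that] by (simp add: is_weak_deriv_def)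
  show "fc (weak_deriv j w) k = fsym k ^ j * fc w k" if "j \<le> s"
    by (rule fc_weak_deriv[OF d[OF that] wi])
qed

lemma sobolev_norm_nonneg: "0 \<le> sobolev_norm s w"
  by (simp add: sobolev_norm_def sum_nonneg)

lemma sobolev_norm_sq: "(sobolev_norm s w)\<^sup>2 = (\<Sum>j\<le>s. \<integral>x. (cmod (weak_deriv j w x))\<^sup>2 \<partial>LI 1)"
  by (simp add: sobolev_norm_def sum_nonneg L2_norm_torus_sq)

lemma sobolev_Bessel:
  assumes w: "w \<in> sobolev_H s" and K: "finite K"
  shows "(\<Sum>k\<in>K. sweight s k * (cmod (fc w k))\<^sup>2) \<le> (sobolev_norm s w)\<^sup>2"
proof -
  have "(\<Sum>k\<in>K. sweight s k * (cmod (fc w k))\<^sup>2)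
      = (\<Sum>j\<le>s. \<Sum>k\<in>K. (cmod (fsym k ^ j * fc w k))\<^sup>2)"
    unfolding sweight_def sum_distrib_right
    by (subst sum.swap) (simp only: norm_mult power_mult_distrib)
  also have "\<dots> \<le> (\<Sum>j\<le>s. \<integral>x. (cmod (weak_deriv j w x))\<^sup>2 \<partial>LI 1)"
  proof (rule sum_mono)
    fix j assume j: "j \<in> {..s}"
    then have d: "torus_L2 (weak_deriv j w)" using sobolev_H_D(4)[OF w] by simp
    have "(\<Sum>k\<in>K. (cmod (fc (weak_deriv j w) k))\<^sup>2) \<le> (\<integral>x. (cmod (weak_deriv j w x))\<^sup>2 \<partial>LI 1)"
      by (rule Bessel) (use K torus_L2_D[OF d] in auto)
    then show "(\<Sum>k\<in>K. (cmod (fsym k ^ j * fc w k))\<^sup>2) \<le> (\<integral>x. (cmod (weak_deriv j w x))\<^sup>2 \<partial>LI 1)"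
      using sobolev_H_D(5)[OF w] j by simp
  qed
  finally show ?thesis by (simp add: sobolev_norm_sq)
qed

lemma sum_inverse_squares:
  fixes K :: "int set"
  assumes "finite K" "0 \<notin> K"
  shows "(\<Sum>k\<in>K. 1 / (real_of_int k)\<^sup>2) \<le> 4"
proof -
  have half: "(\<Sum>n=1..N. 1 / (real n)\<^sup>2) \<le> 2 - 1 / real N" if "N \<ge> 1" for N :: nat
    using that
  proof (induction N rule: nat_induct_at_least)
    case (Suc n)
    have "1 / (real (Suc n))\<^sup>2 \<le> 1 / real n - 1 / real (Suc n)"
      using Suc.hyps by (simp add: divide_simps power2_eq_square)
    with Suc show ?case by simp
  qed simp
  obtain N :: nat where N: "N \<ge> 1" "\<And>k. k \<in> K \<Longrightarrow> nat \<bar>k\<bar> \<le> N"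
  proof
    show "nat \<bar>k\<bar> \<le> Max (insert 1 ((\<lambda>k. nat \<bar>k\<bar>) ` K))" if "k \<in> K" for k
      using that assms by (intro Max_ge) auto
    show "Max (insert 1 ((\<lambda>k. nat \<bar>k\<bar>) ` K)) \<ge> 1"
      using assms by (intro Max_ge) auto
  qed
  let ?f = "\<lambda>k. 1 / (real_of_int k)\<^sup>2"
  have "sum ?f K \<le> sum ?f (int ` {1..N} \<union> (\<lambda>n. - int n) ` {1..N})"
  proof (rule sum_mono2)
    show "K \<subseteq> int ` {1..N} \<union> (\<lambda>n. - int n) ` {1..N}"
    proof
      fix k assume k: "k \<in> K"
      then have "k \<noteq> 0" using assms by auto
      show "k \<in> int ` {1..N} \<union> (\<lambda>n. - int n) ` {1..N}"
      proof (cases "k > 0")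
        case True
        then have "k = int (nat k)" "nat k \<in> {1..N}" using N(2)[OF k] by auto
        then show ?thesis by blast
      next
        case False
        then have "k = - int (nat (- k))" "nat (- k) \<in> {1..N}" using N(2)[OF k] \<open>k \<noteq> 0\<close> by auto
        then show ?thesis by blast
      qed
    qed
  qed auto
  also have "\<dots> \<le> sum ?f (int ` {1..N}) + sum ?f ((\<lambda>n. - int n) ` {1..N})"
    by (subst sum_Un) (auto simp: sum_nonneg)
  also have "\<dots> = 2 * (\<Sum>n=1..N. 1 / (real n)\<^sup>2)"
    by (simp add: sum.reindex inj_on_def)
  also have "\<dots> \<le> 4" using half[OF N(1)] by (simp add: field_simps) (smt (verit) divide_nonneg_nonneg of_nat_0_le_iff)
  finally show ?thesis .
qed

text \<open>The Cauchy--Schwarz inequality against \<open>\<Sum> 1 / k\<^sup>2\<close>: this is the embedding of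
  \<open>H\<^sup>1\<close> into the functions with absolutely convergent Fourier series.\<close>

lemma sobolev_fc_sum_le:
  assumes w: "w \<in> sobolev_H s" and s: "s \<ge> 1" and K: "finite K" "0 \<notin> K"
  shows "(\<Sum>k\<in>K. norm (fc w k)) \<le> sobolev_norm s w"
proof (rule power2_le_imp_le[OF _ sobolev_norm_nonneg])
  have "(\<Sum>k\<in>K. norm (fc w k)) = (\<Sum>k\<in>K. 1 / norm (fsym k) * (norm (fsym k) * norm (fc w k)))"
  proof (rule sum.cong[OF refl])
    fix k assume "k \<in> K"
    then have "norm (fsym k) \<noteq> 0" using K unfolding norm_fsym by auto
    then show "norm (fc w k) = 1 / norm (fsym k) * (norm (fsym k) * norm (fc w k))" by (simp del: norm_eq_zero)
  qed
  then have "(\<Sum>k\<in>K. norm (fc w k))\<^sup>2 \<le> (\<Sum>k\<in>K. (1 / norm (fsym k))\<^sup>2) * (\<Sum>k\<in>K. (norm (fsym k) * norm (fc w k))\<^sup>2)"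
    using Cauchy_Schwarz_ineq_sum by metis
  also have "\<dots> \<le> 1 * (sobolev_norm s w)\<^sup>2"
  proof (rule mult_mono)
    have "(\<Sum>k\<in>K. (1 / norm (fsym k))\<^sup>2) = (1 / (4 * pi\<^sup>2)) * (\<Sum>k\<in>K. 1 / (real_of_int k)\<^sup>2)"
      unfolding norm_fsym sum_distrib_left by (simp add: power_mult_distrib power_divide)
    also have "\<dots> \<le> (1 / (4 * pi\<^sup>2)) * 4"
      by (intro mult_left_mono sum_inverse_squares K) simp
    also have "\<dots> \<le> 1"
    proof -
      have "1 \<le> pi\<^sup>2" using pi_gt3 by (intro one_le_power) simp
      then show ?thesis by (simp add: divide_simps)
    qed
    finally show "(\<Sum>k\<in>K. (1 / norm (fsym k))\<^sup>2) \<le> 1" .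
    have "(norm (fsym k) * norm (fc w k))\<^sup>2 \<le> sweight s k * (cmod (fc w k))\<^sup>2" for k
    proof -
      have "(cmod (fsym k ^ 1))\<^sup>2 \<le> sweight s k"
        unfolding sweight_def by (rule member_le_sum) (use s in auto)
      then show ?thesis unfolding power_mult_distrib by (intro mult_right_mono) simp_all
    qed
    then have "(\<Sum>k\<in>K. (norm (fsym k) * norm (fc w k))\<^sup>2) \<le> (\<Sum>k\<in>K. sweight s k * (cmod (fc w k))\<^sup>2)"
      by (rule sum_mono)
    also have "\<dots> \<le> (sobolev_norm s w)\<^sup>2" by (rule sobolev_Bessel[OF w K(1)])
    finally show "(\<Sum>k\<in>K. (norm (fsym k) * norm (fc w k))\<^sup>2) \<le> (sobolev_norm s w)\<^sup>2" .
  qed (simp_all add: sum_nonneg)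
  finally show "(\<Sum>k\<in>K. norm (fc w k))\<^sup>2 \<le> (sobolev_norm s w)\<^sup>2" by simp
qed

lemma sobolev_fc_0_le:
  assumes w: "w \<in> sobolev_H s"
  shows "norm (fc w 0) \<le> sobolev_norm s w"
proof (rule power2_le_imp_le[OF _ sobolev_norm_nonneg])
  have "sweight s 0 \<ge> (cmod (fsym 0 ^ 0))\<^sup>2"
    unfolding sweight_def by (rule member_le_sum) auto
  then have "(norm (fc w 0))\<^sup>2 \<le> sweight s 0 * (norm (fc w 0))\<^sup>2"
    by (simp add: mult_le_cancel_right1)
  then show "(norm (fc w 0))\<^sup>2 \<le> (sobolev_norm s w)\<^sup>2"
    using sobolev_Bessel[OF w, of "{0}"] by simp
qed

lemma sobolev_fc_summable:
  assumes w: "w \<in> sobolev_H s" and s: "s \<ge> 1"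
  shows "(\<lambda>k. norm (fc w k)) summable_on UNIV"
    and "(\<Sum>\<^sub>\<infinity>k. norm (fc w k)) \<le> 2 * sobolev_norm s w"
    and "fc w 0 = 0 \<Longrightarrow> (\<Sum>\<^sub>\<infinity>k. norm (fc w k)) \<le> sobolev_norm s w"
proof -
  have K: "(\<Sum>k\<in>K. norm (fc w k)) \<le> norm (fc w 0) + sobolev_norm s w" if "finite K" for K
  proof -
    have "(\<Sum>k\<in>K. norm (fc w k)) \<le> (\<Sum>k\<in>insert 0 (K - {0}). norm (fc w k))"
      by (rule sum_mono2) (use that in auto)
    also have "\<dots> = norm (fc w 0) + (\<Sum>k\<in>K - {0}. norm (fc w k))"
      by (rule sum.insert) (use that in auto)
    finally show ?thesis using sobolev_fc_sum_le[OF w s, of "K - {0}"] that by simp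
  qed
  show sm: "(\<lambda>k. norm (fc w k)) summable_on UNIV"
    by (rule nonneg_bdd_above_summable_on) (auto intro!: bdd_aboveI2[where M="norm (fc w 0) + sobolev_norm s w"] K)
  have "(\<Sum>\<^sub>\<infinity>k. norm (fc w k)) \<le> norm (fc w 0) + sobolev_norm s w"
    by (rule infsum_le_finite_sums[OF sm]) (rule K)
  then show "(\<Sum>\<^sub>\<infinity>k. norm (fc w k)) \<le> 2 * sobolev_norm s w"
    "fc w 0 = 0 \<Longrightarrow> (\<Sum>\<^sub>\<infinity>k. norm (fc w k)) \<le> sobolev_norm s w"
    using sobolev_fc_0_le[OF w] by simp_all
qed

text \<open>\<open>weak_deriv j w\<close> is chosen from a predicate that sees \<open>w\<close> only through integrals, so
  it does not change when \<open>w\<close> is modified on a null set.\<close>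

lemma is_weak_deriv_cong_AE:
  assumes "w \<in> borel_measurable borel" "w' \<in> borel_measurable borel" "AE x in lborel. w x = w' x"
  shows "is_weak_deriv j w = is_weak_deriv j w'"
proof
  fix v
  have "(LINT x:{0..1}|lborel. w x * complex_of_real ((deriv ^^ j) \<phi> x))
      = (LINT x:{0..1}|lborel. w' x * complex_of_real ((deriv ^^ j) \<phi> x))"
    if "torus_test_function \<phi>" for \<phi>
    unfolding set_lint_LI
  proof (rule integral_cong_AE)
    have "torus_test_function ((deriv ^^ j) \<phi>)"
      by (induction j) (use that torus_test_function_deriv in auto)
    then have m: "(\<lambda>x. complex_of_real ((deriv ^^ j) \<phi> x)) \<in> borel_measurable (LI 1)"
      by (intro measurable_LI_continuous continuous_intros torus_test_function_DERIV)
    show "(\<lambda>x. w x * complex_of_real ((deriv ^^ j) \<phi> x)) \<in> borel_measurable (LI 1)"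
      "(\<lambda>x. w' x * complex_of_real ((deriv ^^ j) \<phi> x)) \<in> borel_measurable (LI 1)"
      by (rule borel_measurable_times[OF measurable_LI[OF assms(1)] m],
          rule borel_measurable_times[OF measurable_LI[OF assms(2)] m])
    show "AE x in LI 1. w x * complex_of_real ((deriv ^^ j) \<phi> x) = w' x * complex_of_real ((deriv ^^ j) \<phi> x)"
      unfolding AE_LI using assms(3) by eventually_elim simp
  qed
  then show "is_weak_deriv j w v = is_weak_deriv j w' v"
    unfolding is_weak_deriv_def by (intro arg_cong2[where f="(\<and>)"] refl all_cong) simp
qed

lemma sobolev_cong_AE:
  assumes "torus_L2 w" "torus_L2 w'" "AE x in lborel. w x = w' x"
  shows "w \<in> sobolev_H s \<longleftrightarrow> w' \<in> sobolev_H s" "sobolev_norm s w = sobolev_norm s w'"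
proof -
  have e: "is_weak_deriv j w = is_weak_deriv j w'" for j
    by (intro is_weak_deriv_cong_AE assms torus_L2_D)
  then show "w \<in> sobolev_H s \<longleftrightarrow> w' \<in> sobolev_H s" by (simp add: sobolev_H_def assms)
  show "sobolev_norm s w = sobolev_norm s w'" by (simp add: sobolev_norm_def weak_deriv_def e)
qed

text \<open>Derivatives of periodic test functions have mean zero, so they do not see constants.\<close>

lemma sobolev_H_diff_const:
  assumes "w \<in> sobolev_H s"
  shows "(\<lambda>x. w x - c) \<in> sobolev_H s"
proof -
  have w: "torus_L2 w" using sobolev_H_D[OF assms] by simp
  have wi: "integrable (LI 1) w" using w by (rule torus_L2_D)
  have "\<exists>v. is_weak_deriv j (\<lambda>x. w x - c) v" if j: "j \<le> s" for j
  proof (cases "j = 0")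
    case True
    then show ?thesis using torus_L2_diff_const[OF w, of c] by (auto simp: is_weak_deriv_def)
  next
    case False
    then obtain i where i: "j = Suc i" by (cases j) auto
    obtain v where v: "is_weak_deriv j w v" using assms j by (auto simp: sobolev_H_def)
    have "(\<integral>x. (w x - c) * complex_of_real ((deriv ^^ j) \<phi> x) \<partial>LI 1)
        = (\<integral>x. w x * complex_of_real ((deriv ^^ j) \<phi> x) \<partial>LI 1)"
      if \<phi>: "torus_test_function \<phi>" for \<phi>
    proof -
      have "torus_test_function ((deriv ^^ j) \<phi>)"
        by (induction j) (use \<phi> torus_test_function_deriv in auto)
      then have cj: "continuous_on {0..1} ((deriv ^^ j) \<phi>)" by (rule torus_test_function_DERIV)
      have "(\<integral>x. fe 0 x * complex_of_real ((deriv ^^ j) \<phi> x) \<partial>LI 1) = 0"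
        using False by (subst integral_fe_deriv_iter[OF \<phi>]) simp
      then have z: "(\<integral>x. complex_of_real ((deriv ^^ j) \<phi> x) \<partial>LI 1) = 0" by simp
      have "bounded ((deriv ^^ j) \<phi> ` {0..1})"
        by (rule compact_imp_bounded[OF compact_continuous_image[OF cj compact_Icc]])
      then obtain B where B: "\<forall>x\<in>{0..1}. norm ((deriv ^^ j) \<phi> x) \<le> B"
        unfolding bounded_iff by blast
      have i1: "integrable (LI 1) (\<lambda>x. w x * complex_of_real ((deriv ^^ j) \<phi> x))"
        by (rule integrable_mult_bounded[OF wi, where B=B])
           (use B in \<open>auto intro!: measurable_LI_continuous continuous_intros cj\<close>)
      have i2: "integrable (LI 1) (\<lambda>x. c * complex_of_real ((deriv ^^ j) \<phi> x))"
        by (intro integrable_LI_continuous continuous_intros cj)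
      show ?thesis unfolding left_diff_distrib
        by (subst Bochner_Integration.integral_diff[OF i1 i2]) (simp only: integral_mult_right_zero z mult_zero_right diff_zero)
    qed
    then have "is_weak_deriv j (\<lambda>x. w x - c) v"
      using v unfolding is_weak_deriv_def set_lint_LI by simp
    then show ?thesis by blast
  qed
  then show ?thesis using torus_L2_diff_const[OF w] by (auto simp: sobolev_H_def)
qed

subsection \<open>Sobolev norms of Fourier series\<close>

lemma is_weak_deriv_fs:
  assumes c: "(\<lambda>k. norm (c k)) summable_on UNIV" and d: "(\<lambda>k. norm (fsym k ^ j * c k)) summable_on UNIV"
  shows "is_weak_deriv j (fs c) (fs (\<lambda>k. fsym k ^ j * c k))"
  unfolding is_weak_deriv_def set_lint_LI
proof (intro conjI allI impI)
  show "torus_L2 (fs (\<lambda>k. fsym k ^ j * c k))" by (rule torus_L2_fs[OF d])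
  fix \<phi> assume \<phi>: "torus_test_function \<phi>"
  have "torus_test_function ((deriv ^^ j) \<phi>)"
    by (induction j) (use \<phi> torus_test_function_deriv in auto)
  then have i1: "integrable (LI 1) (\<lambda>x. complex_of_real ((deriv ^^ j) \<phi> x))"
    by (intro integrable_LI_continuous continuous_intros torus_test_function_DERIV)
  have i0: "integrable (LI 1) (\<lambda>x. complex_of_real (\<phi> x))"
    by (intro integrable_LI_continuous continuous_intros torus_test_function_DERIV \<phi>)
  have "(\<integral>x. fs c x * complex_of_real ((deriv ^^ j) \<phi> x) \<partial>LI 1)
      = (\<Sum>\<^sub>\<infinity>k. (- 1) ^ j * (fsym k ^ j * c k * (\<integral>x. fe k x * complex_of_real (\<phi> x) \<partial>LI 1)))"
    unfolding integral_fs_mult(1)[OF c i1] integral_fe_deriv_iter[OF \<phi>] power_minus[of "fsym _"]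
    by (simp only: mult.assoc mult.left_commute)
  also have "\<dots> = (- 1) ^ j * (\<integral>x. fs (\<lambda>k. fsym k ^ j * c k) x * complex_of_real (\<phi> x) \<partial>LI 1)"
    unfolding integral_fs_mult(1)[OF d i0] by (rule infsum_cmult_right')
  finally show "(\<integral>x. fs c x * complex_of_real ((deriv ^^ j) \<phi> x) \<partial>LI 1)
      = (- 1) ^ j * (\<integral>x. fs (\<lambda>k. fsym k ^ j * c k) x * complex_of_real (\<phi> x) \<partial>LI 1)" .
qed

lemma sobolev_H_fs:
  assumes c: "\<And>j. j \<le> s \<Longrightarrow> (\<lambda>k. norm (fsym k ^ j * c k)) summable_on UNIV"
  shows "fs c \<in> sobolev_H s"
proof -
  have c0: "(\<lambda>k. norm (c k)) summable_on UNIV" using c[of 0] by simp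
  show ?thesis
    using torus_L2_fs[OF c0] is_weak_deriv_fs[OF c0 c] by (auto simp: sobolev_H_def)
qed

lemma weak_deriv_fs_AE:
  assumes c: "\<And>j. j \<le> s \<Longrightarrow> (\<lambda>k. norm (fsym k ^ j * c k)) summable_on UNIV" and j: "j \<le> s"
  shows "AE x in lborel. weak_deriv j (fs c) x = fs (\<lambda>k. fsym k ^ j * c k) x"
proof -
  have c0: "(\<lambda>k. norm (c k)) summable_on UNIV" using c[of 0] by simp
  note H = sobolev_H_D[OF sobolev_H_fs[OF c]]
  show ?thesis
    by (rule weak_deriv_unique_fc[OF H(3) is_weak_deriv_fs[OF c0 c] H(2)]) (use j in auto)
qed

lemma has_sum_finite_sum:
  fixes f :: "'j \<Rightarrow> 'k \<Rightarrow> real"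
  assumes "finite J" "\<And>j. j \<in> J \<Longrightarrow> (f j has_sum S j) A"
  shows "((\<lambda>k. \<Sum>j\<in>J. f j k) has_sum (\<Sum>j\<in>J. S j)) A"
  using assms by (induction J rule: finite_induct) (auto intro: has_sum_add)

lemma sobolev_norm_fs_le:
  assumes c: "\<And>j. j \<le> s \<Longrightarrow> (\<lambda>k. norm (fsym k ^ j * c k)) summable_on UNIV"
    and E: "\<And>K. finite K \<Longrightarrow> (\<Sum>k\<in>K. sweight s k * (cmod (c k))\<^sup>2) \<le> E\<^sup>2" and "0 \<le> E"
  shows "sobolev_norm s (fs c) \<le> E"
proof (rule power2_le_imp_le[OF _ \<open>0 \<le> E\<close>])
  have "(\<integral>x. (cmod (weak_deriv j (fs c) x))\<^sup>2 \<partial>LI 1) = (\<Sum>\<^sub>\<infinity>k. (cmod (fsym k ^ j * c k))\<^sup>2)"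
    if j: "j \<le> s" for j
  proof -
    have ae: "AE x in lborel. weak_deriv j (fs c) x = fs (\<lambda>k. fsym k ^ j * c k) x"
      by (rule weak_deriv_fs_AE[OF _ j]) (rule c)
    have "(\<integral>x. (cmod (weak_deriv j (fs c) x))\<^sup>2 \<partial>LI 1) = (\<integral>x. (cmod (fs (\<lambda>k. fsym k ^ j * c k) x))\<^sup>2 \<partial>LI 1)"
    proof (rule integral_cong_AE)
      show "AE x in LI 1. (cmod (weak_deriv j (fs c) x))\<^sup>2 = (cmod (fs (\<lambda>k. fsym k ^ j * c k) x))\<^sup>2"
        unfolding AE_LI using ae by eventually_elim simp
      have "torus_L2 (weak_deriv j (fs c))" "torus_L2 (fs (\<lambda>k. fsym k ^ j * c k))"
        using sobolev_H_D(4)[OF sobolev_H_fs[OF c]] torus_L2_fs[OF c] j by auto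
      then show "(\<lambda>x. (cmod (weak_deriv j (fs c) x))\<^sup>2) \<in> borel_measurable (LI 1)"
        "(\<lambda>x. (cmod (fs (\<lambda>k. fsym k ^ j * c k) x))\<^sup>2) \<in> borel_measurable (LI 1)"
        by (auto dest: torus_L2_D(3))
    qed
    then show ?thesis using integral_norm_fs(1)[OF c[OF j]] by simp
  qed
  then have "(sobolev_norm s (fs c))\<^sup>2 = (\<Sum>j\<le>s. \<Sum>\<^sub>\<infinity>k. (cmod (fsym k ^ j * c k))\<^sup>2)"
    unfolding sobolev_norm_sq by simp
  moreover have "((\<lambda>k. \<Sum>j\<le>s. (cmod (fsym k ^ j * c k))\<^sup>2) has_sum (\<Sum>j\<le>s. \<Sum>\<^sub>\<infinity>k. (cmod (fsym k ^ j * c k))\<^sup>2)) UNIV"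
    by (rule has_sum_finite_sum) (use integral_norm_fs(2)[OF c] in auto)
  ultimately have "((\<lambda>k. sweight s k * (cmod (c k))\<^sup>2) has_sum (sobolev_norm s (fs c))\<^sup>2) UNIV"
    by (simp add: sweight_def norm_mult power_mult_distrib sum_distrib_right del: norm_power)
  then show "(sobolev_norm s (fs c))\<^sup>2 \<le> E\<^sup>2"
    by (rule has_sum_le_finite_sums) (use E in auto)
qed

subsection \<open>The nonlinearity\<close>

text \<open>Averaging over \<open>j \<mapsto> m - j\<close> turns \<open>u u\<^sub>x\<close> into \<open>(u\<^sup>2)\<^sub>x / 2\<close>.\<close>

lemma conv_deriv_symmetrize:
  assumes c: "(\<lambda>k. norm (c k)) summable_on UNIV"
    and s: "(\<lambda>j. norm (c j * (fsym (m - j) * c (m - j)))) summable_on UNIV"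
  shows "(\<Sum>\<^sub>\<infinity>j. c j * (fsym (m - j) * c (m - j))) = fsym m / 2 * conv c c m"
proof -
  define h where "h j = c j * (fsym (m - j) * c (m - j))" for j
  have hs: "h summable_on UNIV" unfolding h_def using s by (rule abs_summable_summable)
  have b: "bij_betw (\<lambda>j. m - j) UNIV UNIV"
    by (rule bij_betwI[where g="\<lambda>j. m - j"]) auto
  have hs': "(\<lambda>j. h (m - j)) summable_on UNIV"
    using summable_on_reindex_bij_betw[OF b, of h] hs by simp
  have "2 * infsum h UNIV = infsum h UNIV + (\<Sum>\<^sub>\<infinity>j. h (m - j))"
    using infsum_reindex_bij_betw[OF b, of h] by simp
  also have "\<dots> = (\<Sum>\<^sub>\<infinity>j. h j + h (m - j))"
    by (rule infsum_add[symmetric]) (rule hs hs')+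
  also have "(\<lambda>j. h j + h (m - j)) = (\<lambda>j. fsym m * (c (m - j) * c j))"
    by (rule ext) (simp add: h_def algebra_simps)
  also have "(\<Sum>\<^sub>\<infinity>j. fsym m * (c (m - j) * c j)) = fsym m * conv c c m"
    unfolding conv_def by (rule infsum_cmult_right')
  finally show ?thesis by (simp add: h_def)
qed

lemma integral_mult_AE_fs:
  assumes v: "torus_L2 v" "(\<lambda>k. norm (fc v k)) summable_on UNIV" and g: "integrable (LI 1) g"
  shows "(\<integral>x. v x * g x \<partial>LI 1) = (\<Sum>\<^sub>\<infinity>k. fc v k * (\<integral>x. fe k x * g x \<partial>LI 1))"
    and "integrable (LI 1) (\<lambda>x. v x * g x)"
proof -
  have ae: "AE x in LI 1. v x * g x = fs (fc v) x * g x"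
    unfolding AE_LI using AE_eq_fs[OF v] by eventually_elim simp
  have m: "(\<lambda>x. v x * g x) \<in> borel_measurable (LI 1)" "(\<lambda>x. fs (fc v) x * g x) \<in> borel_measurable (LI 1)"
    using g torus_L2_D(2)[OF v(1)] torus_L2_D(2)[OF torus_L2_fs[OF v(2)]]
    by (auto intro: borel_measurable_times)
  show "(\<integral>x. v x * g x \<partial>LI 1) = (\<Sum>\<^sub>\<infinity>k. fc v k * (\<integral>x. fe k x * g x \<partial>LI 1))"
    using integral_cong_AE[OF m ae] integral_fs_mult(1)[OF v(2) g] by simp
  show "integrable (LI 1) (\<lambda>x. v x * g x)"
    using integrable_cong_AE[OF m ae] integral_fs_mult(2)[OF v(2) g] by simp
qed

text \<open>The weak derivative is only square integrable and has no absolutely convergent series; the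
  product is therefore expanded through the series of \<open>v\<close> alone.\<close>

lemma fc_mult_weak_deriv:
  assumes v: "v \<in> sobolev_H s" and s: "s \<ge> 1"
  shows "fc (\<lambda>x. v x * weak_deriv 1 v x) m = fsym m / 2 * fc (\<lambda>x. (v x)\<^sup>2) m"
    and "integrable (LI 1) (\<lambda>x. v x * weak_deriv 1 v x)"
proof -
  note vs = sobolev_fc_summable(1)[OF v s] and v2 = sobolev_H_D(1)[OF v]
  have w: "integrable (LI 1) (weak_deriv 1 v)"
    using sobolev_H_D(4)[OF v, of 1] s torus_L2_D(4) by auto
  have shift: "(\<integral>x. fe j x * (g x * fe (- m) x) \<partial>LI 1) = fc g (m - j)" for g j
    unfolding fc_def by (rule Bochner_Integration.integral_cong[OF refl])
      (use fe_add[of j "- m"] in \<open>simp add: mult_ac\<close>)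
  have e: "fc v j * (\<integral>x. fe j x * (weak_deriv 1 v x * fe (- m) x) \<partial>LI 1) = fc v j * (fsym (m - j) * fc v (m - j))" for j
    unfolding shift using sobolev_H_D(5)[OF v, of 1] s by simp
  show "integrable (LI 1) (\<lambda>x. v x * weak_deriv 1 v x)"
    by (rule integral_mult_AE_fs(2)[OF v2 vs w])
  have "fc (\<lambda>x. v x * weak_deriv 1 v x) m = (\<Sum>\<^sub>\<infinity>j. fc v j * (fsym (m - j) * fc v (m - j)))"
    unfolding fc_def[of "\<lambda>x. v x * weak_deriv 1 v x"] mult.assoc[of "v _"]
    unfolding integral_mult_AE_fs(1)[OF v2 vs integrable_mult_fe[OF w]] e ..
  also have "\<dots> = fsym m / 2 * conv (fc v) (fc v) m"
  proof (rule conv_deriv_symmetrize[OF vs])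
    show "(\<lambda>j. norm (fc v j * (fsym (m - j) * fc v (m - j)))) summable_on UNIV"
      using integral_fs_mult(3)[OF vs integrable_mult_fe[OF w, of "- m"]] unfolding e .
  qed
  also have "conv (fc v) (fc v) m = fc (\<lambda>x. (v x)\<^sup>2) m"
  proof -
    have "fc (\<lambda>x. (v x)\<^sup>2) m = (\<integral>x. v x * (v x * fe (- m) x) \<partial>LI 1)"
      by (simp add: fc_def power2_eq_square mult.assoc)
    also have "\<dots> = (\<Sum>\<^sub>\<infinity>j. fc v j * fc v (m - j))"
      unfolding integral_mult_AE_fs(1)[OF v2 vs integrable_mult_fe[OF sobolev_H_D(2)[OF v]]] shift ..
    finally show ?thesis by (simp add: conv_def mult.commute)
  qed
  finally show "fc (\<lambda>x. v x * weak_deriv 1 v x) m = fsym m / 2 * fc (\<lambda>x. (v x)\<^sup>2) m" .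
qed

section \<open>The system of Fourier coefficients\<close>

lemma abs_int_le_square: "\<bar>real_of_int k\<bar> \<le> (real_of_int k)\<^sup>2"
proof (cases "k = 0")
  case False
  then have "1 \<le> \<bar>real_of_int k\<bar>" by linarith
  from mult_left_mono[OF this, of "\<bar>real_of_int k\<bar>"] show ?thesis by (simp add: power2_eq_square)
qed simp

lemma has_sum_diff:
  fixes f g :: "'a \<Rightarrow> 'b::real_normed_vector"
  assumes "(f has_sum x) S" "(g has_sum y) S"
  shows "((\<lambda>k. f k - g k) has_sum (x - y)) S"
  using has_sum_add[OF assms(1) has_sum_bounded_linear[OF bounded_linear_minus[OF bounded_linear_ident] assms(2)]]
  by simp

lemma has_real_derivative_cmod_sq:
  assumes "(y has_vector_derivative y') (at t within S)"
  shows "((\<lambda>t. (cmod (y t))\<^sup>2) has_real_derivative 2 * Re (cnj (y t) * y')) (at t within S)"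
proof -
  have "((\<lambda>t. y t * cnj (y t)) has_vector_derivative y t * cnj y' + y' * cnj (y t)) (at t within S)"
    by (rule has_vector_derivative_mult[OF assms bounded_linear.has_vector_derivative[OF bounded_linear_cnj assms]])
  from bounded_linear.has_vector_derivative[OF bounded_linear_Re this]
  have "((\<lambda>t. Re (y t * cnj (y t))) has_vector_derivative Re (y t * cnj y' + y' * cnj (y t))) (at t within S)" .
  moreover have "Re (y t * cnj (y t)) = (cmod (y t))\<^sup>2" for t
    by (simp only: complex_norm_square[symmetric] Re_complex_of_real)
  moreover have "Re (y t * cnj y' + y' * cnj (y t)) = 2 * Re (cnj (y t) * y')" by simp
  ultimately show ?thesis
    unfolding has_real_derivative_iff_has_vector_derivative by (simp only:)
qed

text \<open>Since \<open>\<bar>k\<bar> \<le> \<bar>k - j\<bar> + \<bar>j\<bar>\<close>, one of the factors with frequencies \<open>k - j\<close> and \<open>j\<close> can take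
  over \<open>i\<close> of the \<open>2 i + 1\<close> derivatives; the other one is then summed freely. Both remaining factors carry \<open>i + 1\<close>
  derivatives, which is what the dissipation controls.\<close>

lemma trilinear_estimate:
  fixes z :: "int \<Rightarrow> real"
  assumes S: "finite S" "0 \<notin> S" and z: "\<And>k. 0 \<le> z k" "\<And>k. k \<notin> S \<Longrightarrow> z k = 0"
  shows "(\<Sum>k\<in>S. \<bar>real_of_int k\<bar> ^ (2 * i + 1) * z k * (\<Sum>j\<in>S. z (k - j) * z j))
      \<le> 2 ^ (i + 1) * (\<Sum>k\<in>S. z k) * (\<Sum>k\<in>S. (\<bar>real_of_int k\<bar> ^ (i + 1) * z k)\<^sup>2)"
proof -
  define X where "X k = \<bar>real_of_int k\<bar> ^ (i + 1) * z k" for k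
  define Q where "Q = (\<Sum>k\<in>S. (X k)\<^sup>2)"
  define R where "R = (\<Sum>k\<in>S. z k)"
  have X0: "0 \<le> X k" for k by (simp add: X_def z)
  have XS: "X k = 0" if "k \<notin> S" for k using that z by (simp add: X_def)
  have Y: "\<bar>real_of_int k\<bar> ^ i * z k \<le> X k" for k
  proof (cases "k \<in> S")
    case True
    then have "1 \<le> \<bar>real_of_int k\<bar>" using S by (cases "k = 0") auto
    then show ?thesis unfolding X_def by (intro mult_right_mono power_increasing z) auto
  qed (simp add: X_def z)
  have reindex: "(\<Sum>k\<in>S. f (g k)) \<le> sum f S"
    if "inj g" "\<And>k. 0 \<le> f k" "\<And>k. k \<notin> S \<Longrightarrow> f k = 0" for f :: "int \<Rightarrow> real" and g
  proof -
    have "(\<Sum>k\<in>S. f (g k)) = sum f (g ` S)"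
      using that(1) by (subst sum.reindex) (auto simp: inj_on_def)
    also have "\<dots> \<le> sum f (S \<union> g ` S)"
      by (rule sum_mono2) (use S that in auto)
    also have "\<dots> = sum f S" by (rule sum.mono_neutral_right) (use S that in auto)
    finally show ?thesis .
  qed
  have amgm: "x * y \<le> (x\<^sup>2 + y\<^sup>2) / 2" for x y :: real
    using zero_le_power2[of "x - y"] by (simp add: power2_eq_square algebra_simps)
  have point: "\<bar>real_of_int k\<bar> ^ (2 * i + 1) * z k * (z (k - j) * z j)
      \<le> 2 ^ i * (z j * ((X k)\<^sup>2 + (X (k - j))\<^sup>2) / 2 + z (k - j) * ((X k)\<^sup>2 + (X j)\<^sup>2) / 2)" for k j
  proof -
    have k: "\<bar>real_of_int k\<bar> ^ i \<le> 2 ^ i * (\<bar>real_of_int (k - j)\<bar> ^ i + \<bar>real_of_int j\<bar> ^ i)"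
    proof -
      define M where "M = max \<bar>real_of_int (k - j)\<bar> \<bar>real_of_int j\<bar>"
      have "\<bar>real_of_int k\<bar> \<le> \<bar>real_of_int (k - j)\<bar> + \<bar>real_of_int j\<bar>"
        using abs_triangle_ineq[of "real_of_int (k - j)" "real_of_int j"] by simp
      also have "\<dots> \<le> M + M" unfolding M_def by (intro add_mono) auto
      finally have "\<bar>real_of_int k\<bar> \<le> 2 * M" by simp
      then have "\<bar>real_of_int k\<bar> ^ i \<le> 2 ^ i * M ^ i"
        by (metis abs_ge_zero power_mono power_mult_distrib)
      also have "M ^ i \<le> \<bar>real_of_int (k - j)\<bar> ^ i + \<bar>real_of_int j\<bar> ^ i"
        unfolding M_def max_def by simp
      finally show ?thesis by simp
    qed
    have "\<bar>real_of_int k\<bar> ^ (2 * i + 1) * z k * (z (k - j) * z j)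
        = \<bar>real_of_int k\<bar> ^ i * (X k * (z (k - j) * z j))"
    proof -
      have "\<bar>real_of_int k\<bar> ^ (2 * i + 1) = \<bar>real_of_int k\<bar> ^ i * \<bar>real_of_int k\<bar> ^ (i + 1)"
        unfolding power_add[symmetric] by (simp add: mult_2)
      then show ?thesis by (simp only: X_def mult_ac)
    qed
    also have "\<dots> \<le> 2 ^ i * (\<bar>real_of_int (k - j)\<bar> ^ i + \<bar>real_of_int j\<bar> ^ i) * (X k * (z (k - j) * z j))"
      by (rule mult_right_mono[OF k]) (intro mult_nonneg_nonneg X0 z)
    also have "\<dots> = 2 ^ i * (X k * (\<bar>real_of_int (k - j)\<bar> ^ i * z (k - j)) * z j
        + X k * (\<bar>real_of_int j\<bar> ^ i * z j) * z (k - j))"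
      by (simp add: algebra_simps)
    also have "\<dots> \<le> 2 ^ i * (X k * X (k - j) * z j + X k * X j * z (k - j))"
      by (intro mult_left_mono add_mono mult_right_mono Y X0 z) auto
    also have "\<dots> \<le> 2 ^ i * (((X k)\<^sup>2 + (X (k - j))\<^sup>2) / 2 * z j + ((X k)\<^sup>2 + (X j)\<^sup>2) / 2 * z (k - j))"
      by (intro mult_left_mono add_mono mult_right_mono amgm z) auto
    finally show ?thesis by (simp add: mult.commute)
  qed
  have "(\<Sum>k\<in>S. \<bar>real_of_int k\<bar> ^ (2 * i + 1) * z k * (\<Sum>j\<in>S. z (k - j) * z j))
      \<le> (\<Sum>k\<in>S. \<Sum>j\<in>S. 2 ^ i * (z j * ((X k)\<^sup>2 + (X (k - j))\<^sup>2) / 2 + z (k - j) * ((X k)\<^sup>2 + (X j)\<^sup>2) / 2))"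
    unfolding sum_distrib_left by (intro sum_mono point)
  also have "\<dots> = 2 ^ i / 2 * ((\<Sum>j\<in>S. z j * (Q + (\<Sum>k\<in>S. (X (k - j))\<^sup>2)))
      + ((\<Sum>k\<in>S. (X k)\<^sup>2 * (\<Sum>j\<in>S. z (k - j))) + (\<Sum>j\<in>S. (X j)\<^sup>2 * (\<Sum>k\<in>S. z (k - j)))))"
  proof -
    have 1: "(\<Sum>j\<in>S. z j * (Q + (\<Sum>k\<in>S. (X (k - j))\<^sup>2))) = (\<Sum>k\<in>S. \<Sum>j\<in>S. z j * ((X k)\<^sup>2 + (X (k - j))\<^sup>2))"
      unfolding Q_def sum.distrib[symmetric] sum_distrib_left by (rule sum.swap)
    have 2: "(\<Sum>j\<in>S. (X j)\<^sup>2 * (\<Sum>k\<in>S. z (k - j))) = (\<Sum>k\<in>S. \<Sum>j\<in>S. (X j)\<^sup>2 * z (k - j))"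
      unfolding sum_distrib_left by (rule sum.swap)
    show ?thesis unfolding 1 2 unfolding sum_distrib_left sum.distrib[symmetric]
      by (intro sum.cong refl) (simp add: field_simps)
  qed
  also have "\<dots> \<le> 2 ^ i / 2 * ((\<Sum>j\<in>S. z j * (Q + Q)) + ((\<Sum>k\<in>S. (X k)\<^sup>2 * R) + (\<Sum>j\<in>S. (X j)\<^sup>2 * R)))"
    unfolding Q_def R_def
    by (intro mult_left_mono add_mono sum_mono order_refl reindex) (auto simp: z XS inj_def)
  also have "\<dots> = 2 ^ (i + 1) * R * Q"
    unfolding sum_distrib_right[symmetric] Q_def[symmetric] R_def[symmetric] by (simp add: algebra_simps)
  finally show ?thesis by (simp add: X_def Q_def R_def)
qed

lemma sweight_eq: "sweight s k = (\<Sum>i\<le>s. (2 * pi) ^ (2 * i) * \<bar>real_of_int k\<bar> ^ (2 * i))"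
  unfolding sweight_def norm_power norm_fsym
  by (intro sum.cong refl) (simp add: power_mult power_mult_distrib power_even_abs flip: power_mult mult.commute[of 2])

lemma trilinear_sweight:
  fixes z :: "int \<Rightarrow> real"
  assumes S: "finite S" "0 \<notin> S" and z: "\<And>k. 0 \<le> z k" "\<And>k. k \<notin> S \<Longrightarrow> z k = 0"
  shows "(\<Sum>k\<in>S. sweight s k * (\<bar>real_of_int k\<bar> * z k * (\<Sum>j\<in>S. z (k - j) * z j)))
      \<le> 2 ^ (s + 1) * (\<Sum>k\<in>S. z k) * (\<Sum>k\<in>S. sweight s k * ((real_of_int k)\<^sup>2 * (z k)\<^sup>2))"
proof -
  have R: "0 \<le> (\<Sum>k\<in>S. z k)" by (intro sum_nonneg z)
  have "(\<Sum>k\<in>S. sweight s k * (\<bar>real_of_int k\<bar> * z k * (\<Sum>j\<in>S. z (k - j) * z j)))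
      = (\<Sum>i\<le>s. (2 * pi) ^ (2 * i) * (\<Sum>k\<in>S. \<bar>real_of_int k\<bar> ^ (2 * i + 1) * z k * (\<Sum>j\<in>S. z (k - j) * z j)))"
  proof -
    define W where "W k = z k * (\<Sum>j\<in>S. z (k - j) * z j)" for k
    have "(\<Sum>k\<in>S. sweight s k * (\<bar>real_of_int k\<bar> * W k))
        = (\<Sum>k\<in>S. \<Sum>i\<le>s. (2 * pi) ^ (2 * i) * (\<bar>real_of_int k\<bar> ^ (2 * i + 1) * W k))"
      unfolding sweight_eq sum_distrib_right by (intro sum.cong refl) (simp add: mult_ac)
    also have "\<dots> = (\<Sum>i\<le>s. (2 * pi) ^ (2 * i) * (\<Sum>k\<in>S. \<bar>real_of_int k\<bar> ^ (2 * i + 1) * W k))"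
      unfolding sum_distrib_left by (rule sum.swap)
    finally show ?thesis by (simp only: W_def mult.assoc)
  qed
  also have "\<dots> \<le> (\<Sum>i\<le>s. (2 * pi) ^ (2 * i) * (2 ^ (s + 1) * (\<Sum>k\<in>S. z k) * (\<Sum>k\<in>S. (\<bar>real_of_int k\<bar> ^ (i + 1) * z k)\<^sup>2)))"
  proof (rule sum_mono, rule mult_left_mono)
    fix i assume i: "i \<in> {..s}"
    have "(\<Sum>k\<in>S. \<bar>real_of_int k\<bar> ^ (2 * i + 1) * z k * (\<Sum>j\<in>S. z (k - j) * z j))
        \<le> 2 ^ (i + 1) * (\<Sum>k\<in>S. z k) * (\<Sum>k\<in>S. (\<bar>real_of_int k\<bar> ^ (i + 1) * z k)\<^sup>2)"
      by (rule trilinear_estimate[OF S z])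
    also have "\<dots> \<le> 2 ^ (s + 1) * (\<Sum>k\<in>S. z k) * (\<Sum>k\<in>S. (\<bar>real_of_int k\<bar> ^ (i + 1) * z k)\<^sup>2)"
      using i by (intro mult_right_mono[OF mult_right_mono[OF _ R]] power_increasing sum_nonneg) auto
    finally show "(\<Sum>k\<in>S. \<bar>real_of_int k\<bar> ^ (2 * i + 1) * z k * (\<Sum>j\<in>S. z (k - j) * z j))
        \<le> 2 ^ (s + 1) * (\<Sum>k\<in>S. z k) * (\<Sum>k\<in>S. (\<bar>real_of_int k\<bar> ^ (i + 1) * z k)\<^sup>2)" .
  qed simp
  also have "\<dots> = 2 ^ (s + 1) * (\<Sum>k\<in>S. z k) * (\<Sum>i\<le>s. \<Sum>k\<in>S. (2 * pi) ^ (2 * i) * (\<bar>real_of_int k\<bar> ^ (i + 1) * z k)\<^sup>2)"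
    unfolding sum_distrib_left by (intro sum.cong refl) (simp add: mult_ac)
  also have "(\<Sum>i\<le>s. \<Sum>k\<in>S. (2 * pi) ^ (2 * i) * (\<bar>real_of_int k\<bar> ^ (i + 1) * z k)\<^sup>2)
      = (\<Sum>k\<in>S. sweight s k * ((real_of_int k)\<^sup>2 * (z k)\<^sup>2))"
    unfolding sweight_eq sum_distrib_right
  proof (subst sum.swap, intro sum.cong refl)
    fix k i
    have "(\<bar>real_of_int k\<bar> ^ (i + 1) * z k)\<^sup>2 = \<bar>real_of_int k\<bar> ^ (2 * i) * \<bar>real_of_int k\<bar>\<^sup>2 * (z k)\<^sup>2"
      unfolding power_mult_distrib power_mult[symmetric] power_add[symmetric] by (simp add: algebra_simps)
    then show "(2 * pi) ^ (2 * i) * (\<bar>real_of_int k\<bar> ^ (i + 1) * z k)\<^sup>2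
        = (2 * pi) ^ (2 * i) * \<bar>real_of_int k\<bar> ^ (2 * i) * ((real_of_int k)\<^sup>2 * (z k)\<^sup>2)"
      by (simp only: power2_abs mult.assoc)
  qed
  finally show ?thesis .
qed

text \<open>Write \<open>u = \<i> t + m + \<Sum> w\<^sub>k fe k\<close>. For \<open>k \<noteq> 0\<close> the equation becomes
  \<open>w\<^sub>k' = lam k w\<^sub>k - \<pi> \<i> k (w * w)\<^sub>k\<close>: transport along the imaginary direction \<open>\<i> t\<close> makes mode \<open>k\<close>
  grow at rate \<open>2 \<pi> k t\<close>, and viscosity damps it at rate \<open>4 \<pi>\<^sup>2 \<epsilon> k\<^sup>2\<close>. The damping wins for
  \<open>t \<le> T < 2 \<pi> \<epsilon>\<close>, with a margin controlled by \<open>\<delta>\<close>. \<open>Lam\<close> is the primitive of \<open>lam\<close> that vanishes at \<open>0\<close>.\<close>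

locale coeff_system =
  fixes \<epsilon> T \<delta> m :: real and a :: "int \<Rightarrow> complex"
  assumes eps: "0 < \<epsilon>" and T: "0 < T" and \<delta>: "0 < \<delta>" and \<delta>_eq: "\<delta> = 2 * pi * \<epsilon> - T"
    and a_summable: "(\<lambda>k. norm (a k)) summable_on UNIV"
    and a_small: "8 * (\<Sum>\<^sub>\<infinity>k. norm (a k)) \<le> \<delta>"
begin

definition Lam :: "int \<Rightarrow> real \<Rightarrow> complex"
  where "Lam k t = of_real (pi * k * t\<^sup>2 - 4 * pi\<^sup>2 * \<epsilon> * k\<^sup>2 * t) - fsym k * of_real (m * t)"

definition lam :: "int \<Rightarrow> real \<Rightarrow> complex"
  where "lam k t = of_real (2 * pi * k * t - 4 * pi\<^sup>2 * \<epsilon> * k\<^sup>2) - fsym k * of_real m"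

definition decay :: "int \<Rightarrow> real \<Rightarrow> real"
  where "decay k t = exp (- (pi * \<delta> * \<bar>real_of_int k\<bar> * t))"

text \<open>The variation of constants formula for the modes in \<open>S\<close>, all other modes being set to
  \<open>0\<close>. Finite sets \<open>S\<close> give Galerkin systems, \<open>- {0}\<close> gives the full system. \<open>Maj\<close> is the corresponding
  operator on sequences of numbers that bound the modes uniformly in time.\<close>

definition Phi :: "int set \<Rightarrow> (int \<Rightarrow> real \<Rightarrow> complex) \<Rightarrow> int \<Rightarrow> real \<Rightarrow> complex"
  where "Phi S w k t = (if k \<in> S then exp (Lam k t) * (a k - fsym k / 2 *
      integral {0..t} (\<lambda>\<tau>. exp (- Lam k \<tau>) * conv (\<lambda>j. w j \<tau>) (\<lambda>j. w j \<tau>) k)) else 0)"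

definition Maj :: "int set \<Rightarrow> (int \<Rightarrow> real) \<Rightarrow> int \<Rightarrow> real"
  where "Maj S B k = (if k \<in> S then norm (a k) + conv B B k / \<delta> else 0)"

definition iter :: "int set \<Rightarrow> nat \<Rightarrow> int \<Rightarrow> real \<Rightarrow> complex"
  where "iter S n = (Phi S ^^ n) (\<lambda>_ _. 0)"

definition Miter :: "int set \<Rightarrow> nat \<Rightarrow> int \<Rightarrow> real"
  where "Miter S n = (Maj S ^^ n) (\<lambda>_. 0)"

lemma iter_simps: "iter S 0 = (\<lambda>_ _. 0)" "iter S (Suc n) = Phi S (iter S n)"
  by (simp_all add: iter_def)

lemma Miter_simps: "Miter S 0 = (\<lambda>_. 0)" "Miter S (Suc n) = Maj S (Miter S n)"
  by (simp_all add: Miter_def)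

lemma decay_pos: "0 < decay k t"
  by (simp add: decay_def)

lemma decay_le_1: "0 \<le> t \<Longrightarrow> decay k t \<le> 1"
  using \<delta> by (simp add: decay_def)

lemma decay_mult: "0 \<le> t \<Longrightarrow> decay (k - j) t * decay j t \<le> decay k t"
proof -
  assume t: "0 \<le> t"
  have "\<bar>real_of_int k\<bar> \<le> \<bar>real_of_int (k - j)\<bar> + \<bar>real_of_int j\<bar>" by simp
  from mult_left_mono[OF this, of "pi * \<delta> * t"] show ?thesis
    using \<delta> t by (simp add: decay_def exp_add[symmetric] algebra_simps)
qed

lemma DERIV_Lam: "(Lam k has_vector_derivative lam k t) (at t within A)"
proof -
  have "((\<lambda>t. complex_of_real (pi * k * t\<^sup>2 - 4 * pi\<^sup>2 * \<epsilon> * k\<^sup>2 * t)) has_vector_derivative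
      complex_of_real (2 * pi * k * t - 4 * pi\<^sup>2 * \<epsilon> * k\<^sup>2)) (at t within A)"
    by (rule has_vector_derivative_of_real) (auto intro!: derivative_eq_intros)
  moreover have "((\<lambda>t. complex_of_real (m * t)) has_vector_derivative complex_of_real m) (at t within A)"
    by (rule has_vector_derivative_of_real) (auto intro!: derivative_eq_intros)
  ultimately show ?thesis
    unfolding Lam_def lam_def
    by (intro has_vector_derivative_diff bounded_linear.has_vector_derivative[OF bounded_linear_mult_right])
qed

lemma continuous_on_Lam [continuous_intros]: "continuous_on A (Lam k)"
  using DERIV_Lam by (meson has_vector_derivative_continuous continuous_on_eq_continuous_within)

lemma Re_lam_le:
  assumes "t \<in> {0..T}"
  shows "Re (lam k t) \<le> - (2 * pi * \<delta> * k\<^sup>2)"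
proof -
  have "real_of_int k * t \<le> (real_of_int k)\<^sup>2 * T"
  proof -
    have "real_of_int k * t \<le> \<bar>real_of_int k\<bar> * t" using assms by (intro mult_right_mono) auto
    also have "\<dots> \<le> (real_of_int k)\<^sup>2 * T" using assms abs_int_le_square by (intro mult_mono) auto
    finally show ?thesis .
  qed
  then have "2 * pi * (real_of_int k * t) \<le> 2 * pi * ((real_of_int k)\<^sup>2 * T)" by simp
  then show ?thesis unfolding \<delta>_eq by (simp add: lam_def power2_eq_square algebra_simps)
qed

lemma Re_Lam_diff:
  assumes "0 \<le> \<tau>" "\<tau> \<le> t" "t \<le> T"
  shows "Re (Lam k t - Lam k \<tau>) \<le> - (2 * pi * \<delta> * k\<^sup>2 * (t - \<tau>))"
proof -
  have "Re (Lam k t - Lam k \<tau>) = (t - \<tau>) * Re (lam k ((t + \<tau>) / 2))"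
    by (simp add: Lam_def lam_def power2_eq_square field_simps)
  also have "\<dots> \<le> (t - \<tau>) * - (2 * pi * \<delta> * k\<^sup>2)"
    by (intro mult_left_mono Re_lam_le) (use assms in auto)
  finally show ?thesis by (simp add: mult_ac)
qed

text \<open>The gap \<open>\<delta>\<close> makes every mode \<open>k \<noteq> 0\<close> decay at rate \<open>2 \<pi> \<delta> k\<^sup>2\<close>. Half of the rate pays for
  the weight \<open>decay k\<close>, the other half integrates to \<open>1 / (\<pi> \<delta> k\<^sup>2)\<close>, which absorbs the derivative
  in the nonlinearity.\<close>

lemma Duhamel_bound:
  assumes k: "k \<noteq> 0" and t: "t \<in> {0..T}" and g: "continuous_on {0..T} g" and G: "0 \<le> G"
    and gG: "\<And>\<tau>. \<tau> \<in> {0..T} \<Longrightarrow> norm (g \<tau>) \<le> G * decay k \<tau>"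
  shows "norm (exp (Lam k t) * (fsym k / 2 * integral {0..t} (\<lambda>\<tau>. exp (- Lam k \<tau>) * g \<tau>))) \<le> G / \<delta> * decay k t"
proof -
  define \<mu> where "\<mu> = pi * \<delta> * (real_of_int k)\<^sup>2"
  have \<mu>: "\<mu> > 0" using k \<delta> by (simp add: \<mu>_def)
  note k2 = abs_int_le_square[of k]
  have gt: "continuous_on {0..t} g" using g t by (auto intro: continuous_on_subset)
  have "exp (Lam k t) * integral {0..t} (\<lambda>\<tau>. exp (- Lam k \<tau>) * g \<tau>)
      = integral {0..t} (\<lambda>\<tau>. exp (Lam k t) * (exp (- Lam k \<tau>) * g \<tau>))"
    by (rule integral_mult_right[symmetric])
  also have "norm \<dots> \<le> integral {0..t} (\<lambda>\<tau>. G * decay k t * exp (- (\<mu> * (t - \<tau>))))"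
  proof (rule integral_norm_bound_integral)
    show "(\<lambda>\<tau>. exp (Lam k t) * (exp (- Lam k \<tau>) * g \<tau>)) integrable_on {0..t}"
      by (intro integrable_continuous_real continuous_intros gt)
    show "(\<lambda>\<tau>. G * decay k t * exp (- (\<mu> * (t - \<tau>)))) integrable_on {0..t}"
      by (intro integrable_continuous_real continuous_intros)
    fix \<tau> assume \<tau>: "\<tau> \<in> {0..t}"
    have "exp (Lam k t) * (exp (- Lam k \<tau>) * g \<tau>) = exp (Lam k t - Lam k \<tau>) * g \<tau>"
      by (simp add: exp_diff exp_minus divide_inverse)
    then have "norm (exp (Lam k t) * (exp (- Lam k \<tau>) * g \<tau>)) = exp (Re (Lam k t - Lam k \<tau>)) * norm (g \<tau>)"
      by (simp only: norm_mult norm_exp_eq_Re)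
    also have "\<dots> \<le> exp (- (2 * pi * \<delta> * k\<^sup>2 * (t - \<tau>))) * (G * decay k \<tau>)"
      by (intro mult_mono gG) (use Re_Lam_diff[of \<tau> t k] \<tau> t in auto)
    also have "\<dots> = G * exp (- (2 * pi * \<delta> * k\<^sup>2 * (t - \<tau>)) - pi * \<delta> * \<bar>real_of_int k\<bar> * \<tau>)"
      by (simp add: decay_def exp_diff exp_minus divide_inverse)
    also have "\<dots> \<le> G * exp (- (pi * \<delta> * \<bar>real_of_int k\<bar> * t) - \<mu> * (t - \<tau>))"
    proof (rule mult_left_mono[OF _ G], subst exp_le_cancel_iff)
      have "pi * \<delta> * (t - \<tau>) * \<bar>real_of_int k\<bar> \<le> pi * \<delta> * (t - \<tau>) * (real_of_int k)\<^sup>2"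
        by (rule mult_left_mono[OF k2]) (use \<tau> \<delta> in auto)
      then show "- (2 * pi * \<delta> * k\<^sup>2 * (t - \<tau>)) - pi * \<delta> * \<bar>real_of_int k\<bar> * \<tau>
          \<le> - (pi * \<delta> * \<bar>real_of_int k\<bar> * t) - \<mu> * (t - \<tau>)"
        by (simp add: \<mu>_def algebra_simps)
    qed
    also have "\<dots> = G * decay k t * exp (- (\<mu> * (t - \<tau>)))"
      by (simp add: decay_def exp_diff exp_minus divide_inverse)
    finally show "norm (exp (Lam k t) * (exp (- Lam k \<tau>) * g \<tau>)) \<le> G * decay k t * exp (- (\<mu> * (t - \<tau>)))" .
  qed
  also have "integral {0..t} (\<lambda>\<tau>. G * decay k t * exp (- (\<mu> * (t - \<tau>)))) = G * decay k t * ((1 - exp (- (\<mu> * t))) / \<mu>)"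
  proof -
    have "((\<lambda>\<tau>. exp (- (\<mu> * (t - \<tau>)))) has_integral (exp (- (\<mu> * (t - t))) / \<mu> - exp (- (\<mu> * (t - 0))) / \<mu>)) {0..t}"
    proof (rule fundamental_theorem_of_calculus)
      show "((\<lambda>\<tau>. exp (- (\<mu> * (t - \<tau>))) / \<mu>) has_vector_derivative exp (- (\<mu> * (t - x)))) (at x within {0..t})" for x
        unfolding has_real_derivative_iff_has_vector_derivative[symmetric]
        using \<mu> by (auto intro!: derivative_eq_intros)
    qed (use t in auto)
    from integral_unique[OF this] show ?thesis
      by (simp add: diff_divide_distrib)
  qed
  also have "\<dots> \<le> G * decay k t * (1 / \<mu>)"
    using \<mu> G decay_pos[of k t] by (intro mult_left_mono divide_right_mono) auto
  finally have *: "norm (exp (Lam k t) * integral {0..t} (\<lambda>\<tau>. exp (- Lam k \<tau>) * g \<tau>)) \<le> G * decay k t / \<mu>"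
    by simp
  have "norm (exp (Lam k t) * (fsym k / 2 * integral {0..t} (\<lambda>\<tau>. exp (- Lam k \<tau>) * g \<tau>)))
      = norm (fsym k / 2) * norm (exp (Lam k t) * integral {0..t} (\<lambda>\<tau>. exp (- Lam k \<tau>) * g \<tau>))"
    by (simp only: norm_mult mult_ac)
  also have "norm (fsym k / 2) = pi * \<bar>real_of_int k\<bar>" by (simp only: norm_divide norm_fsym) simp
  also have "pi * \<bar>real_of_int k\<bar> * norm (exp (Lam k t) * integral {0..t} (\<lambda>\<tau>. exp (- Lam k \<tau>) * g \<tau>))
      \<le> pi * \<bar>real_of_int k\<bar> * (G * decay k t / \<mu>)"
    by (intro mult_left_mono *) simp
  also have "\<dots> = G / \<delta> * decay k t * (\<bar>real_of_int k\<bar> / (real_of_int k)\<^sup>2)"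
    using \<delta> k by (simp add: \<mu>_def)
  also have "\<dots> \<le> G / \<delta> * decay k t * 1"
    using G \<delta> decay_pos[of k t] k k2 by (intro mult_left_mono) (auto simp: divide_le_eq)
  finally show ?thesis by simp
qed

text \<open>\<open>B k * decay k t\<close> bounds mode \<open>k\<close> at time \<open>t\<close>. The weight \<open>decay\<close> is submultiplicative, so it
  is inherited by convolutions, and it makes the modes decay exponentially in \<open>k\<close> for \<open>t > 0\<close>.\<close>

definition majorized :: "(int \<Rightarrow> real \<Rightarrow> complex) \<Rightarrow> (int \<Rightarrow> real) \<Rightarrow> bool"
  where "majorized w B \<longleftrightarrow> (\<forall>k. continuous_on {0..T} (w k)) \<and> B summable_on UNIV \<and>
    (\<forall>k t. t \<in> {0..T} \<longrightarrow> norm (w k t) \<le> B k * decay k t)"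

lemma majorized_nonneg: "majorized w B \<Longrightarrow> 0 \<le> B k"
proof -
  assume "majorized w B"
  then have "norm (w k 0) \<le> B k * decay k 0" using T unfolding majorized_def by auto
  from order_trans[OF norm_ge_zero this] show ?thesis by (simp add: decay_def)
qed

lemma majorized_norm: "majorized w B \<Longrightarrow> (\<lambda>k. norm (B k)) summable_on UNIV"
  using majorized_nonneg[of w B] by (auto simp: majorized_def)

lemma majorized_bound: "majorized w B \<Longrightarrow> t \<in> {0..T} \<Longrightarrow> norm (w k t) \<le> B k"
  using majorized_nonneg[of w B k] decay_le_1[of t k]
  by (smt (verit) atLeastAtMost_iff majorized_def mult_left_le)

lemma majorized_summable:
  assumes "majorized w B" "t \<in> {0..T}"
  shows "(\<lambda>k. norm (w k t)) summable_on UNIV"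
  by (rule infsum_norm_mono(1)[of _ B]) (use assms majorized_bound in \<open>auto simp: majorized_def\<close>)

lemma continuous_on_conv:
  assumes w: "majorized w B"
  shows "continuous_on {0..T} (\<lambda>\<tau>. conv (\<lambda>j. w j \<tau>) (\<lambda>j. w j \<tau>) k)"
  unfolding conv_def
proof (rule continuous_on_infsum)
  show "continuous_on {0..T} (\<lambda>x. w (k - j) x * w j x)" for j
    using w by (auto simp: majorized_def intro!: continuous_intros)
  show "norm (w (k - j) x * w j x) \<le> B (k - j) * B j" if "x \<in> {0..T}" for x j
    unfolding norm_mult using majorized_bound[OF w that] majorized_nonneg[OF w] by (intro mult_mono) auto
  show "(\<lambda>j. B (k - j) * B j) summable_on UNIV"
    using conv_term_summable[OF majorized_norm[OF w] majorized_norm[OF w], of k] majorized_nonneg[OF w] by simp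
qed

text \<open>Differences of products are majorized by differences of majorants:
  \<open>F F' - G G' = (F - G) F' + G (F' - G')\<close>.\<close>

lemma conv_compare:
  assumes F: "majorized F BF" and G: "majorized G BG"
    and d: "\<And>k t. t \<in> {0..T} \<Longrightarrow> norm (F k t - G k t) \<le> (BF k - BG k) * decay k t"
    and t: "t \<in> {0..T}"
  shows "norm (conv (\<lambda>j. F j t) (\<lambda>j. F j t) k - conv (\<lambda>j. G j t) (\<lambda>j. G j t) k)
      \<le> (conv BF BF k - conv BG BG k) * decay k t"
proof -
  note tF = conv_term_summable[OF majorized_summable[OF F t] majorized_summable[OF F t], of k, THEN abs_summable_summable]
  note tG = conv_term_summable[OF majorized_summable[OF G t] majorized_summable[OF G t], of k, THEN abs_summable_summable]
  note sF = conv_term_summable[OF majorized_norm[OF F] majorized_norm[OF F], of k, THEN abs_summable_summable]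
  note sG = conv_term_summable[OF majorized_norm[OF G] majorized_norm[OF G], of k, THEN abs_summable_summable]
  have sum: "(\<lambda>j. (BF (k - j) * BF j - BG (k - j) * BG j) * decay k t) summable_on UNIV"
    by (rule summable_on_cmult_left[OF has_sum_imp_summable[OF
          has_sum_diff[OF has_sum_infsum[OF sF] has_sum_infsum[OF sG]]]])
  have "norm (F (k - j) t * F j t - G (k - j) t * G j t) \<le> (BF (k - j) * BF j - BG (k - j) * BG j) * decay k t" for j
  proof -
    have F1: "norm (F j t) \<le> BF j * decay j t" and G1: "norm (G (k - j) t) \<le> BG (k - j) * decay (k - j) t"
      using F G t by (auto simp: majorized_def)
    have D: "0 \<le> BF j - BG j" for j
    proof -
      have "0 \<le> (BF j - BG j) * decay j t" using order_trans[OF norm_ge_zero d[OF t]] .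
      then show ?thesis using decay_pos[of j t] by (simp add: zero_le_mult_iff)
    qed
    have "F (k - j) t * F j t - G (k - j) t * G j t
        = (F (k - j) t - G (k - j) t) * F j t + G (k - j) t * (F j t - G j t)"
      by (simp add: algebra_simps)
    then have "norm (F (k - j) t * F j t - G (k - j) t * G j t)
        \<le> norm (F (k - j) t - G (k - j) t) * norm (F j t) + norm (G (k - j) t) * norm (F j t - G j t)"
      using norm_triangle_ineq norm_mult by metis
    also have "\<dots> \<le> ((BF (k - j) - BG (k - j)) * decay (k - j) t) * (BF j * decay j t)
        + (BG (k - j) * decay (k - j) t) * ((BF j - BG j) * decay j t)"
      by (intro add_mono mult_mono d[OF t] F1 G1)
         (use D majorized_nonneg[OF F] majorized_nonneg[OF G] decay_pos in \<open>auto intro!: mult_nonneg_nonneg simp: less_imp_le\<close>)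
    also have "\<dots> = (BF (k - j) * BF j - BG (k - j) * BG j) * (decay (k - j) t * decay j t)"
      by (simp add: algebra_simps)
    also have "\<dots> \<le> (BF (k - j) * BF j - BG (k - j) * BG j) * decay k t"
    proof (rule mult_left_mono)
      show "decay (k - j) t * decay j t \<le> decay k t" using t by (intro decay_mult) simp
      have "BG (k - j) * BG j \<le> BF (k - j) * BF j"
        using D[of "k - j"] D[of j] majorized_nonneg[OF G] majorized_nonneg[OF F] by (intro mult_mono) auto
      then show "0 \<le> BF (k - j) * BF j - BG (k - j) * BG j" by simp
    qed
    finally show ?thesis .
  qed
  from infsum_norm_mono(3)[OF this sum]
  have "norm (\<Sum>\<^sub>\<infinity>j. F (k - j) t * F j t - G (k - j) t * G j t)
      \<le> (\<Sum>\<^sub>\<infinity>j. (BF (k - j) * BF j - BG (k - j) * BG j) * decay k t)" .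
  also have "(\<Sum>\<^sub>\<infinity>j. F (k - j) t * F j t - G (k - j) t * G j t)
      = conv (\<lambda>j. F j t) (\<lambda>j. F j t) k - conv (\<lambda>j. G j t) (\<lambda>j. G j t) k"
    unfolding conv_def by (rule infsumI) (intro has_sum_diff has_sum_infsum tF tG)
  also have "(\<Sum>\<^sub>\<infinity>j. (BF (k - j) * BF j - BG (k - j) * BG j) * decay k t)
      = (conv BF BF k - conv BG BG k) * decay k t"
    unfolding conv_def by (rule infsumI) (intro has_sum_cmult_left has_sum_diff has_sum_infsum sF sG)
  finally show ?thesis .
qed

lemma continuous_on_Phi:
  assumes "majorized w B"
  shows "continuous_on {0..T} (Phi S w k)"
proof (cases "k \<in> S")
  case True
  have "continuous_on {0..T} (\<lambda>t. exp (Lam k t) * (a k - fsym k / 2 *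
      integral {0..t} (\<lambda>\<tau>. exp (- Lam k \<tau>) * conv (\<lambda>j. w j \<tau>) (\<lambda>j. w j \<tau>) k)))"
    by (intro continuous_intros indefinite_integral_continuous_1 integrable_continuous_real
        continuous_on_conv[OF assms])
  then show ?thesis using True by (simp add: Phi_def[abs_def])
qed (simp add: Phi_def[abs_def])

lemma Phi_compare:
  assumes F: "majorized F BF" and G: "majorized G BG" and S: "S \<subseteq> S'" "0 \<notin> S'"
    and d: "\<And>k t. t \<in> {0..T} \<Longrightarrow> norm (F k t - G k t) \<le> (BF k - BG k) * decay k t"
    and t: "t \<in> {0..T}"
  shows "norm (Phi S' F k t - Phi S G k t) \<le> (Maj S' BF k - Maj S BG k) * decay k t"
proof -
  have G0: "0 \<le> conv BF BF k - conv BG BG k"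
    using order_trans[OF norm_ge_zero conv_compare[OF F G d t, of k]] decay_pos[of k t]
    by (simp add: zero_le_mult_iff)
  consider "k \<in> S" | "k \<in> S'" "k \<notin> S" | "k \<notin> S'" using S by auto
  then show ?thesis
  proof cases
    case 1
    then have k: "k \<noteq> 0" "k \<in> S'" using S by auto
    let ?g = "\<lambda>\<tau>. conv (\<lambda>j. F j \<tau>) (\<lambda>j. F j \<tau>) k - conv (\<lambda>j. G j \<tau>) (\<lambda>j. G j \<tau>) k"
    have i: "(\<lambda>\<tau>. exp (- Lam k \<tau>) * conv (\<lambda>j. w j \<tau>) (\<lambda>j. w j \<tau>) k) integrable_on {0..t}" if "majorized w B" for w B
      by (intro integrable_continuous_real continuous_intros continuous_on_subset[OF continuous_on_conv[OF that]])
         (use t in auto)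
    have "Phi S' F k t - Phi S G k t = - (exp (Lam k t) * (fsym k / 2 * integral {0..t} (\<lambda>\<tau>. exp (- Lam k \<tau>) * ?g \<tau>)))"
      unfolding Phi_def right_diff_distrib[of "exp (- Lam k _)"] Henstock_Kurzweil_Integration.integral_diff[OF i[OF F] i[OF G]]
      using 1 k by (simp add: algebra_simps)
    also have "norm \<dots> \<le> (conv BF BF k - conv BG BG k) / \<delta> * decay k t"
      unfolding norm_minus_cancel
      by (rule Duhamel_bound[OF k(1) t _ G0])
         (auto intro!: continuous_intros continuous_on_conv[OF F] continuous_on_conv[OF G] conv_compare[OF F G d])
    finally show ?thesis using 1 k by (simp add: Maj_def diff_divide_distrib)
  next
    case 2
    then have k: "k \<noteq> 0" using S by auto
    have zero: "majorized (\<lambda>_ _. 0) (\<lambda>_. 0)" by (simp add: majorized_def)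
    have bF: "norm (conv (\<lambda>j. F j t) (\<lambda>j. F j t) k) \<le> conv BF BF k * decay k t" if "t \<in> {0..T}" for t
      using conv_compare[OF F zero _ that, of k] F by (simp add: majorized_def conv_def)
    have c0: "0 \<le> conv BF BF k"
      unfolding conv_def by (intro infsum_nonneg mult_nonneg_nonneg majorized_nonneg[OF F])
    have "norm (exp (Lam k t)) \<le> decay k t"
    proof -
      have "Re (Lam k t) \<le> - (2 * pi * \<delta> * k\<^sup>2 * t)"
        using Re_Lam_diff[of 0 t k] t by (simp add: Lam_def)
      also have "\<dots> \<le> - (pi * \<delta> * \<bar>real_of_int k\<bar> * t)"
      proof -
        have "\<bar>real_of_int k\<bar> \<le> 2 * (real_of_int k)\<^sup>2"
          using abs_int_le_square[of k] zero_le_power2[of "real_of_int k"] by linarith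
        from mult_left_mono[OF this, of "pi * \<delta> * t"] show ?thesis
          using t \<delta> by (simp add: mult_ac)
      qed
      finally show ?thesis by (simp add: decay_def norm_exp_eq_Re)
    qed
    then have "norm (exp (Lam k t) * a k) \<le> norm (a k) * decay k t"
      unfolding norm_mult by (subst mult.commute) (intro mult_left_mono, auto)
    moreover have "norm (exp (Lam k t) * (fsym k / 2 * integral {0..t} (\<lambda>\<tau>. exp (- Lam k \<tau>) * conv (\<lambda>j. F j \<tau>) (\<lambda>j. F j \<tau>) k)))
        \<le> conv BF BF k / \<delta> * decay k t"
      by (rule Duhamel_bound[OF k t continuous_on_conv[OF F] c0 bF])
    moreover have "Phi S' F k t - Phi S G k t = exp (Lam k t) * a k
        - exp (Lam k t) * (fsym k / 2 * integral {0..t} (\<lambda>\<tau>. exp (- Lam k \<tau>) * conv (\<lambda>j. F j \<tau>) (\<lambda>j. F j \<tau>) k))"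
      using 2 by (simp add: Phi_def right_diff_distrib)
    ultimately have "norm (Phi S' F k t - Phi S G k t) \<le> norm (a k) * decay k t + conv BF BF k / \<delta> * decay k t"
      using norm_triangle_ineq4 by (smt (verit))
    then show ?thesis using 2 by (simp add: Maj_def distrib_right)
  qed (use S in \<open>auto simp: Phi_def Maj_def\<close>)
qed

definition A where "A = (\<Sum>\<^sub>\<infinity>k. norm (a k))"

lemma A_nonneg: "0 \<le> A"
  unfolding A_def by (rule infsum_nonneg) simp

lemma A_small: "8 * A \<le> \<delta>"
  using a_small by (simp add: A_def)

text \<open>The ball of radius \<open>2 A\<close> in the space of summable sequences is mapped into itself by the
  majorant operator: \<open>A + (2 A)\<^sup>2 / \<delta> \<le> 2 A\<close> because \<open>A\<close> is small compared with \<open>\<delta>\<close>.\<close>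

lemma Maj_ball:
  assumes B: "B summable_on UNIV" "\<And>k. 0 \<le> B k" "infsum B UNIV \<le> 2 * A"
  shows "Maj S B summable_on UNIV" "\<And>k. 0 \<le> Maj S B k" "infsum (Maj S B) UNIV \<le> 2 * A"
proof -
  have Bn: "(\<lambda>k. norm (B k)) summable_on UNIV" using B by simp
  have c0: "0 \<le> conv B B k" for k
    unfolding conv_def by (intro infsum_nonneg mult_nonneg_nonneg B)
  then have cs: "conv B B summable_on UNIV" using conv_abs_summable[OF Bn Bn] by simp
  show M0: "0 \<le> Maj S B k" for k using c0[of k] \<delta> by (simp add: Maj_def)
  have le: "Maj S B k \<le> norm (a k) + conv B B k / \<delta>" for k
    using c0[of k] \<delta> by (simp add: Maj_def)
  have hs: "((\<lambda>k. norm (a k) + conv B B k / \<delta>) has_sum (A + (infsum B UNIV * infsum B UNIV) / \<delta>)) UNIV"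
    unfolding A_def infsum_conv[OF Bn Bn, symmetric]
    by (intro has_sum_add has_sum_divide_const has_sum_infsum a_summable cs)
  then have s: "(\<lambda>k. norm (a k) + conv B B k / \<delta>) summable_on UNIV" by (rule has_sum_imp_summable)
  show Ms: "Maj S B summable_on UNIV"
    by (rule infsum_norm_mono(2)[OF _ s]) (use le M0 in auto)
  have "infsum (Maj S B) UNIV \<le> A + (infsum B UNIV * infsum B UNIV) / \<delta>"
    using infsum_mono[OF Ms s le] infsumI[OF hs] by simp
  also have "\<dots> \<le> A + (2 * A) * (2 * A) / \<delta>"
    using B \<delta> by (intro add_mono divide_right_mono mult_mono) (auto intro!: infsum_nonneg A_nonneg)
  also have "\<dots> \<le> 2 * A"
  proof -
    have "A * (8 * A) \<le> A * \<delta>" by (rule mult_left_mono[OF A_small A_nonneg])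
    then have "4 * A * A \<le> A * \<delta>" using zero_le_square[of A] by linarith
    then show ?thesis using \<delta> by (simp add: divide_simps algebra_simps)
  qed
  finally show "infsum (Maj S B) UNIV \<le> 2 * A" .
qed

lemma Miter_ball:
  "Miter S n summable_on UNIV" "\<And>k. 0 \<le> Miter S n k" "infsum (Miter S n) UNIV \<le> 2 * A"
proof -
  have "Miter S n summable_on UNIV \<and> (\<forall>k. 0 \<le> Miter S n k) \<and> infsum (Miter S n) UNIV \<le> 2 * A"
  proof (induction n)
    case 0
    then show ?case by (simp add: Miter_simps A_nonneg)
  next
    case (Suc n)
    then show ?case unfolding Miter_simps using Maj_ball[of "Miter S n" S] by blast
  qed
  then show "Miter S n summable_on UNIV" "\<And>k. 0 \<le> Miter S n k" "infsum (Miter S n) UNIV \<le> 2 * A"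
    by auto
qed

lemma iter_majorized: "0 \<notin> S \<Longrightarrow> majorized (iter S n) (Miter S n)"
proof (induction n)
  case 0
  then show ?case by (simp add: majorized_def iter_simps Miter_simps)
next
  case (Suc n)
  have zero: "majorized (\<lambda>_ _. 0) (\<lambda>_. 0)" by (simp add: majorized_def)
  have "norm (Phi S (iter S n) k t) \<le> Maj S (Miter S n) k * decay k t" if t: "t \<in> {0..T}" for k t
    using Phi_compare[OF Suc.IH[OF Suc.prems] zero empty_subsetI Suc.prems _ t, of k] Suc
    by (simp add: majorized_def Phi_def Maj_def split: if_splits)
  then show ?case
    using continuous_on_Phi[OF Suc.IH[OF Suc.prems]] Miter_ball(1)[of S "Suc n"]
    unfolding majorized_def iter_simps Miter_simps by blast
qed

text \<open>Enlarging \<open>S\<close> and iterating further both change the iterates by no more than the increase of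
  their majorants. Since the majorants are monotone and bounded, this single inequality gives the
  convergence of the iteration and that of the truncated solutions.\<close>

lemma iter_compare:
  assumes S: "S \<subseteq> S'" "0 \<notin> S'" and "n \<le> n'" and t: "t \<in> {0..T}"
  shows "norm (iter S' n' k t - iter S n k t) \<le> (Miter S' n' k - Miter S n k) * decay k t"
  using assms(3) t
proof (induction n arbitrary: n' k t)
  case 0
  then show ?case using iter_majorized[OF S(2), of n'] by (simp add: iter_simps Miter_simps majorized_def)
next
  case (Suc n)
  then obtain n'' where n'': "n' = Suc n''" "n \<le> n''" by (cases n') auto
  have S0: "0 \<notin> S" using S by auto
  show ?case unfolding n''(1) iter_simps Miter_simps
    by (rule Phi_compare[OF iter_majorized[OF S(2)] iter_majorized[OF S0] S]) (use Suc n'' in auto)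
qed

lemma Miter_mono:
  assumes "S \<subseteq> S'" "0 \<notin> S'" "n \<le> n'"
  shows "Miter S n k \<le> Miter S' n' k"
proof -
  have "0 \<le> (Miter S' n' k - Miter S n k) * decay k 0"
    by (rule order_trans[OF norm_ge_zero iter_compare[OF assms]]) (use T in auto)
  then show ?thesis by (simp add: decay_def)
qed

lemma Miter_le: "Miter S n k \<le> 2 * A"
proof -
  have "sum (Miter S n) {k} \<le> infsum (Miter S n) UNIV"
    by (rule finite_sum_le_infsum) (use Miter_ball in auto)
  then show ?thesis using Miter_ball(3)[of S n] by simp
qed

definition sol :: "int set \<Rightarrow> int \<Rightarrow> real \<Rightarrow> complex"
  where "sol S k t = lim (\<lambda>n. iter S n k t)"

definition Msol :: "int set \<Rightarrow> int \<Rightarrow> real"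
  where "Msol S k = lim (\<lambda>n. Miter S n k)"

lemma Miter_lim:
  assumes "0 \<notin> S"
  shows "(\<lambda>n. Miter S n k) \<longlonglongrightarrow> Msol S k"
proof -
  have "incseq (\<lambda>n. Miter S n k)" using Miter_mono[OF order_refl assms] by (auto simp: incseq_def)
  then obtain L where "(\<lambda>n. Miter S n k) \<longlonglongrightarrow> L"
    by (rule incseq_convergent) (use Miter_le in auto)
  then show ?thesis unfolding Msol_def by (simp add: limI)
qed

lemma Miter_le_Msol: "0 \<notin> S \<Longrightarrow> Miter S n k \<le> Msol S k"
  by (rule incseq_le[OF _ Miter_lim]) (auto simp: incseq_def Miter_mono)

lemma Msol_ball:
  assumes S: "0 \<notin> S"
  shows "Msol S summable_on UNIV" "0 \<le> Msol S k" "infsum (Msol S) UNIV \<le> 2 * A"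
proof -
  show n: "0 \<le> Msol S k" for k using Miter_le_Msol[OF S, of 0 k] by (simp add: Miter_simps)
  have K: "sum (Msol S) K \<le> 2 * A" if "finite K" for K
  proof (rule tendsto_upperbound)
    show "(\<lambda>n. \<Sum>k\<in>K. Miter S n k) \<longlonglongrightarrow> sum (Msol S) K"
      by (intro tendsto_sum Miter_lim S)
    have "sum (Miter S n) K \<le> infsum (Miter S n) UNIV" for n
      by (rule finite_sum_le_infsum) (use Miter_ball that in auto)
    then show "\<forall>\<^sub>F n in sequentially. (\<Sum>k\<in>K. Miter S n k) \<le> 2 * A"
      using Miter_ball(3) by (intro always_eventually allI) (metis order_trans)
  qed simp
  show s: "Msol S summable_on UNIV"
    by (rule nonneg_bdd_above_summable_on) (auto intro!: bdd_aboveI2[where M="2 * A"] K n)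
  show "infsum (Msol S) UNIV \<le> 2 * A"
    by (rule infsum_le_finite_sums[OF s]) (rule K)
qed

lemma sol_lim:
  assumes S: "0 \<notin> S" and t: "t \<in> {0..T}"
  shows "(\<lambda>n. iter S n k t) \<longlonglongrightarrow> sol S k t"
proof -
  have "Cauchy (\<lambda>n. iter S n k t)"
  proof (rule CauchyI')
    fix e :: real assume "e > 0"
    then obtain M where M: "\<And>n. n \<ge> M \<Longrightarrow> dist (Miter S n k) (Msol S k) < e"
      using Miter_lim[OF S, of k] by (auto simp: lim_sequentially)
    have "dist (iter S p k t) (iter S n k t) < e" if "p \<ge> M" "n > p" for p n
    proof -
      have "dist (iter S p k t) (iter S n k t) = norm (iter S n k t - iter S p k t)"
        by (simp add: dist_norm norm_minus_commute)
      also have "\<dots> \<le> (Miter S n k - Miter S p k) * decay k t"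
        using that by (intro iter_compare[OF order_refl S _ t]) simp
      also have "\<dots> \<le> (Miter S n k - Miter S p k) * 1"
        using that t Miter_mono[OF order_refl S, of p n k] by (intro mult_left_mono decay_le_1) auto
      also have "\<dots> \<le> Msol S k - Miter S p k" using Miter_le_Msol[OF S] by simp
      also have "\<dots> < e" using M[of p] that Miter_le_Msol[OF S, of p k] by (simp add: dist_real_def)
      finally show ?thesis .
    qed
    then show "\<exists>M. \<forall>p\<ge>M. \<forall>n>p. dist (iter S p k t) (iter S n k t) < e" by blast
  qed
  then show ?thesis unfolding sol_def by (simp add: Cauchy_convergent_iff convergent_LIMSEQ_iff)
qed

lemma sol_iter_compare:
  assumes S: "0 \<notin> S" and t: "t \<in> {0..T}"
  shows "norm (sol S k t - iter S n k t) \<le> (Msol S k - Miter S n k) * decay k t"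
proof (rule tendsto_le[OF sequentially_bot])
  show "(\<lambda>n'. norm (iter S n' k t - iter S n k t)) \<longlonglongrightarrow> norm (sol S k t - iter S n k t)"
    by (intro tendsto_intros sol_lim S t)
  show "(\<lambda>n'. (Miter S n' k - Miter S n k) * decay k t) \<longlonglongrightarrow> (Msol S k - Miter S n k) * decay k t"
    by (intro tendsto_intros Miter_lim S)
  show "\<forall>\<^sub>F n' in sequentially. norm (iter S n' k t - iter S n k t) \<le> (Miter S n' k - Miter S n k) * decay k t"
    using iter_compare[OF order_refl S _ t] by (rule eventually_sequentiallyI)
qed

lemma sol_compare:
  assumes S: "S \<subseteq> S'" "0 \<notin> S'" and t: "t \<in> {0..T}"
  shows "norm (sol S' k t - sol S k t) \<le> (Msol S' k - Msol S k) * decay k t"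
proof (rule tendsto_le[OF sequentially_bot])
  have S0: "0 \<notin> S" using S by auto
  show "(\<lambda>n. norm (iter S' n k t - iter S n k t)) \<longlonglongrightarrow> norm (sol S' k t - sol S k t)"
    by (intro tendsto_intros sol_lim S S0 t)
  show "(\<lambda>n. (Miter S' n k - Miter S n k) * decay k t) \<longlonglongrightarrow> (Msol S' k - Msol S k) * decay k t"
    by (intro tendsto_intros Miter_lim S S0)
  show "\<forall>\<^sub>F n in sequentially. norm (iter S' n k t - iter S n k t) \<le> (Miter S' n k - Miter S n k) * decay k t"
    by (intro always_eventually allI iter_compare S t order_refl)
qed

lemma sol_majorized:
  assumes S: "0 \<notin> S"
  shows "majorized (sol S) (Msol S)"
  unfolding majorized_def
proof (intro conjI allI impI)
  show "norm (sol S k t) \<le> Msol S k * decay k t" if "t \<in> {0..T}" for k t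
    using sol_iter_compare[OF S that, of k 0] by (simp add: iter_simps Miter_simps)
  show "continuous_on {0..T} (sol S k)" for k
  proof (rule uniform_limit_theorem)
    show "\<forall>\<^sub>F n in sequentially. continuous_on {0..T} (iter S n k)"
      using iter_majorized[OF S] by (simp add: majorized_def)
    show "uniform_limit {0..T} (\<lambda>n. iter S n k) (sol S k) sequentially"
    proof (rule uniform_limitI)
      fix e :: real assume "e > 0"
      then have "\<forall>\<^sub>F n in sequentially. dist (Miter S n k) (Msol S k) < e"
        using Miter_lim[OF S, of k] by (rule tendstoD[rotated])
      then show "\<forall>\<^sub>F n in sequentially. \<forall>t\<in>{0..T}. dist (iter S n k t) (sol S k t) < e"
      proof eventually_elim
        case (elim n)
        show ?case
        proof
          fix t assume t: "t \<in> {0..T}"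
          have "dist (iter S n k t) (sol S k t) \<le> (Msol S k - Miter S n k) * decay k t"
            using sol_iter_compare[OF S t] by (simp add: dist_norm norm_minus_commute)
          also have "\<dots> \<le> (Msol S k - Miter S n k) * 1"
            using t Miter_le_Msol[OF S, of n k] by (intro mult_left_mono decay_le_1) auto
          also have "\<dots> < e" using elim Miter_le_Msol[OF S, of n k] by (simp add: dist_real_def)
          finally show "dist (iter S n k t) (sol S k t) < e" .
        qed
      qed
    qed
  qed simp
qed (rule Msol_ball[OF S])

lemma Msol_fixed:
  assumes S: "0 \<notin> S"
  shows "Maj S (Msol S) k = Msol S k"
proof (rule LIMSEQ_unique)
  show "(\<lambda>n. Miter S (Suc n) k) \<longlonglongrightarrow> Msol S k"
    using Miter_lim[OF S, of k] by (rule LIMSEQ_Suc)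
  have "(\<lambda>n. conv (Miter S n) (Miter S n) k) \<longlonglongrightarrow> conv (Msol S) (Msol S) k"
    unfolding conv_def
  proof (rule tendsto_infsum_dominated)
    show "(\<lambda>n. Miter S n (k - j) * Miter S n j) \<longlonglongrightarrow> Msol S (k - j) * Msol S j" for j
      by (intro tendsto_intros Miter_lim S)
    show "\<forall>\<^sub>F n in sequentially. \<forall>j. norm (Miter S n (k - j) * Miter S n j) \<le> Msol S (k - j) * Msol S j"
      using Miter_ball(2) Miter_le_Msol[OF S] Msol_ball(2)[OF S]
      by (intro always_eventually allI) (auto simp: abs_mult intro!: mult_mono)
    have "(\<lambda>k. norm (Msol S k)) summable_on UNIV" using Msol_ball[OF S] by simp
    from conv_term_summable[OF this this, of k]
    show "(\<lambda>j. Msol S (k - j) * Msol S j) summable_on UNIV" using Msol_ball(2)[OF S] by simp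
  qed
  then show "(\<lambda>n. Miter S (Suc n) k) \<longlonglongrightarrow> Maj S (Msol S) k"
    unfolding Miter_simps Maj_def using \<delta> by (auto intro!: tendsto_intros)
qed

lemma sol_fixed:
  assumes S: "0 \<notin> S" and t: "t \<in> {0..T}"
  shows "Phi S (sol S) k t = sol S k t"
proof (rule LIMSEQ_unique)
  show "(\<lambda>n. iter S (Suc n) k t) \<longlonglongrightarrow> sol S k t"
    using sol_lim[OF S t, of k] by (rule LIMSEQ_Suc)
  have "(\<lambda>n. Phi S (sol S) k t - iter S (Suc n) k t) \<longlonglongrightarrow> 0"
  proof (rule Lim_null_comparison)
    show "\<forall>\<^sub>F n in sequentially. norm (Phi S (sol S) k t - iter S (Suc n) k t) \<le> (Msol S k - Miter S (Suc n) k) * decay k t"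
    proof (intro always_eventually allI)
      fix n
      have "norm (Phi S (sol S) k t - Phi S (iter S n) k t) \<le> (Maj S (Msol S) k - Maj S (Miter S n) k) * decay k t"
        by (rule Phi_compare[OF sol_majorized[OF S] iter_majorized[OF S] order_refl S sol_iter_compare[OF S] t])
      then show "norm (Phi S (sol S) k t - iter S (Suc n) k t) \<le> (Msol S k - Miter S (Suc n) k) * decay k t"
        by (simp add: Msol_fixed[OF S] iter_simps Miter_simps)
    qed
    have "(\<lambda>n. (Msol S k - Miter S (Suc n) k) * decay k t) \<longlonglongrightarrow> (Msol S k - Msol S k) * decay k t"
      by (intro tendsto_intros LIMSEQ_Suc Miter_lim S)
    then show "(\<lambda>n. (Msol S k - Miter S (Suc n) k) * decay k t) \<longlonglongrightarrow> 0" by simp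
  qed
  then have "(\<lambda>n. Phi S (sol S) k t - (Phi S (sol S) k t - iter S (Suc n) k t)) \<longlonglongrightarrow> Phi S (sol S) k t - 0"
    by (intro tendsto_diff tendsto_const)
  then show "(\<lambda>n. iter S (Suc n) k t) \<longlonglongrightarrow> Phi S (sol S) k t" by simp
qed

lemma sol_ODE:
  assumes S: "0 \<notin> S" and k: "k \<in> S" and t: "t \<in> {0..T}"
  shows "(sol S k has_vector_derivative
      lam k t * sol S k t - fsym k / 2 * conv (\<lambda>j. sol S j t) (\<lambda>j. sol S j t) k) (at t within {0..T})"
proof -
  define g where "g \<tau> = exp (- Lam k \<tau>) * conv (\<lambda>j. sol S j \<tau>) (\<lambda>j. sol S j \<tau>) k" for \<tau>
  define I where "I t = a k - fsym k / 2 * integral {0..t} g" for t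
  have g: "continuous_on {0..T} g"
    unfolding g_def by (intro continuous_intros continuous_on_conv[OF sol_majorized[OF S]])
  have "((\<lambda>u. integral {0..u} g) has_vector_derivative g t) (at t within {0..T})"
    by (rule integral_has_vector_derivative[OF g t])
  from has_vector_derivative_diff[OF has_vector_derivative_const
      bounded_linear.has_vector_derivative[OF bounded_linear_mult_right this]]
  have dI: "(I has_vector_derivative (0 - fsym k / 2 * g t)) (at t within {0..T})"
    unfolding I_def .
  have dE: "((\<lambda>t. exp (Lam k t)) has_vector_derivative (lam k t * exp (Lam k t))) (at t within {0..T})"
    using field_vector_diff_chain_within[OF DERIV_Lam has_field_derivative_at_within[OF DERIV_exp]]
    by (simp add: o_def)
  have "((\<lambda>t. exp (Lam k t) * I t) has_vector_derivative
      (exp (Lam k t) * (0 - fsym k / 2 * g t) + lam k t * exp (Lam k t) * I t)) (at t within {0..T})"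
    by (rule has_vector_derivative_mult[OF dE dI])
  moreover have e: "sol S k t = exp (Lam k t) * I t" if "t \<in> {0..T}" for t
    using sol_fixed[OF S that, of k] k by (simp add: Phi_def I_def g_def[abs_def])
  ultimately have "(sol S k has_vector_derivative
      (exp (Lam k t) * (0 - fsym k / 2 * g t) + lam k t * exp (Lam k t) * I t)) (at t within {0..T})"
    by (subst has_vector_derivative_cong_ev[where g="\<lambda>t. exp (Lam k t) * I t"]) (use t in \<open>auto intro!: always_eventually\<close>)
  moreover have "exp (Lam k t) * (0 - fsym k / 2 * g t) + lam k t * exp (Lam k t) * I t
      = lam k t * sol S k t - fsym k / 2 * conv (\<lambda>j. sol S j t) (\<lambda>j. sol S j t) k"
    by (simp add: e[OF t] g_def exp_minus)
  ultimately show ?thesis by simp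
qed

lemma sol_outside: "k \<notin> S \<Longrightarrow> 0 \<notin> S \<Longrightarrow> t \<in> {0..T} \<Longrightarrow> sol S k t = 0"
  using sol_fixed[of S t k] by (simp add: Phi_def)

lemma sol_0: "k \<in> S \<Longrightarrow> 0 \<notin> S \<Longrightarrow> sol S k 0 = a k"
  using sol_fixed[of S 0 k] T by (simp add: Phi_def Lam_def)

text \<open>Together with \<open>sol_compare\<close>, the convergence of the majorants as the truncation is removed gives
  the convergence of the truncated solutions.\<close>

lemma Miter_truncation:
  assumes S: "0 \<notin> S"
  shows "(\<lambda>N. Miter (S \<inter> {-int N..int N}) n k) \<longlonglongrightarrow> Miter S n k"
proof (induction n arbitrary: k)
  case 0
  then show ?case by (simp add: Miter_simps)
next
  case (Suc n)
  let ?S = "\<lambda>N. S \<inter> {-int N..int N}"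
  have "(\<lambda>N. conv (Miter (?S N) n) (Miter (?S N) n) k) \<longlonglongrightarrow> conv (Miter S n) (Miter S n) k"
    unfolding conv_def
  proof (rule tendsto_infsum_dominated)
    show "(\<lambda>N. Miter (?S N) n (k - j) * Miter (?S N) n j) \<longlonglongrightarrow> Miter S n (k - j) * Miter S n j" for j
      by (intro tendsto_intros Suc)
    show "\<forall>\<^sub>F N in sequentially. \<forall>j. norm (Miter (?S N) n (k - j) * Miter (?S N) n j) \<le> Miter S n (k - j) * Miter S n j"
      using Miter_ball(2) by (intro always_eventually allI) (auto simp: abs_mult intro!: mult_mono Miter_mono S)
    have "(\<lambda>k. norm (Miter S n k)) summable_on UNIV" using Miter_ball[of S n] by simp
    from conv_term_summable[OF this this, of k]
    show "(\<lambda>j. Miter S n (k - j) * Miter S n j) summable_on UNIV" using Miter_ball(2) by simp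
  qed
  then have lim: "(\<lambda>N. norm (a k) + conv (Miter (?S N) n) (Miter (?S N) n) k / \<delta>) \<longlonglongrightarrow>
      norm (a k) + conv (Miter S n) (Miter S n) k / \<delta>"
    using \<delta> by (auto intro!: tendsto_intros)
  show ?case
  proof (cases "k \<in> S")
    case True
    have "\<forall>\<^sub>F N in sequentially. norm (a k) + conv (Miter (?S N) n) (Miter (?S N) n) k / \<delta> = Miter (?S N) (Suc n) k"
      by (rule eventually_sequentiallyI[of "nat \<bar>k\<bar>"]) (use True in \<open>auto simp: Miter_simps Maj_def\<close>)
    from Lim_transform_eventually[OF lim this] show ?thesis
      using True by (simp add: Miter_simps Maj_def)
  qed (simp add: Miter_simps Maj_def)
qed

lemma Msol_truncation:
  assumes S: "0 \<notin> S"
  shows "(\<lambda>N. Msol (S \<inter> {-int N..int N}) k) \<longlonglongrightarrow> Msol S k"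
proof (rule tendstoI)
  let ?S = "\<lambda>N. S \<inter> {-int N..int N}"
  fix e :: real assume e: "e > 0"
  from tendstoD[OF Miter_lim[OF S, of k], of "e / 2"] e
  obtain n where "dist (Miter S n k) (Msol S k) < e / 2"
    by (auto simp: eventually_sequentially)
  then have n: "Msol S k - e / 2 < Miter S n k" by (simp add: dist_real_def abs_if split: if_splits)
  have "\<forall>\<^sub>F N in sequentially. dist (Miter (?S N) n k) (Miter S n k) < e / 2"
    using Miter_truncation[OF S, of n k] e by (intro tendstoD) auto
  then show "\<forall>\<^sub>F N in sequentially. dist (Msol (?S N) k) (Msol S k) < e"
  proof eventually_elim
    case (elim N)
    have "Miter (?S N) n k \<le> Msol (?S N) k" using S by (intro Miter_le_Msol) auto
    moreover have "Msol (?S N) k \<le> Msol S k"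
      by (rule LIMSEQ_le[OF Miter_lim Miter_lim]) (use S in \<open>auto intro!: Miter_mono\<close>)
    moreover have "Miter S n k - e / 2 < Miter (?S N) n k"
      using elim by (simp add: dist_real_def abs_if split: if_splits)
    ultimately show ?case using n by (simp add: dist_real_def)
  qed
qed

lemma sol_truncation:
  assumes S: "0 \<notin> S" and t: "t \<in> {0..T}"
  shows "(\<lambda>N. sol (S \<inter> {-int N..int N}) k t) \<longlonglongrightarrow> sol S k t"
proof -
  let ?S = "\<lambda>N. S \<inter> {-int N..int N}"
  have "(\<lambda>N. sol S k t - sol (?S N) k t) \<longlonglongrightarrow> 0"
  proof (rule Lim_null_comparison)
    show "\<forall>\<^sub>F N in sequentially. norm (sol S k t - sol (?S N) k t) \<le> (Msol S k - Msol (?S N) k) * decay k t"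
      by (intro always_eventually allI sol_compare S t) auto
    have "(\<lambda>N. (Msol S k - Msol (?S N) k) * decay k t) \<longlonglongrightarrow> (Msol S k - Msol S k) * decay k t"
      by (intro tendsto_intros Msol_truncation S)
    then show "(\<lambda>N. (Msol S k - Msol (?S N) k) * decay k t) \<longlonglongrightarrow> 0" by simp
  qed
  then have "(\<lambda>N. sol S k t - (sol S k t - sol (?S N) k t)) \<longlonglongrightarrow> sol S k t - 0"
    by (intro tendsto_diff tendsto_const)
  then show ?thesis by simp
qed


text \<open>Multiplying mode \<open>k\<close> by \<open>cnj (sol k)\<close>, the linear part dissipates \<open>4 \<pi> \<delta> D\<close> with
  \<open>D = \<Sum> sweight s k * k\<^sup>2 * \<bar>sol k\<bar>\<^sup>2\<close>, and by the trilinear estimate the nonlinear part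
  is at most \<open>2 \<pi> 2\<^bsup>s+1\<^esup> (2 A) D\<close>.\<close>

lemma galerkin_energy:
  assumes S: "finite S" "0 \<notin> S" and small: "2 ^ (s + 1) * A \<le> \<delta>" and t: "t \<in> {0..T}"
  shows "(\<Sum>k\<in>S. sweight s k * (cmod (sol S k t))\<^sup>2) \<le> (\<Sum>k\<in>S. sweight s k * (cmod (a k))\<^sup>2)"
proof -
  define y' where "y' k t = lam k t * sol S k t - fsym k / 2 * conv (\<lambda>j. sol S j t) (\<lambda>j. sol S j t) k" for k t
  define E where "E t = (\<Sum>k\<in>S. sweight s k * (cmod (sol S k t))\<^sup>2)" for t
  define E' where "E' t = (\<Sum>k\<in>S. sweight s k * (2 * Re (cnj (sol S k t) * y' k t)))" for t
  have dE: "(E has_real_derivative E' \<tau>) (at \<tau> within {0..T})" if "\<tau> \<in> {0..T}" for \<tau>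
    unfolding E_def E'_def y'_def
    by (intro DERIV_sum DERIV_cmult has_real_derivative_cmod_sq sol_ODE S that)
  have E'_le: "E' \<tau> \<le> 0" if \<tau>: "\<tau> \<in> {0..T}" for \<tau>
  proof -
    define z where "z k = cmod (sol S k \<tau>)" for k
    define D where "D = (\<Sum>k\<in>S. sweight s k * ((real_of_int k)\<^sup>2 * (z k)\<^sup>2))"
    have z: "0 \<le> z k" "k \<notin> S \<Longrightarrow> z k = 0" for k
      using sol_outside[OF _ S(2) \<tau>] by (simp_all add: z_def)
    have D: "0 \<le> D" unfolding D_def by (intro sum_nonneg mult_nonneg_nonneg sweight_nonneg) auto
    have R: "(\<Sum>k\<in>S. z k) \<le> 2 * A"
    proof -
      have "(\<Sum>k\<in>S. z k) \<le> (\<Sum>k\<in>S. Msol S k)"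
        unfolding z_def by (intro sum_mono majorized_bound[OF sol_majorized[OF S(2)] \<tau>])
      also have "\<dots> \<le> infsum (Msol S) UNIV"
        by (rule finite_sum_le_infsum) (use S Msol_ball[OF S(2)] in auto)
      finally show ?thesis using Msol_ball(3)[OF S(2)] by simp
    qed
    have point: "2 * Re (cnj (sol S k \<tau>) * y' k \<tau>)
        \<le> - (4 * pi * \<delta>) * ((real_of_int k)\<^sup>2 * (z k)\<^sup>2) + 2 * pi * (\<bar>real_of_int k\<bar> * z k * (\<Sum>j\<in>S. z (k - j) * z j))" for k
    proof -
      let ?c = "conv (\<lambda>j. sol S j \<tau>) (\<lambda>j. sol S j \<tau>) k"
      have "?c = (\<Sum>\<^sub>\<infinity>j\<in>S. sol S (k - j) \<tau> * sol S j \<tau>)"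
        unfolding conv_def by (rule infsum_cong_neutral) (use sol_outside[OF _ S(2) \<tau>] in auto)
      then have c: "?c = (\<Sum>j\<in>S. sol S (k - j) \<tau> * sol S j \<tau>)" using S by simp
      have nc: "cmod ?c \<le> (\<Sum>j\<in>S. z (k - j) * z j)"
        unfolding c z_def by (rule order_trans[OF norm_sum]) (simp add: norm_mult)
      have "cnj (sol S k \<tau>) * (lam k \<tau> * sol S k \<tau>) = complex_of_real ((z k)\<^sup>2) * lam k \<tau>"
        unfolding z_def complex_norm_square by (simp only: mult_ac)
      then have lin: "Re (cnj (sol S k \<tau>) * (lam k \<tau> * sol S k \<tau>)) = (z k)\<^sup>2 * Re (lam k \<tau>)"
        by (simp only: times_complex.sel Re_complex_of_real Im_complex_of_real mult_zero_left diff_zero)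
      have "(z k)\<^sup>2 * Re (lam k \<tau>) \<le> (z k)\<^sup>2 * - (2 * pi * \<delta> * k\<^sup>2)"
        by (intro mult_left_mono Re_lam_le \<tau>) simp
      moreover have "- Re (cnj (sol S k \<tau>) * (fsym k / 2 * ?c)) \<le> pi * (\<bar>real_of_int k\<bar> * z k * (\<Sum>j\<in>S. z (k - j) * z j))"
      proof -
        have "- Re (cnj (sol S k \<tau>) * (fsym k / 2 * ?c)) \<le> cmod (cnj (sol S k \<tau>) * (fsym k / 2 * ?c))"
          using complex_Re_le_cmod[of "- (cnj (sol S k \<tau>) * (fsym k / 2 * ?c))"] by (simp only: uminus_complex.sel norm_minus_cancel)
        also have "\<dots> = z k * (pi * \<bar>real_of_int k\<bar>) * cmod ?c"
          unfolding norm_mult[of "cnj _"] norm_mult[of "fsym k / 2"] norm_divide norm_fsym complex_mod_cnj z_def by simp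
        also have "\<dots> \<le> z k * (pi * \<bar>real_of_int k\<bar>) * (\<Sum>j\<in>S. z (k - j) * z j)"
          by (intro mult_left_mono nc mult_nonneg_nonneg z) auto
        finally show ?thesis by (simp only: mult_ac)
      qed
      moreover have "Re (cnj (sol S k \<tau>) * y' k \<tau>) = Re (cnj (sol S k \<tau>) * (lam k \<tau> * sol S k \<tau>))
          - Re (cnj (sol S k \<tau>) * (fsym k / 2 * ?c))"
        unfolding y'_def right_diff_distrib by (simp only: minus_complex.sel)
      ultimately show ?thesis unfolding lin by (simp add: algebra_simps)
    qed
    have "E' \<tau> \<le> (\<Sum>k\<in>S. sweight s k * (- (4 * pi * \<delta>) * ((real_of_int k)\<^sup>2 * (z k)\<^sup>2)
        + 2 * pi * (\<bar>real_of_int k\<bar> * z k * (\<Sum>j\<in>S. z (k - j) * z j))))"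
      unfolding E'_def by (intro sum_mono mult_left_mono point sweight_nonneg)
    also have "\<dots> = - (4 * pi * \<delta>) * D
        + 2 * pi * (\<Sum>k\<in>S. sweight s k * (\<bar>real_of_int k\<bar> * z k * (\<Sum>j\<in>S. z (k - j) * z j)))"
      unfolding D_def sum_distrib_left[of "- (4 * pi * \<delta>)"] sum_distrib_left[of "2 * pi"] sum.distrib[symmetric]
      by (intro sum.cong refl) (simp only: distrib_left mult.left_commute)
    also have "\<dots> \<le> - (4 * pi * \<delta>) * D + 2 * pi * (2 ^ (s + 1) * (\<Sum>k\<in>S. z k) * D)"
      unfolding D_def by (intro add_left_mono mult_left_mono trilinear_sweight S z) auto
    also have "\<dots> \<le> - (4 * pi * \<delta>) * D + 2 * pi * (2 ^ (s + 1) * (2 * A) * D)"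
      by (intro add_left_mono mult_left_mono mult_right_mono R D) auto
    also have "\<dots> = 4 * pi * D * (2 ^ (s + 1) * A - \<delta>)" by (simp add: algebra_simps)
    also have "\<dots> \<le> 0" using small D by (intro mult_nonneg_nonpos) auto
    finally show ?thesis .
  qed
  have "(E' has_integral (E t - E 0)) {0..t}"
  proof (rule fundamental_theorem_of_calculus)
    show "(E has_vector_derivative E' x) (at x within {0..t})" if "x \<in> {0..t}" for x
      using dE[of x] that t unfolding has_real_derivative_iff_has_vector_derivative
      by (auto intro: has_vector_derivative_within_subset)
  qed (use t in auto)
  from has_integral_neg[OF this] have "0 \<le> - (E t - E 0)"
    by (rule has_integral_nonneg) (use E'_le t in auto)
  moreover have "E 0 = (\<Sum>k\<in>S. sweight s k * (cmod (a k))\<^sup>2)"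
    unfolding E_def by (intro sum.cong refl) (simp add: sol_0 S)
  ultimately show ?thesis by (simp add: E_def)
qed

text \<open>For finitely many modes the energy can be differentiated term by term. The bound obtained
  there survives the limit because every finite partial sum does.\<close>

lemma sol_energy:
  assumes small: "2 ^ (s + 1) * A \<le> \<delta>" and t: "t \<in> {0..T}" and K: "finite K"
    and E: "\<And>K. finite K \<Longrightarrow> 0 \<notin> K \<Longrightarrow> (\<Sum>k\<in>K. sweight s k * (cmod (a k))\<^sup>2) \<le> E"
  shows "(\<Sum>k\<in>K. sweight s k * (cmod (sol (- {0}) k t))\<^sup>2) \<le> E"
proof (rule tendsto_upperbound)
  let ?S = "\<lambda>N. - {0} \<inter> {-int N..int N}"
  show "(\<lambda>N. \<Sum>k\<in>K. sweight s k * (cmod (sol (?S N) k t))\<^sup>2) \<longlonglongrightarrow> (\<Sum>k\<in>K. sweight s k * (cmod (sol (- {0}) k t))\<^sup>2)"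
    by (intro tendsto_intros sol_truncation t) auto
  have "(\<Sum>k\<in>K. sweight s k * (cmod (sol (?S N) k t))\<^sup>2) \<le> E" for N
  proof -
    have "(\<Sum>k\<in>K. sweight s k * (cmod (sol (?S N) k t))\<^sup>2) \<le> (\<Sum>k\<in>K \<union> ?S N. sweight s k * (cmod (sol (?S N) k t))\<^sup>2)"
      by (rule sum_mono2) (use K in \<open>auto intro!: mult_nonneg_nonneg sweight_nonneg\<close>)
    also have "\<dots> = (\<Sum>k\<in>?S N. sweight s k * (cmod (sol (?S N) k t))\<^sup>2)"
      by (rule sum.mono_neutral_right) (use K t sol_outside[of _ "?S N" t] in auto)
    also have "\<dots> \<le> (\<Sum>k\<in>?S N. sweight s k * (cmod (a k))\<^sup>2)"
      by (rule galerkin_energy[OF _ _ small t]) auto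
    also have "\<dots> \<le> E" by (rule E) auto
    finally show ?thesis .
  qed
  then show "\<forall>\<^sub>F N in sequentially. (\<Sum>k\<in>K. sweight s k * (cmod (sol (?S N) k t))\<^sup>2) \<le> E"
    by simp
qed simp

end

section \<open>The solution\<close>

lemma power_le_fact_exp:
  fixes y :: real
  assumes "0 \<le> y"
  shows "y ^ j \<le> fact j * exp y"
proof -
  have "sum (\<lambda>n. y ^ n /\<^sub>R fact n) {j} \<le> (\<Sum>n. y ^ n /\<^sub>R fact n)"
    by (rule sum_le_suminf[OF summable_exp_generic]) (use assms in auto)
  then have "y ^ j / fact j \<le> exp y"
    by (simp add: exp_def divide_inverse mult.commute)
  then show ?thesis by (simp add: divide_le_eq mult.commute)
qed

lemma fs_add_const:
  assumes c: "(\<lambda>k. norm (c k)) summable_on UNIV"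
  shows "fs (\<lambda>k. c k + (if k = 0 then z else 0)) x = fs c x + z"
    and "(\<lambda>k. norm (c k + (if k = 0 then z else 0))) summable_on UNIV"
proof -
  have 0: "((\<lambda>k::int. if k = 0 then z else 0) has_sum z) UNIV"
    by (rule has_sum_finite_neutralI[where B="{0}"]) auto
  have zn: "((\<lambda>k::int. if k = 0 then norm z else 0) has_sum norm z) UNIV"
    by (rule has_sum_finite_neutralI[where B="{0}"]) auto
  have "((\<lambda>k. c k * fe k x) has_sum fs c x) UNIV"
    unfolding fs_def by (rule has_sum_infsum, rule abs_summable_summable) (simp add: norm_mult c)
  from has_sum_add[OF this 0] show "fs (\<lambda>k. c k + (if k = 0 then z else 0)) x = fs c x + z"
    unfolding fs_def by (intro infsumI) (auto elim!: has_sum_cong[THEN iffD1, rotated] simp: distrib_right)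
  show "(\<lambda>k. norm (c k + (if k = 0 then z else 0))) summable_on UNIV"
  proof (rule infsum_norm_mono(1)[where B="\<lambda>k. norm (c k) + (if k = 0 then norm z else 0)"])
    show "(\<lambda>k. norm (c k) + (if k = 0 then norm z else 0)) summable_on UNIV"
      by (intro summable_on_add c has_sum_imp_summable[OF zn])
  qed (auto intro: norm_triangle_ineq)
qed

lemma fs_diff:
  assumes c: "(\<lambda>k. norm (c k)) summable_on UNIV" and d: "(\<lambda>k. norm (d k)) summable_on UNIV"
  shows "fs (\<lambda>k. c k - d k) x = fs c x - fs d x"
proof -
  have "((\<lambda>k. c k * fe k x) has_sum fs c x) UNIV" "((\<lambda>k. d k * fe k x) has_sum fs d x) UNIV"
    unfolding fs_def by (rule has_sum_infsum, rule abs_summable_summable, simp add: norm_mult c d)+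
  from has_sum_diff[OF this] show ?thesis
    unfolding fs_def left_diff_distrib[symmetric] by (rule infsumI)
qed

lemma conv_add_const:
  fixes c :: "int \<Rightarrow> complex"
  assumes c: "(\<lambda>k. norm (c k)) summable_on UNIV" and k: "k \<noteq> 0"
  shows "conv (\<lambda>k. c k + (if k = 0 then z else 0)) (\<lambda>k. c k + (if k = 0 then z else 0)) k = conv c c k + 2 * z * c k"
proof -
  have "((\<lambda>j. c (k - j) * c j) has_sum conv c c k) UNIV"
    unfolding conv_def by (rule has_sum_infsum, rule abs_summable_summable, rule conv_term_summable[OF c c])
  moreover have "((\<lambda>j. if j = 0 then z * c k else 0) has_sum z * c k) UNIV"
    by (rule has_sum_finite_neutralI[where B="{0}"]) auto
  moreover have "((\<lambda>j. if j = k then z * c k else 0) has_sum z * c k) UNIV"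
    by (rule has_sum_finite_neutralI[where B="{k}"]) auto
  ultimately have "((\<lambda>j. c (k - j) * c j + (if j = 0 then z * c k else 0) + (if j = k then z * c k else 0))
      has_sum conv c c k + z * c k + z * c k) UNIV"
    by (intro has_sum_add)
  moreover have "(\<lambda>j. (c (k - j) + (if k - j = 0 then z else 0)) * (c j + (if j = 0 then z else 0)))
      = (\<lambda>j. c (k - j) * c j + (if j = 0 then z * c k else 0) + (if j = k then z * c k else 0))"
    using k by (auto simp: fun_eq_iff algebra_simps)
  ultimately show ?thesis
    unfolding conv_def[of "\<lambda>k. c k + (if k = 0 then z else 0)"] by (simp add: infsumI)
qed

lemma square_summable:
  fixes c :: "int \<Rightarrow> real"
  assumes c: "c summable_on UNIV" "\<And>k. 0 \<le> c k"
  shows "(\<lambda>k. (c k)\<^sup>2) summable_on UNIV"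
  using integral_norm_fs(2)[of "\<lambda>k. complex_of_real (c k)"] c by simp

subsection \<open>Smooth test functions\<close>

lemma smooth_plane_D:
  assumes "smooth_plane \<phi>"
  shows "continuous_on UNIV (\<lambda>(t, x). \<phi> t x)" "smooth_plane (Dt \<phi>)" "smooth_plane (Dx \<phi>)"
    "((\<lambda>\<tau>. \<phi> \<tau> x) has_real_derivative Dt \<phi> t x) (at t)"
    "((\<lambda>y. \<phi> t y) has_real_derivative Dx \<phi> t x) (at x)"
proof -
  from assms show "continuous_on UNIV (\<lambda>(t, x). \<phi> t x)" "smooth_plane (Dt \<phi>)" "smooth_plane (Dx \<phi>)"
    by (auto elim: smooth_plane.cases)
  from assms have "(\<lambda>\<tau>. \<phi> \<tau> x) differentiable (at t)" "(\<lambda>y. \<phi> t y) differentiable (at x)"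
    by (auto elim: smooth_plane.cases)
  then show "((\<lambda>\<tau>. \<phi> \<tau> x) has_real_derivative Dt \<phi> t x) (at t)"
    "((\<lambda>y. \<phi> t y) has_real_derivative Dx \<phi> t x) (at x)"
    unfolding Dt_def Dx_def by (simp_all only: DERIV_deriv_iff_real_differentiable)
qed

lemma smooth_plane_torus_test_function:
  assumes \<phi>: "smooth_plane \<phi>" and p: "periodic1 (\<phi> t)"
  shows "torus_test_function (\<phi> t)"
proof -
  have it: "smooth_plane ((Dx ^^ k) \<phi>) \<and> (deriv ^^ k) (\<phi> t) = (Dx ^^ k) \<phi> t" for k
  proof (induction k)
    case (Suc k)
    then have "smooth_plane (Dx ((Dx ^^ k) \<phi>))" using smooth_plane_D(3) by blast
    moreover have "deriv ((Dx ^^ k) \<phi> t) = Dx ((Dx ^^ k) \<phi>) t" by (rule ext) (simp add: Dx_def)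
    ultimately show ?case using Suc by simp
  qed (simp add: \<phi>)
  show ?thesis unfolding torus_test_function_def
  proof (intro conjI allI p)
    fix k x
    have "((Dx ^^ k) \<phi> t has_real_derivative Dx ((Dx ^^ k) \<phi>) t x) (at x)"
      using smooth_plane_D(5) it by blast
    then show "(deriv ^^ k) (\<phi> t) differentiable (at x)"
      using it[of k] real_differentiable_def by auto
  qed
qed

abbreviation weak_integrand :: "real \<Rightarrow> (real \<Rightarrow> real \<Rightarrow> complex) \<Rightarrow> (real \<Rightarrow> real \<Rightarrow> real) \<Rightarrow> real \<Rightarrow> real \<Rightarrow> complex"
  where "weak_integrand \<epsilon> v \<phi> t x \<equiv> - v t x * complex_of_real (Dt \<phi> t x)
    + v t x * weak_deriv 1 (v t) x * complex_of_real (\<phi> t x)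
    - complex_of_real \<epsilon> * v t x * complex_of_real (Dx (Dx \<phi>) t x)"

definition par_int :: "(real \<Rightarrow> real \<Rightarrow> real) \<Rightarrow> int \<Rightarrow> real \<Rightarrow> complex"
  where "par_int \<psi> k t = (\<integral>x. fe k x * complex_of_real (\<psi> t x) \<partial>LI 1)"

lemma continuous_slices:
  assumes "continuous_on UNIV (\<lambda>(t, x). \<psi> t x)"
  shows "continuous_on S (\<psi> t)" "continuous_on S (\<lambda>\<tau>. \<psi> \<tau> x)"
proof -
  have "continuous_on S (\<lambda>x. (t, x))" "continuous_on S (\<lambda>\<tau>. (\<tau>, x))"
    by (intro continuous_intros)+
  with continuous_on_compose2[OF assms] show "continuous_on S (\<psi> t)" "continuous_on S (\<lambda>\<tau>. \<psi> \<tau> x)"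
    by fastforce+
qed

lemma par_int_HK:
  assumes "continuous_on UNIV (\<lambda>(t, x). \<psi> t x)"
  shows "par_int \<psi> k t = integral (cbox 0 1) (\<lambda>x. fe k x * complex_of_real (\<psi> t x))"
  unfolding par_int_def cbox_interval
  by (intro integral_LI_HK continuous_intros continuous_on_fe continuous_slices[OF assms])

lemma continuous_on_par_int:
  assumes \<psi>: "continuous_on UNIV (\<lambda>(t, x). \<psi> t x)"
  shows "continuous_on S (par_int \<psi> k)"
proof -
  have "continuous_on UNIV (\<lambda>t. integral (cbox 0 1) (\<lambda>x. fe k x * complex_of_real (\<psi> t x)))"
  proof (rule integral_continuous_on_param)
    have "continuous_on (UNIV \<times> cbox 0 1) (\<lambda>z. fe k (snd z) * complex_of_real (case z of (t, x) \<Rightarrow> \<psi> t x))"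
      by (intro continuous_intros continuous_on_compose2[OF continuous_on_fe[of UNIV k]] continuous_on_subset[OF \<psi>]) auto
    then show "continuous_on (UNIV \<times> cbox 0 1) (\<lambda>(t, x). fe k x * complex_of_real (\<psi> t x))"
      by (simp add: case_prod_unfold)
  qed
  then show ?thesis using par_int_HK[OF \<psi>, of k] by (auto intro: continuous_on_subset simp: fun_eq_iff cong: continuous_on_cong)
qed

lemma par_int_deriv:
  assumes \<psi>: "smooth_plane \<psi>"
  shows "(par_int \<psi> k has_vector_derivative par_int (Dt \<psi>) k t) (at t within S)"
proof -
  note c = smooth_plane_D(1)[OF \<psi>] smooth_plane_D(1)[OF smooth_plane_D(2)[OF \<psi>]]
  have "((\<lambda>t. integral (cbox 0 1) (\<lambda>x. fe k x * complex_of_real (\<psi> t x))) has_vector_derivative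
      integral (cbox 0 1) (\<lambda>x. fe k x * complex_of_real (Dt \<psi> t x))) (at t within UNIV)"
  proof (rule leibniz_rule_vector_derivative)
    show "((\<lambda>t. fe k x * complex_of_real (\<psi> t x)) has_vector_derivative fe k x * complex_of_real (Dt \<psi> t x)) (at t within UNIV)" for t x
      by (intro bounded_linear.has_vector_derivative[OF bounded_linear_mult_right] has_vector_derivative_of_real)
        (rule smooth_plane_D(4)[OF \<psi>])
    show "(\<lambda>x. fe k x * complex_of_real (\<psi> t x)) integrable_on cbox 0 1" for t
      by (intro integrable_continuous continuous_intros continuous_on_fe continuous_slices[OF c(1)])
    have "continuous_on (UNIV \<times> cbox 0 1) (\<lambda>z. fe k (snd z) * complex_of_real (case z of (t, x) \<Rightarrow> Dt \<psi> t x))"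
      by (intro continuous_intros continuous_on_compose2[OF continuous_on_fe[of UNIV k]] continuous_on_subset[OF c(2)]) auto
    then show "continuous_on (UNIV \<times> cbox 0 1) (\<lambda>(t, x). fe k x * complex_of_real (Dt \<psi> t x))"
      by (simp add: case_prod_unfold)
  qed auto
  then show ?thesis
    unfolding par_int_HK[OF c(2), symmetric] par_int_HK[OF c(1), of k, symmetric]
    by (rule has_vector_derivative_at_within)
qed

lemma par_int_Dx:
  assumes "smooth_plane \<psi>" "periodic1 (\<psi> t)"
  shows "par_int (Dx \<psi>) k t = - fsym k * par_int \<psi> k t"
    and "par_int (Dx (Dx \<psi>)) k t = fsym k ^ 2 * par_int \<psi> k t"
proof -
  note tt = smooth_plane_torus_test_function[OF assms]
  have 1: "(deriv ^^ 1) (\<psi> t) = Dx \<psi> t" by (rule ext) (simp add: Dx_def)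
  have 2: "(deriv ^^ 2) (\<psi> t) = Dx (Dx \<psi>) t"
  proof -
    have "(deriv ^^ 2) (\<psi> t) = deriv (deriv (\<psi> t))" by (simp add: numeral_2_eq_2)
    also have "deriv (\<psi> t) = Dx \<psi> t" by (rule ext) (simp add: Dx_def)
    finally show ?thesis by (simp add: Dx_def fun_eq_iff)
  qed
  show "par_int (Dx \<psi>) k t = - fsym k * par_int \<psi> k t"
    using integral_fe_deriv_iter[OF tt, of k 1] unfolding 1 par_int_def by simp
  show "par_int (Dx (Dx \<psi>)) k t = fsym k ^ 2 * par_int \<psi> k t"
    using integral_fe_deriv_iter[OF tt, of k 2] unfolding 2 par_int_def by simp
qed

lemma par_int_bound:
  assumes \<psi>: "continuous_on UNIV (\<lambda>(t, x). \<psi> t x)"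
  obtains C where "0 \<le> C" "\<And>k t. t \<in> {0..T} \<Longrightarrow> norm (par_int \<psi> k t) \<le> C"
proof -
  have "compact ((\<lambda>(t, x). \<psi> t x) ` ({0..T} \<times> {0..1}))"
    by (intro compact_continuous_image continuous_on_subset[OF \<psi>] compact_Times) auto
  then have "bounded ((\<lambda>(t, x). \<psi> t x) ` ({0..T} \<times> {0..1}))" by (rule compact_imp_bounded)
  then obtain B where B': "\<forall>z\<in>(\<lambda>(t, x). \<psi> t x) ` ({0..T} \<times> {0..1}). norm z \<le> B"
    unfolding bounded_iff by blast
  have B: "norm (\<psi> t x) \<le> B" if "t \<in> {0..T}" "x \<in> {0..1}" for t x
    using B' that by force
  show thesis
  proof
    show "0 \<le> \<bar>B\<bar>" by simp
    fix k t assume t: "t \<in> {0..T}"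
    have "norm (fe k x * complex_of_real (\<psi> t x)) \<le> \<bar>B\<bar>" if "x \<in> {0..1}" for x
      using B[OF t that] by (simp add: norm_mult)
    then have "norm (par_int \<psi> k t) \<le> \<bar>B\<bar> * 1"
      unfolding par_int_def by (intro norm_integral_LI_le) (auto simp: AE_LI)
    then show "norm (par_int \<psi> k t) \<le> \<bar>B\<bar>" by simp
  qed
qed

subsection \<open>Regularity of the solution\<close>

locale burgers_coeffs = coeff_system +
  fixes s :: nat and E :: real
  assumes a_0: "a 0 = 0" and small: "2 ^ (s + 1) * (\<Sum>\<^sub>\<infinity>k. norm (a k)) \<le> \<delta>"
    and s: "s \<ge> 1" and E: "0 \<le> E" and energy_0: "\<And>K. finite K \<Longrightarrow> (\<Sum>k\<in>K. sweight s k * (cmod (a k))\<^sup>2) \<le> E\<^sup>2"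
begin

abbreviation w :: "int \<Rightarrow> real \<Rightarrow> complex"
  where "w \<equiv> sol (- {0})"

definition uc :: "int \<Rightarrow> real \<Rightarrow> complex"
  where "uc k t = w k t + (if k = 0 then \<i> * of_real t + of_real m else 0)"

definition u :: "real \<Rightarrow> real \<Rightarrow> complex"
  where "u t x = fs (\<lambda>k. uc k t) x"

definition Bu :: "int \<Rightarrow> real"
  where "Bu k = Msol (- {0}) k + (if k = 0 then T + \<bar>m\<bar> else 0)"

lemma w_majorized: "majorized w (Msol (- {0}))"
  by (rule sol_majorized) simp

lemma w_0 [simp]: "t \<in> {0..T} \<Longrightarrow> w 0 t = 0"
  by (rule sol_outside) auto

lemma w_init: "w k 0 = a k"
  using sol_0[of k "- {0}"] a_0 T by (cases "k = 0") auto

lemma w_summable: "t \<in> {0..T} \<Longrightarrow> (\<lambda>k. norm (w k t)) summable_on UNIV"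
  by (rule majorized_summable[OF w_majorized])

lemma Bu_summable: "Bu summable_on UNIV"
  unfolding Bu_def
  by (intro summable_on_add Msol_ball(1) has_sum_imp_summable[OF has_sum_finite_neutralI[where B="{0}"]]) auto

lemma Bu_nonneg: "0 \<le> Bu k"
  using Msol_ball(2)[of "- {0}" k] T by (simp add: Bu_def)

lemma uc_bound:
  assumes "t \<in> {0..T}"
  shows "norm (uc k t) \<le> Bu k"
proof -
  have "norm (if k = 0 then \<i> * of_real t + of_real m else (0::complex)) \<le> (if k = 0 then T + \<bar>m\<bar> else 0)"
    using norm_triangle_ineq[of "\<i> * of_real t" "of_real m"] assms by (auto simp: norm_mult)
  then show ?thesis
    unfolding uc_def Bu_def using majorized_bound[OF w_majorized assms, of k]
    by (intro order_trans[OF norm_triangle_ineq] add_mono)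
qed

lemma uc_summable: "t \<in> {0..T} \<Longrightarrow> (\<lambda>k. norm (uc k t)) summable_on UNIV"
  by (rule infsum_norm_mono(1)[OF uc_bound Bu_summable])

lemma continuous_on_uc: "continuous_on {0..T} (uc k)"
proof -
  have "continuous_on {0..T} (w k)" using w_majorized by (simp add: majorized_def)
  then show ?thesis unfolding uc_def by (cases "k = 0") (auto intro!: continuous_intros)
qed

lemma u_eq: "t \<in> {0..T} \<Longrightarrow> u t x = fs (\<lambda>k. w k t) x + (\<i> * of_real t + of_real m)"
  unfolding u_def uc_def by (rule fs_add_const) (rule w_summable)

text \<open>The mode \<open>0\<close> carries \<open>\<i> t + m\<close>; its products with the mode \<open>k\<close> in the convolution are what \<open>lam\<close>
  contains besides the viscous term.\<close>

lemma uc_ODE: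
  assumes t: "t \<in> {0..T}"
  shows "(uc k has_vector_derivative (if k = 0 then \<i> else 0)
      - fsym k / 2 * conv (\<lambda>j. uc j t) (\<lambda>j. uc j t) k + of_real \<epsilon> * (fsym k ^ 2 * uc k t)) (at t within {0..T})"
proof (cases "k = 0")
  case True
  have "((\<lambda>t. \<i> * complex_of_real t + of_real m) has_vector_derivative (\<i> * of_real 1 + 0)) (at t within {0..T})"
    by (intro has_vector_derivative_add bounded_linear.has_vector_derivative[OF bounded_linear_mult_right]
        has_vector_derivative_of_real has_vector_derivative_const) (auto intro!: derivative_eq_intros)
  then have "(uc 0 has_vector_derivative \<i>) (at t within {0..T})"
    by (subst has_vector_derivative_cong_ev[where g="\<lambda>t. \<i> * complex_of_real t + of_real m"])
       (use t in \<open>auto intro!: always_eventually simp: uc_def\<close>)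
  then show ?thesis using True by simp
next
  case False
  have "conv (\<lambda>j. uc j t) (\<lambda>j. uc j t) k = conv (\<lambda>j. w j t) (\<lambda>j. w j t) k + 2 * (\<i> * of_real t + of_real m) * w k t"
    unfolding uc_def by (rule conv_add_const[OF w_summable[OF t] False])
  then have "lam k t * w k t - fsym k / 2 * conv (\<lambda>j. w j t) (\<lambda>j. w j t) k
      = - fsym k / 2 * conv (\<lambda>j. uc j t) (\<lambda>j. uc j t) k + of_real \<epsilon> * (fsym k ^ 2 * uc k t)"
    using False by (simp add: lam_def uc_def algebra_simps power2_eq_square)
  moreover have "(w k has_vector_derivative
      lam k t * w k t - fsym k / 2 * conv (\<lambda>j. w j t) (\<lambda>j. w j t) k) (at t within {0..T})"
    by (rule sol_ODE[OF _ _ t]) (use False in auto)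
  moreover have "uc k = w k" using False by (auto simp: uc_def)
  ultimately show ?thesis using False by simp
qed

text \<open>The weight \<open>decay k\<close> makes the solution analytic for \<open>t > 0\<close>.\<close>

lemma w_smooth:
  assumes t: "0 < t" "t \<le> T"
  shows "(\<lambda>k. norm (fsym k ^ j * w k t)) summable_on UNIV"
proof (rule infsum_norm_mono(1))
  define C where "C = (2 / (\<delta> * t)) ^ j * fact j"
  show "norm (fsym k ^ j * w k t) \<le> C * Msol (- {0}) k" for k
  proof -
    define y where "y = pi * \<delta> * \<bar>real_of_int k\<bar> * t"
    have y: "0 \<le> y" using \<delta> t by (simp add: y_def)
    have "2 * pi * \<bar>real_of_int k\<bar> = 2 / (\<delta> * t) * y" using \<delta> t by (simp add: y_def)
    then have "norm (fsym k ^ j) = (2 / (\<delta> * t)) ^ j * y ^ j"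
      unfolding norm_power norm_fsym by (simp only: power_mult_distrib)
    also have "\<dots> \<le> (2 / (\<delta> * t)) ^ j * (fact j * exp y)"
      using \<delta> t by (intro mult_left_mono power_le_fact_exp y) auto
    finally have 1: "norm (fsym k ^ j) \<le> C * exp y" by (simp add: C_def)
    have 2: "norm (w k t) \<le> Msol (- {0}) k * exp (- y)"
      using w_majorized t unfolding majorized_def decay_def y_def by auto
    have "norm (fsym k ^ j * w k t) \<le> C * exp y * (Msol (- {0}) k * exp (- y))"
      unfolding norm_mult by (rule mult_mono[OF 1 2]) (use \<delta> t in \<open>auto simp: C_def\<close>)
    also have "\<dots> = C * Msol (- {0}) k" by (simp add: exp_minus field_simps)
    finally show ?thesis .
  qed
  show "(\<lambda>k. C * Msol (- {0}) k) summable_on UNIV"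
    by (intro summable_on_cmult_right Msol_ball) simp
qed

lemma uc_smooth:
  assumes t: "0 < t" "t \<le> T"
  shows "(\<lambda>k. norm (fsym k ^ j * uc k t)) summable_on UNIV"
proof -
  have "fsym k ^ j * uc k t = fsym k ^ j * w k t + (if k = 0 then fsym 0 ^ j * (\<i> * of_real t + of_real m) else 0)" for k
    by (simp add: uc_def distrib_left)
  then show ?thesis using fs_add_const(2)[OF w_smooth[OF t, of j]] by simp
qed

lemma w_energy:
  assumes "t \<in> {0..T}" "finite K"
  shows "(\<Sum>k\<in>K. sweight s k * (cmod (w k t))\<^sup>2) \<le> E\<^sup>2"
  by (rule sol_energy) (use assms small energy_0 in \<open>auto simp: A_def\<close>)

lemma u_sobolev:
  assumes t: "0 < t" "t \<le> T"
  shows "u t \<in> sobolev_H s" "sobolev_norm s (\<lambda>x. u t x - \<i> * of_real t - of_real m) \<le> E"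
    and "sobolev_norm s (u t) \<le> sqrt (E\<^sup>2 + sweight s 0 * (T + \<bar>m\<bar>)\<^sup>2)"
proof -
  have tt: "t \<in> {0..T}" using t by simp
  have ut: "u t = fs (\<lambda>k. uc k t)" by (rule ext) (simp add: u_def)
  show "u t \<in> sobolev_H s" unfolding ut by (rule sobolev_H_fs) (rule uc_smooth[OF t])
  have "(\<lambda>x. u t x - \<i> * of_real t - of_real m) = fs (\<lambda>k. w k t)"
    using u_eq[OF tt] by (auto simp: fun_eq_iff)
  then show "sobolev_norm s (\<lambda>x. u t x - \<i> * of_real t - of_real m) \<le> E"
    using sobolev_norm_fs_le[OF w_smooth[OF t] w_energy[OF tt] E] by simp
  show "sobolev_norm s (u t) \<le> sqrt (E\<^sup>2 + sweight s 0 * (T + \<bar>m\<bar>)\<^sup>2)"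
    unfolding ut
  proof (rule sobolev_norm_fs_le[OF uc_smooth[OF t]])
    fix K :: "int set" assume K: "finite K"
    have "sweight s k * (cmod (uc k t))\<^sup>2 \<le> sweight s k * (cmod (w k t))\<^sup>2
        + (if k = 0 then sweight s 0 * (T + \<bar>m\<bar>)\<^sup>2 else 0)" for k
    proof (cases "k = 0")
      case True
      have "cmod (uc 0 t) \<le> T + \<bar>m\<bar>"
        using norm_triangle_ineq[of "\<i> * of_real t" "of_real m"] tt by (auto simp: uc_def norm_mult)
      then have "(cmod (uc 0 t))\<^sup>2 \<le> (T + \<bar>m\<bar>)\<^sup>2" by (intro power_mono) auto
      then show ?thesis using True mult_left_mono[OF _ sweight_nonneg] tt by auto
    qed (simp add: uc_def)
    then have "(\<Sum>k\<in>K. sweight s k * (cmod (uc k t))\<^sup>2) \<le> (\<Sum>k\<in>K. sweight s k * (cmod (w k t))\<^sup>2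
        + (if k = 0 then sweight s 0 * (T + \<bar>m\<bar>)\<^sup>2 else 0))"
      by (rule sum_mono)
    also have "\<dots> \<le> E\<^sup>2 + sweight s 0 * (T + \<bar>m\<bar>)\<^sup>2"
      unfolding sum.distrib using w_energy[OF tt K] K sweight_nonneg[of s 0]
      by (intro add_mono) auto
    finally show "(\<Sum>k\<in>K. sweight s k * (cmod (uc k t))\<^sup>2) \<le> (sqrt (E\<^sup>2 + sweight s 0 * (T + \<bar>m\<bar>)\<^sup>2))\<^sup>2"
      using sweight_nonneg[of s 0] by simp
  qed (use sweight_nonneg[of s 0] in simp)
qed

lemma u_torus_L2: "t \<in> {0..T} \<Longrightarrow> torus_L2 (u t)"
  using torus_L2_fs[OF uc_summable] by (simp add: u_def[abs_def])

lemma u_Linf_sobolev: "u \<in> Linf_sobolev T s"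
  unfolding Linf_sobolev_def
proof (intro CollectI conjI exI)
  have "continuous_on ({0..T} \<times> UNIV) (\<lambda>z. \<Sum>\<^sub>\<infinity>k. uc k (fst z) * fe k (snd z))"
  proof (rule continuous_on_infsum[OF _ _ Bu_summable])
    show "continuous_on ({0..T} \<times> UNIV) (\<lambda>z. uc k (fst z) * fe k (snd z))" for k
      by (intro continuous_intros continuous_on_compose2[OF continuous_on_uc]
          continuous_on_compose2[OF continuous_on_fe[of UNIV]]) auto
  qed (auto simp: norm_mult uc_bound)
  then have c: "continuous_on ({0..T} \<times> UNIV) (\<lambda>(t, x). u t x)"
    by (simp add: u_def fs_def case_prod_unfold)
  show "set_borel_measurable borel ({0..T} \<times> UNIV) (\<lambda>(t, x). u t x)"
    unfolding set_borel_measurable_def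
    by (rule borel_measurable_continuous_on_indicator[OF _ c]) (intro borel_closed closed_Times; simp)
  show "AE t in lborel. t \<in> {0..T} \<longrightarrow> u t \<in> sobolev_H s
      \<and> sobolev_norm s (u t) \<le> sqrt (E\<^sup>2 + sweight s 0 * (T + \<bar>m\<bar>)\<^sup>2)"
    using AE_LI_gt0[of T] unfolding AE_LI by eventually_elim (use u_sobolev in auto)
qed

lemma u_L2_continuous: "L2_continuous_in_time T u"
  unfolding L2_continuous_in_time_def
proof (intro conjI ballI u_torus_L2)
  fix t assume t: "t \<in> {0..T}"
  have eq: "L2_norm_torus (\<lambda>x. u \<tau> x - u t x) = sqrt (\<Sum>\<^sub>\<infinity>k. (cmod (uc k \<tau> - uc k t))\<^sup>2)" if \<tau>: "\<tau> \<in> {0..T}" for \<tau>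
  proof -
    have "(\<lambda>k. norm (uc k \<tau> - uc k t)) summable_on UNIV"
      by (rule infsum_norm_mono(1)[OF _ summable_on_add[OF uc_summable[OF \<tau>] uc_summable[OF t]]])
         (rule norm_triangle_ineq4)
    from integral_norm_fs(1)[OF this] show ?thesis
      unfolding L2_norm_torus_LI u_def fs_diff[OF uc_summable[OF \<tau>] uc_summable[OF t], symmetric] by simp
  qed
  have "((\<lambda>\<tau>. \<Sum>\<^sub>\<infinity>k. (cmod (uc k \<tau> - uc k t))\<^sup>2) \<longlongrightarrow> (\<Sum>\<^sub>\<infinity>k::int. 0)) (at t within {0..T})"
  proof (rule tendsto_infsum_dominated)
    show "((\<lambda>\<tau>. (cmod (uc k \<tau> - uc k t))\<^sup>2) \<longlongrightarrow> 0) (at t within {0..T})" for k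
    proof -
      have "(uc k \<longlongrightarrow> uc k t) (at t within {0..T})" using continuous_on_uc t by (auto simp: continuous_on_def)
      then have "((\<lambda>\<tau>. (cmod (uc k \<tau> - uc k t))\<^sup>2) \<longlongrightarrow> (cmod (uc k t - uc k t))\<^sup>2) (at t within {0..T})"
        by (intro tendsto_intros)
      then show ?thesis by simp
    qed
    show "\<forall>\<^sub>F \<tau> in at t within {0..T}. \<forall>k. norm ((cmod (uc k \<tau> - uc k t))\<^sup>2) \<le> (2 * Bu k)\<^sup>2"
      unfolding eventually_at_filter
    proof (intro always_eventually allI impI)
      fix \<tau> k assume \<tau>: "\<tau> \<in> {0..T}"
      have "cmod (uc k \<tau> - uc k t) \<le> 2 * Bu k"
        using norm_triangle_ineq4[of "uc k \<tau>" "uc k t"] uc_bound[OF \<tau>, of k] uc_bound[OF t, of k] by simp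
      from power_mono[OF this norm_ge_zero, of 2]
      show "norm ((cmod (uc k \<tau> - uc k t))\<^sup>2) \<le> (2 * Bu k)\<^sup>2"
        by (simp only: real_norm_def abs_of_nonneg zero_le_power2)
    qed
    show "(\<lambda>k. (2 * Bu k)\<^sup>2) summable_on UNIV"
      by (rule square_summable) (auto intro!: summable_on_cmult_right Bu_summable Bu_nonneg)
  qed
  then have "((\<lambda>\<tau>. sqrt (\<Sum>\<^sub>\<infinity>k. (cmod (uc k \<tau> - uc k t))\<^sup>2)) \<longlongrightarrow> sqrt 0) (at t within {0..T})"
    by (intro tendsto_real_sqrt) simp
  then have "((\<lambda>\<tau>. sqrt (\<Sum>\<^sub>\<infinity>k. (cmod (uc k \<tau> - uc k t))\<^sup>2)) \<longlongrightarrow> 0) (at t within {0..T})" by simp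
  then show "((\<lambda>\<tau>. L2_norm_torus (\<lambda>x. u \<tau> x - u t x)) \<longlongrightarrow> 0) (at t within {0..T})"
    by (rule Lim_transform_eventually) (auto simp: eventually_at_filter eq)
qed

subsection \<open>The weak formulation\<close>

context
  fixes \<phi> :: "real \<Rightarrow> real \<Rightarrow> real"
  assumes \<phi>: "spacetime_test_function T \<phi>"
begin

lemma \<phi>_smooth: "smooth_plane \<phi>" and \<phi>_periodic: "periodic1 (\<phi> t)" and \<phi>_end: "\<phi> T x = 0"
  using \<phi> by (auto simp: spacetime_test_function_def)

lemma \<phi>_cont:
  "continuous_on UNIV (\<lambda>(t, x). \<phi> t x)" "continuous_on UNIV (\<lambda>(t, x). Dt \<phi> t x)"
  "continuous_on UNIV (\<lambda>(t, x). Dx \<phi> t x)" "continuous_on UNIV (\<lambda>(t, x). Dx (Dx \<phi>) t x)"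
  by (intro smooth_plane_D \<phi>_smooth)+

text \<open>The contribution of mode \<open>k\<close> to the spatial integral. All \<open>x\<close>-derivatives can be moved
  to \<open>\<phi>\<close>, so that it is summable in \<open>k\<close> uniformly in \<open>t\<close>, down to \<open>t = 0\<close>.\<close>

definition mode_integrand :: "int \<Rightarrow> real \<Rightarrow> complex"
  where "mode_integrand k t = - (uc k t * par_int (Dt \<phi>) k t) + fsym k / 2 * conv (\<lambda>j. uc j t) (\<lambda>j. uc j t) k * par_int \<phi> k t
    - of_real \<epsilon> * (uc k t * par_int (Dx (Dx \<phi>)) k t)"

lemma conv_uc_bound: "t \<in> {0..T} \<Longrightarrow> norm (conv (\<lambda>j. uc j t) (\<lambda>j. uc j t) k) \<le> conv Bu Bu k"
proof -
  assume t: "t \<in> {0..T}"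
  have n: "(\<lambda>k. norm (Bu k)) summable_on UNIV" using Bu_summable Bu_nonneg by simp
  show ?thesis
    unfolding conv_def
  proof (rule infsum_norm_mono(3))
    show "norm (uc (k - j) t * uc j t) \<le> Bu (k - j) * Bu j" for j
      unfolding norm_mult by (intro mult_mono uc_bound t Bu_nonneg) auto
    show "(\<lambda>j. Bu (k - j) * Bu j) summable_on UNIV"
      using conv_term_summable[OF n n, of k] Bu_nonneg by simp
  qed
qed

lemma continuous_on_conv_uc: "continuous_on {0..T} (\<lambda>t. conv (\<lambda>j. uc j t) (\<lambda>j. uc j t) k)"
  unfolding conv_def
proof (rule continuous_on_infsum)
  have n: "(\<lambda>k. norm (Bu k)) summable_on UNIV" using Bu_summable Bu_nonneg by simp
  show "norm (uc (k - j) t * uc j t) \<le> Bu (k - j) * Bu j" if "t \<in> {0..T}" for j t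
    unfolding norm_mult by (intro mult_mono uc_bound that Bu_nonneg) auto
  show "(\<lambda>j. Bu (k - j) * Bu j) summable_on UNIV"
    using conv_term_summable[OF n n, of k] Bu_nonneg by simp
qed (intro continuous_intros continuous_on_uc)

lemma continuous_on_mode_integrand: "continuous_on {0..T} (mode_integrand k)"
  unfolding mode_integrand_def
  by (intro continuous_intros continuous_on_uc continuous_on_conv_uc continuous_on_par_int \<phi>_cont)

lemma mode_integrand_bound:
  obtains C where "C summable_on UNIV" "\<And>k t. t \<in> {0..T} \<Longrightarrow> norm (mode_integrand k t) \<le> C k"
proof -
  obtain C1 where C1: "0 \<le> C1" "\<And>k t. t \<in> {0..T} \<Longrightarrow> norm (par_int (Dt \<phi>) k t) \<le> C1"
    using par_int_bound[OF \<phi>_cont(2)] by blast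
  obtain C2 where C2: "0 \<le> C2" "\<And>k t. t \<in> {0..T} \<Longrightarrow> norm (par_int (Dx \<phi>) k t) \<le> C2"
    using par_int_bound[OF \<phi>_cont(3)] by blast
  obtain C3 where C3: "0 \<le> C3" "\<And>k t. t \<in> {0..T} \<Longrightarrow> norm (par_int (Dx (Dx \<phi>)) k t) \<le> C3"
    using par_int_bound[OF \<phi>_cont(4)] by blast
  have n: "(\<lambda>k. norm (Bu k)) summable_on UNIV" using Bu_summable Bu_nonneg by simp
  have c0: "0 \<le> conv Bu Bu k" for k
    unfolding conv_def by (intro infsum_nonneg mult_nonneg_nonneg Bu_nonneg)
  show thesis
  proof
    show "(\<lambda>k. Bu k * C1 + conv Bu Bu k * C2 + \<epsilon> * (Bu k * C3)) summable_on UNIV"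
      using conv_abs_summable[OF n n] c0
      by (intro summable_on_add summable_on_cmult_left summable_on_cmult_right Bu_summable) simp
    fix k t assume t: "t \<in> {0..T}"
    have "norm (fsym k / 2 * conv (\<lambda>j. uc j t) (\<lambda>j. uc j t) k * par_int \<phi> k t)
        = norm (conv (\<lambda>j. uc j t) (\<lambda>j. uc j t) k) * norm (par_int (Dx \<phi>) k t) / 2"
      unfolding par_int_Dx(1)[OF \<phi>_smooth \<phi>_periodic] norm_mult norm_divide norm_minus_cancel by simp
    also have "\<dots> \<le> conv Bu Bu k * C2 / 2"
      by (intro divide_right_mono mult_mono conv_uc_bound t C2 c0) auto
    also have "\<dots> \<le> conv Bu Bu k * C2" using c0[of k] C2(1) by simp
    finally have 2: "norm (fsym k / 2 * conv (\<lambda>j. uc j t) (\<lambda>j. uc j t) k * par_int \<phi> k t) \<le> conv Bu Bu k * C2" .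
    have 1: "norm (- (uc k t * par_int (Dt \<phi>) k t)) \<le> Bu k * C1"
      unfolding norm_minus_cancel norm_mult by (intro mult_mono uc_bound t C1 Bu_nonneg) auto
    have 3: "norm (of_real \<epsilon> * (uc k t * par_int (Dx (Dx \<phi>)) k t)) \<le> \<epsilon> * (Bu k * C3)"
      unfolding norm_mult norm_of_real using eps
      by (intro mult_mono uc_bound t C3 Bu_nonneg) (auto intro!: mult_nonneg_nonneg)
    show "norm (mode_integrand k t) \<le> Bu k * C1 + conv Bu Bu k * C2 + \<epsilon> * (Bu k * C3)"
      unfolding mode_integrand_def by (rule order_trans[OF norm_triangle_ineq4 add_mono[OF order_trans[OF norm_triangle_ineq add_mono[OF 1 2]] 3]])
  qed
qed

text \<open>By the equation for \<open>uc k\<close>, the integrand is \<open>\<i>\<close> times the mean of \<open>\<phi>\<close> (for \<open>k = 0\<close>) minus the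
  time derivative of \<open>uc k * par_int \<phi> k\<close>.\<close>

lemma integral_mode_integrand: "integral\<^sup>L (LI T) (mode_integrand k) = uc k 0 * par_int \<phi> k 0 + (if k = 0 then \<i> * integral\<^sup>L (LI T) (par_int \<phi> 0) else 0)"
proof -
  define F where "F t = uc k t * par_int \<phi> k t" for t
  define F' where "F' t = uc k t * par_int (Dt \<phi>) k t + ((if k = 0 then \<i> else 0)
      - fsym k / 2 * conv (\<lambda>j. uc j t) (\<lambda>j. uc j t) k + of_real \<epsilon> * (fsym k ^ 2 * uc k t)) * par_int \<phi> k t" for t
  have "(F has_vector_derivative F' t) (at t within {0..T})" if "t \<in> {0..T}" for t
    unfolding F_def F'_def by (rule has_vector_derivative_mult[OF uc_ODE[OF that] par_int_deriv[OF \<phi>_smooth]])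
  then have "(F' has_integral (F T - F 0)) {0..T}"
    using T by (intro fundamental_theorem_of_calculus) auto
  moreover have "F T = 0" by (simp add: F_def par_int_def \<phi>_end)
  ultimately have "integral {0..T} F' = - F 0" by (simp add: integral_unique)
  moreover have cF': "continuous_on {0..T} F'"
    unfolding F'_def
    by (intro continuous_intros continuous_on_uc continuous_on_conv_uc continuous_on_par_int \<phi>_cont)
  ultimately have F': "integral\<^sup>L (LI T) F' = - F 0" by (simp add: integral_LI_HK)
  have cP: "continuous_on {0..T} (par_int \<phi> k)" for k by (intro continuous_on_par_int \<phi>_cont)
  have "mode_integrand k = (\<lambda>t. (if k = 0 then \<i> else 0) * par_int \<phi> k t - F' t)"
    by (rule ext) (simp add: mode_integrand_def F'_def par_int_Dx(2)[OF \<phi>_smooth \<phi>_periodic] algebra_simps)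
  then have "integral\<^sup>L (LI T) (mode_integrand k) = (if k = 0 then \<i> else 0) * integral\<^sup>L (LI T) (par_int \<phi> k) - integral\<^sup>L (LI T) F'"
    by (simp only: Bochner_Integration.integral_diff[OF integrable_mult_right[OF integrable_LI_continuous[OF cP]]
        integrable_LI_continuous[OF cF']] integral_mult_right_zero)
  then show ?thesis using F' by (simp add: F_def)
qed

lemma spatial_integral:
  assumes t: "0 < t" "t \<le> T"
  shows "(\<integral>x. weak_integrand \<epsilon> u \<phi> t x \<partial>LI 1) = (\<Sum>\<^sub>\<infinity>k. mode_integrand k t)"
proof -
  have tt: "t \<in> {0..T}" using t by simp
  define c where "c k = uc k t" for k
  have ut: "u t = fs c" by (rule ext) (simp add: u_def c_def[abs_def])
  have cs: "(\<lambda>k. norm (c k)) summable_on UNIV" using uc_summable[OF tt] by (simp add: c_def)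
  have ds: "(\<lambda>k. norm (fsym k * c k)) summable_on UNIV" using uc_smooth[OF t, of 1] by (simp add: c_def)
  define d where "d = conv (\<lambda>k. fsym k * c k) c"
  have dsum: "(\<lambda>k. norm (d k)) summable_on UNIV" unfolding d_def by (rule conv_abs_summable[OF ds cs])
  have d_eq: "d k = fsym k / 2 * conv c c k" for k
  proof -
    have e: "c j * (fsym (k - j) * c (k - j)) = fsym (k - j) * c (k - j) * c j" for j
      by (rule mult.commute)
    have "(\<lambda>j. norm (c j * (fsym (k - j) * c (k - j)))) summable_on UNIV"
      unfolding e by (rule conv_term_summable[OF ds cs])
    from conv_deriv_symmetrize[OF cs this] show ?thesis
      unfolding e d_def conv_def[of "\<lambda>k. fsym k * c k"] .
  qed
  have prod: "AE x in LI 1. u t x * weak_deriv 1 (u t) x = fs d x"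
  proof -
    have "AE x in lborel. weak_deriv 1 (fs c) x = fs (\<lambda>k. fsym k ^ 1 * c k) x"
      by (rule weak_deriv_fs_AE[where s=1]) (use uc_smooth[OF t] in \<open>auto simp: c_def\<close>)
    then show ?thesis
      unfolding AE_LI ut by eventually_elim (simp add: d_def fs_mult[OF ds cs, symmetric])
  qed
  have i: "integrable (LI 1) (\<lambda>x. complex_of_real (\<psi> t x))" if "continuous_on UNIV (\<lambda>(t, x). \<psi> t x)" for \<psi>
    by (intro integrable_LI_continuous continuous_intros continuous_slices[OF that])
  note i1 = i[OF \<phi>_cont(2)] and i2 = i[OF \<phi>_cont(1)] and i3 = i[OF \<phi>_cont(4)]
  note S1 = integral_fs_mult[OF cs i1, folded par_int_def]
    and S2 = integral_fs_mult[OF dsum i2, folded par_int_def]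
    and S3 = integral_fs_mult[OF cs i3, folded par_int_def]
  have "(\<integral>x. weak_integrand \<epsilon> u \<phi> t x \<partial>LI 1)
      = (\<integral>x. - (fs c x * complex_of_real (Dt \<phi> t x)) + fs d x * complex_of_real (\<phi> t x)
      - complex_of_real \<epsilon> * (fs c x * complex_of_real (Dx (Dx \<phi>) t x)) \<partial>LI 1)"
  proof (rule integral_cong_AE)
    have m: "(\<lambda>x. complex_of_real (\<psi> t x)) \<in> borel_measurable (LI 1)" if "continuous_on UNIV (\<lambda>(t, x). \<psi> t x)" for \<psi>
      using i[OF that] by auto
    have um: "u t \<in> borel_measurable (LI 1)" "weak_deriv 1 (u t) \<in> borel_measurable (LI 1)"
      using u_torus_L2[OF tt] sobolev_H_D(4)[OF u_sobolev(1)[OF t], of 1] s torus_L2_D(2) by auto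
    show "(\<lambda>x. weak_integrand \<epsilon> u \<phi> t x) \<in> borel_measurable (LI 1)"
      by (intro borel_measurable_diff borel_measurable_add borel_measurable_times borel_measurable_uminus
          borel_measurable_const um m \<phi>_cont)
    show "(\<lambda>x. - (fs c x * complex_of_real (Dt \<phi> t x)) + fs d x * complex_of_real (\<phi> t x)
      - complex_of_real \<epsilon> * (fs c x * complex_of_real (Dx (Dx \<phi>) t x))) \<in> borel_measurable (LI 1)"
      by (intro borel_measurable_integrable Bochner_Integration.integrable_diff Bochner_Integration.integrable_add
          Bochner_Integration.integrable_minus integrable_mult_right S1 S2 S3)
    show "AE x in LI 1. weak_integrand \<epsilon> u \<phi> t x
      = - (fs c x * complex_of_real (Dt \<phi> t x)) + fs d x * complex_of_real (\<phi> t x)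
      - complex_of_real \<epsilon> * (fs c x * complex_of_real (Dx (Dx \<phi>) t x))"
      using prod by eventually_elim (simp add: ut mult.assoc)
  qed
  also have "\<dots> = - (\<Sum>\<^sub>\<infinity>k. c k * par_int (Dt \<phi>) k t) + (\<Sum>\<^sub>\<infinity>k. d k * par_int \<phi> k t)
      - complex_of_real \<epsilon> * (\<Sum>\<^sub>\<infinity>k. c k * par_int (Dx (Dx \<phi>)) k t)"
    using S1(1,2) S2(1,2) S3(1,2) by simp
  also have "\<dots> = (\<Sum>\<^sub>\<infinity>k. - (c k * par_int (Dt \<phi>) k t) + d k * par_int \<phi> k t
      - complex_of_real \<epsilon> * (c k * par_int (Dx (Dx \<phi>)) k t))"
  proof -
    note h1 = has_sum_infsum[OF abs_summable_summable[OF S1(3)]]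
      and h2 = has_sum_infsum[OF abs_summable_summable[OF S2(3)]]
      and h3 = has_sum_infsum[OF abs_summable_summable[OF S3(3)]]
    show ?thesis
      by (rule infsumI[symmetric],
          rule has_sum_diff[OF has_sum_add[OF has_sum_uminusI[OF h1] h2] has_sum_cmult_right[OF h3]])
  qed
  also have "\<dots> = (\<Sum>\<^sub>\<infinity>k. mode_integrand k t)"
    by (simp add: mode_integrand_def d_eq) (simp add: c_def[abs_def])
  finally show ?thesis .
qed

lemma weak_form:
  "- (\<integral>x. u 0 x * complex_of_real (\<phi> 0 x) \<partial>LI 1)
   + (\<integral>t. \<integral>x. weak_integrand \<epsilon> u \<phi> t x \<partial>LI 1 \<partial>LI T)
   = (\<integral>t. \<integral>x. \<i> * complex_of_real (\<phi> t x) \<partial>LI 1 \<partial>LI T)" (is "_ + (\<integral>t. ?I t \<partial>LI T) = _")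
proof -
  have T0: "(0::real) \<in> {0..T}" using T by simp
  obtain C where C: "C summable_on UNIV" "\<And>k t. t \<in> {0..T} \<Longrightarrow> norm (mode_integrand k t) \<le> C k"
    using mode_integrand_bound by blast
  note JI = integral_infsum[of mode_integrand "LI T" C "\<lambda>_. 1", OF measurable_LI_continuous[OF continuous_on_mode_integrand] _ C(1)]
  have JI1: "(\<integral>t. (\<Sum>\<^sub>\<infinity>k. mode_integrand k t) \<partial>LI T) = (\<Sum>\<^sub>\<infinity>k. integral\<^sup>L (LI T) (mode_integrand k))"
    and JI2: "integrable (LI T) (\<lambda>t. \<Sum>\<^sub>\<infinity>k. mode_integrand k t)"
    using JI(1,2) C(2) by auto
  have cP: "continuous_on {0..T} (par_int \<phi> 0)" by (intro continuous_on_par_int \<phi>_cont)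
  have "(\<integral>t. ?I t \<partial>LI T) = (\<integral>t. (\<Sum>\<^sub>\<infinity>k. mode_integrand k t) \<partial>LI T)"
  proof (rule integral_cong_AE)
    show "AE t in LI T. ?I t = (\<Sum>\<^sub>\<infinity>k. mode_integrand k t)"
      using AE_LI_gt0[of T] AE_space by eventually_elim (rule spatial_integral, auto)
    \<comment> \<open>The integrands agree except possibly at the single time \<open>0\<close>.\<close>
    have "(\<lambda>t. if t = 0 then ?I 0 else (\<Sum>\<^sub>\<infinity>k. mode_integrand k t)) \<in> borel_measurable (LI T)"
    proof (rule measurable_If)
      have "{0} \<inter> {0..T} \<in> sets (LI T)" unfolding LI_def by (simp add: sets_restrict_space_iff)
      moreover have "{t \<in> space (LI T). t = 0} = {0} \<inter> {0..T}" by auto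
      ultimately show "{t \<in> space (LI T). t = 0} \<in> sets (LI T)" by simp
    qed (use JI2 in auto)
    then show "?I \<in> borel_measurable (LI T)"
      by (rule measurable_cong[THEN iffD2, rotated]) (use spatial_integral in auto)
    show "(\<lambda>t. \<Sum>\<^sub>\<infinity>k. mode_integrand k t) \<in> borel_measurable (LI T)" using JI2 by simp
  qed
  also have "\<dots> = (\<Sum>\<^sub>\<infinity>k. uc k 0 * par_int \<phi> k 0 + (if k = 0 then \<i> * integral\<^sup>L (LI T) (par_int \<phi> 0) else 0))"
    unfolding JI1 by (rule infsum_cong) (rule integral_mode_integrand)
  also have "\<dots> = (\<integral>x. u 0 x * complex_of_real (\<phi> 0 x) \<partial>LI 1) + \<i> * integral\<^sup>L (LI T) (par_int \<phi> 0)"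
  proof -
    have c: "continuous_on {0..1} (\<lambda>x. complex_of_real (\<phi> 0 x))"
      by (rule continuous_on_of_real) (rule continuous_slices(1)[OF \<phi>_cont(1)])
    have i: "integrable (LI 1) (\<lambda>x. complex_of_real (\<phi> 0 x))"
      by (rule integrable_LI_continuous[OF c])
    have F1: "(\<integral>x. u 0 x * complex_of_real (\<phi> 0 x) \<partial>LI 1) = (\<Sum>\<^sub>\<infinity>k. uc k 0 * par_int \<phi> k 0)"
      unfolding u_def par_int_def by (rule integral_fs_mult(1)[OF uc_summable[OF T0] i])
    have F3: "(\<lambda>k. norm (uc k 0 * par_int \<phi> k 0)) summable_on UNIV"
      unfolding par_int_def by (rule integral_fs_mult(3)[OF uc_summable[OF T0] i])
    have h1: "((\<lambda>k. uc k 0 * par_int \<phi> k 0) has_sum (\<integral>x. u 0 x * complex_of_real (\<phi> 0 x) \<partial>LI 1)) UNIV"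
      unfolding F1 by (rule has_sum_infsum[OF abs_summable_summable[OF F3]])
    have h2: "((\<lambda>k::int. if k = 0 then \<i> * integral\<^sup>L (LI T) (par_int \<phi> 0) else 0) has_sum \<i> * integral\<^sup>L (LI T) (par_int \<phi> 0)) UNIV"
      by (rule has_sum_finite_neutralI[where B="{0}"]) auto
    show ?thesis by (rule infsumI[OF has_sum_add[OF h1 h2]])
  qed
  also have "\<i> * integral\<^sup>L (LI T) (par_int \<phi> 0) = (\<integral>t. \<integral>x. \<i> * complex_of_real (\<phi> t x) \<partial>LI 1 \<partial>LI T)"
    by (simp add: par_int_def[abs_def])
  finally show ?thesis by simp
qed

end

end

section \<open>Uniqueness of weak solutions\<close>

subsection \<open>A family of flat cut-offs\<close>

text \<open>A family of functions that are flat at \<open>0\<close> and closed under differentiation.\<close>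

definition bump :: "real poly \<Rightarrow> real \<Rightarrow> real"
  where "bump p s = (if s > 0 then poly p (1 / s) * exp (- (1 / s)) else 0)"

lemma poly_exp_tendsto_0: "((\<lambda>y. poly p y * exp (- y)) \<longlongrightarrow> 0) at_top" for p :: "real poly"
proof -
  have "((\<lambda>y. \<Sum>i\<le>degree p. coeff p i * (y ^ i / exp y)) \<longlongrightarrow> (\<Sum>i\<le>degree p. coeff p i * 0)) at_top"
    by (intro tendsto_intros tendsto_power_div_exp_0)
  then show ?thesis
    by (simp add: poly_altdef sum_distrib_right exp_minus divide_inverse mult.assoc)
qed

lemma bump_tendsto_0: "((\<lambda>h. bump p h) \<longlongrightarrow> 0) (at 0)"
proof (rule filterlim_split_at)
  have "((\<lambda>h. poly p (inverse h) * exp (- inverse h)) \<longlongrightarrow> 0) (at_right 0)"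
    using filterlim_compose[OF poly_exp_tendsto_0 filterlim_inverse_at_top_right] .
  then show "(bump p \<longlongrightarrow> 0) (at_right 0)"
    by (rule Lim_transform_eventually) (auto simp: eventually_at_filter bump_def divide_inverse)
  show "(bump p \<longlongrightarrow> 0) (at_left 0)"
    by (rule tendsto_eventually) (auto simp: eventually_at_filter bump_def)
qed

definition bump_next :: "real poly \<Rightarrow> real poly"
  where "bump_next p = [:0, 0, 1:] * (p - pderiv p)"

lemma DERIV_bump: "(bump p has_real_derivative bump (bump_next p) s) (at s)"
proof -
  consider "s > 0" | "s = 0" | "s < 0" by linarith
  then show ?thesis
  proof cases
    case 1
    have "((\<lambda>s. poly p (1 / s) * exp (- (1 / s))) has_real_derivative bump (bump_next p) s) (at s)"
      using 1 by (auto intro!: derivative_eq_intros poly_DERIV[THEN DERIV_chain2]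
          simp: bump_def bump_next_def power2_eq_square field_simps)
    then show ?thesis
    proof (rule DERIV_cong_ev[THEN iffD1, rotated -1])
      show "\<forall>\<^sub>F x in nhds s. poly p (1 / x) * exp (- (1 / x)) = bump p x"
        using eventually_nhds_in_open[of "{0<..}" s] 1 by (auto simp: bump_def elim!: eventually_mono)
    qed auto
  next
    case 2
    have "((\<lambda>h. bump (pCons 0 p) h) \<longlongrightarrow> 0) (at 0)" by (rule bump_tendsto_0)
    moreover have "bump (pCons 0 p) = (\<lambda>h. (bump p (0 + h) - bump p 0) / h)"
      by (rule ext) (simp add: bump_def)
    ultimately show ?thesis using 2 by (simp add: DERIV_def bump_def)
  next
    case 3
    have "((\<lambda>s. 0) has_real_derivative bump (bump_next p) s) (at s)"
      using 3 by (simp add: bump_def)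
    then show ?thesis
    proof (rule DERIV_cong_ev[THEN iffD1, rotated -1])
      show "\<forall>\<^sub>F x in nhds s. 0 = bump p x"
        using eventually_nhds_in_open[of "{..<0}" s] 3 by (auto simp: bump_def elim!: eventually_mono)
    qed auto
  qed
qed

lemma DERIV_id_bump: "((\<lambda>s. s * bump 1 s) has_real_derivative bump [:1, 1:] s) (at s)"
proof (cases "s = 0")
  case False
  have "((\<lambda>s. s * bump 1 s) has_real_derivative 1 * bump 1 s + bump (bump_next 1) s * s) (at s)"
    by (rule DERIV_mult[OF DERIV_ident DERIV_bump])
  moreover have "1 * bump 1 s + bump (bump_next 1) s * s = bump [:1, 1:] s"
    using False by (simp add: bump_def bump_next_def field_simps)
  ultimately show ?thesis by simp
next
  case True
  have "(\<lambda>h. bump 1 h) \<midarrow>0\<rightarrow> 0" by (rule bump_tendsto_0)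
  then have "((\<lambda>h. ((0 + h) * bump 1 (0 + h) - 0 * bump 1 0) / h) \<longlongrightarrow> 0) (at 0)"
    by (rule Lim_transform_eventually) (auto simp: eventually_at_filter)
  moreover have "bump [:1, 1:] 0 = 0" by (simp add: bump_def)
  ultimately show ?thesis unfolding DERIV_def True by (simp only:)
qed

text \<open>For \<open>t < b\<close> the derivative of \<open>cutoff N b 0\<close> at \<open>t\<close> is \<open>(1 + y) exp (- y)\<close> with \<open>y = 1 / (N (b - t))\<close>.
  It lies between \<open>0\<close> and \<open>1\<close> and tends to \<open>1\<close> as \<open>N\<close> grows: these derivatives approximate the
  indicator of \<open>{..<b}\<close>. The further indices list the higher derivatives.\<close>

definition cutoff :: "real \<Rightarrow> real \<Rightarrow> nat \<Rightarrow> real \<Rightarrow> real"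
  where "cutoff N b j t = (case j of 0 \<Rightarrow> - (1 / N) * ((N * (b - t)) * bump 1 (N * (b - t)))
    | Suc i \<Rightarrow> (- N) ^ i * bump ((bump_next ^^ i) [:1, 1:]) (N * (b - t)))"

lemma DERIV_cutoff:
  assumes "N > 0"
  shows "(cutoff N b j has_real_derivative cutoff N b (Suc j) t) (at t)"
proof -
  have inner: "((\<lambda>t. N * (b - t)) has_real_derivative - N) (at t)"
    by (auto intro!: derivative_eq_intros)
  show ?thesis
  proof (cases j)
    case 0
    have "((\<lambda>t. - (1 / N) * ((N * (b - t)) * bump 1 (N * (b - t)))) has_real_derivative
        - (1 / N) * (bump [:1, 1:] (N * (b - t)) * - N)) (at t)"
      by (rule DERIV_cmult[OF DERIV_chain2[OF DERIV_id_bump inner]])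
    then show ?thesis using 0 assms by (simp add: cutoff_def[abs_def])
  next
    case (Suc i)
    have "((\<lambda>t. (- N) ^ i * bump ((bump_next ^^ i) [:1, 1:]) (N * (b - t))) has_real_derivative
        (- N) ^ i * (bump (bump_next ((bump_next ^^ i) [:1, 1:])) (N * (b - t)) * - N)) (at t)"
      by (rule DERIV_cmult[OF DERIV_chain2[OF DERIV_bump inner]])
    then show ?thesis using Suc by (simp add: cutoff_def[abs_def] mult_ac)
  qed
qed

lemma cutoff_after: "N > 0 \<Longrightarrow> b \<le> t \<Longrightarrow> cutoff N b 0 t = 0"
  by (simp add: cutoff_def bump_def zero_less_mult_iff)

lemma continuous_on_cutoff: "N > 0 \<Longrightarrow> continuous_on S (cutoff N b j)"
  by (meson DERIV_continuous DERIV_cutoff continuous_at_imp_continuous_on)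

lemma cutoff_deriv_bound:
  assumes "N > 0"
  shows "\<bar>cutoff N b 1 t\<bar> \<le> 1"
proof -
  have "0 \<le> (1 + y) * exp (- y)" "(1 + y) * exp (- y) \<le> 1" if "0 < y" for y :: real
    using that exp_ge_add_one_self[of y] by (simp_all add: exp_minus divide_simps)
  from this[of "1 / (N * (b - t))"] show ?thesis
    by (simp add: cutoff_def bump_def)
qed

lemma cutoff_deriv_tendsto: "(\<lambda>n. cutoff (real (Suc n)) b 1 t) \<longlonglongrightarrow> of_bool (t < b)"
proof (cases "t < b")
  case True
  have "(\<lambda>n. (1 + 1 / real (Suc n) * (1 / (b - t))) * exp (- (1 / real (Suc n) * (1 / (b - t))))) \<longlonglongrightarrow>
      (1 + 0 * (1 / (b - t))) * exp (- (0 * (1 / (b - t))))"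
    by (intro tendsto_intros LIMSEQ_Suc[OF lim_1_over_n])
  moreover have "cutoff (real (Suc n)) b 1 t = (1 + 1 / real (Suc n) * (1 / (b - t))) * exp (- (1 / real (Suc n) * (1 / (b - t))))" for n
    using True by (simp add: cutoff_def bump_def)
  ultimately show ?thesis using True by simp
next
  case False
  then have "cutoff (real (Suc n)) b 1 t = 0" for n
    by (simp add: cutoff_def bump_def zero_less_mult_iff)
  then show ?thesis using False by simp
qed

lemma smooth_plane_product:
  assumes F: "\<And>i t. (F i has_real_derivative F (Suc i) t) (at t)"
    and G: "\<And>j x. (G j has_real_derivative G (Suc j) x) (at x)"
  shows "smooth_plane (\<lambda>t x. F i t * G j x)"
proof -
  have cF: "continuous_on UNIV (F i)" and cG: "continuous_on UNIV (G i)" for i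
    using F G by (meson DERIV_continuous continuous_at_imp_continuous_on)+
  show ?thesis
  proof (coinduction arbitrary: i j rule: smooth_plane.coinduct)
    case (smooth_plane i j)
    have 1: "Dt (\<lambda>t x. F i t * G j x) = (\<lambda>t x. F (Suc i) t * G j x)"
      unfolding Dt_def by (intro ext DERIV_imp_deriv DERIV_cmult_right F)
    have 2: "Dx (\<lambda>t x. F i t * G j x) = (\<lambda>t x. F i t * G (Suc j) x)"
      unfolding Dx_def by (intro ext DERIV_imp_deriv DERIV_cmult G)
    have "continuous_on UNIV (\<lambda>z. F i (fst z) * G j (snd z))"
      by (intro continuous_intros continuous_on_compose2[OF cF] continuous_on_compose2[OF cG]) auto
    then have "continuous_on UNIV (\<lambda>(t, x). F i t * G j x)" by (simp add: case_prod_unfold)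
    moreover have "(\<lambda>\<tau>. F i \<tau> * G j x) differentiable (at t)" "(\<lambda>y. F i t * G j y) differentiable (at x)" for t x
      using DERIV_cmult_right[OF F] DERIV_cmult[OF G] real_differentiable_def by blast+
    ultimately show ?case
      by (intro exI[of _ "\<lambda>t x. F i t * G j x"] conjI allI disjI1 refl; (unfold 1 2)?; blast?)
  qed
qed

subsection \<open>The equation for the Fourier coefficients\<close>

lemma measurable_param_integral:
  fixes G :: "real \<times> real \<Rightarrow> 'a::{banach,second_countable_topology}"
  assumes G: "G \<in> borel_measurable borel"
  shows "(\<lambda>t. \<integral>x. G (t, x) \<partial>LI 1) \<in> borel_measurable borel"
proof (rule LI.borel_measurable_lebesgue_integral)
  have "(\<lambda>z :: real \<times> real. (fst z, snd z)) \<in> borel \<Otimes>\<^sub>M LI 1 \<rightarrow>\<^sub>M borel \<Otimes>\<^sub>M borel"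
    by (intro measurable_Pair measurable_fst measurable_compose[OF measurable_snd] measurable_LI) simp
  then have "(\<lambda>z :: real \<times> real. z) \<in> borel \<Otimes>\<^sub>M LI 1 \<rightarrow>\<^sub>M borel"
    unfolding borel_prod prod.collapse .
  from measurable_compose[OF this G] show "(\<lambda>(t, x). G (t, x)) \<in> borel_measurable (borel \<Otimes>\<^sub>M LI 1)"
    by (simp add: case_prod_unfold)
qed

lemma sobolev_AE_bound:
  assumes v: "v \<in> sobolev_H s" "sobolev_norm s v \<le> M" and s: "s \<ge> 1"
  shows "AE x in LI 1. norm (v x) \<le> 2 * M"
proof -
  note sm = sobolev_fc_summable(1,2)[OF v(1) s]
  have b: "norm (fs (fc v) x) \<le> 2 * M" for x
    using norm_fs_le[OF sm(1), of x] sm(2) v(2) by linarith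
  show ?thesis
    unfolding AE_LI using AE_eq_fs[OF sobolev_H_D(1)[OF v(1)] sm(1)] by eventually_elim (simp add: b)
qed

text \<open>The mean of the datum is real; \<open>tested_equation\<close> below depends on it.\<close>

locale weak_solution =
  fixes s :: nat and \<epsilon> T :: real and a :: "real \<Rightarrow> complex" and v :: "real \<Rightarrow> real \<Rightarrow> complex" and M :: real
  assumes s: "s \<ge> 1" and eps: "0 < \<epsilon>" and T: "0 < T" and a: "integrable (LI 1) a" and a_real: "Im (fc a 0) = 0"
    and solution: "burgers_solution s \<epsilon> T a v" and M: "0 \<le> M"
    and bounded: "AE t in LI T. v t \<in> sobolev_H s \<and> sobolev_norm s (v t) \<le> M"
begin

definition V :: "real \<times> real \<Rightarrow> complex"
  where "V z = indicator ({0..T} \<times> UNIV) z *\<^sub>R v (fst z) (snd z)"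

lemma V_measurable [measurable]: "V \<in> borel_measurable borel"
  using solution by (simp add: burgers_solution_def Linf_sobolev_def set_borel_measurable_def V_def[abs_def] case_prod_unfold)

lemma V_eq: "t \<in> {0..T} \<Longrightarrow> V (t, x) = v t x"
  by (simp add: V_def)

definition vc :: "int \<Rightarrow> real \<Rightarrow> complex"
  where "vc k t = fc (v t) k"

definition gc :: "int \<Rightarrow> real \<Rightarrow> complex"
  where "gc k t = fc (\<lambda>x. (v t x)\<^sup>2) k"

lemma measurable_slice_integral:
  fixes h :: "complex \<Rightarrow> real \<Rightarrow> complex"
  assumes "(\<lambda>z. h (V z) (snd z)) \<in> borel_measurable borel"
  shows "(\<lambda>t. \<integral>x. h (v t x) x \<partial>LI 1) \<in> borel_measurable (LI T)"
proof (rule measurable_cong[THEN iffD1])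
  show "(\<lambda>t. \<integral>x. h (V (t, x)) x \<partial>LI 1) \<in> borel_measurable (LI T)"
    using measurable_LI[OF measurable_param_integral[OF assms]] by simp
qed (simp add: V_eq)

lemma measurable_fe_snd: "(\<lambda>z. fe k (snd z)) \<in> borel_measurable (borel :: (real \<times> real) measure)"
  by (intro borel_measurable_continuous_onI continuous_on_compose2[OF continuous_on_fe[of UNIV]] continuous_intros) auto

lemma vc_measurable: "vc k \<in> borel_measurable (LI T)"
  unfolding vc_def fc_def
  by (rule measurable_slice_integral[where h="\<lambda>y x. y * fe (- k) x"])
     (intro borel_measurable_times V_measurable measurable_fe_snd)

lemma gc_measurable: "gc k \<in> borel_measurable (LI T)"
  unfolding gc_def fc_def
  by (rule measurable_slice_integral[where h="\<lambda>y x. y\<^sup>2 * fe (- k) x"])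
     (intro borel_measurable_times borel_measurable_power V_measurable measurable_fe_snd)

lemma slice_bound:
  assumes "v t \<in> sobolev_H s" "sobolev_norm s (v t) \<le> M"
  shows "AE x in LI 1. norm (v t x) \<le> 2 * M"
  using assms s by (intro sobolev_AE_bound)

lemma vc_bound: "AE t in LI T. norm (vc k t) \<le> 2 * M"
  using bounded
proof eventually_elim
  case (elim t)
  have "norm (vc k t) \<le> (2 * M) * 1"
    unfolding vc_def fc_def
    by (rule norm_integral_LI_le) (use slice_bound[of t] elim M in \<open>auto simp: norm_mult\<close>)
  then show ?case by simp
qed

lemma gc_bound: "AE t in LI T. norm (gc k t) \<le> (2 * M)\<^sup>2"
  using bounded
proof eventually_elim
  case (elim t)
  have "AE x in LI 1. norm (v t x) \<le> 2 * M"
    using slice_bound[of t] elim by blast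
  then have "AE x in LI 1. norm ((v t x)\<^sup>2 * fe (- k) x) \<le> (2 * M)\<^sup>2"
    by eventually_elim (simp only: norm_mult norm_power norm_fe mult_1_right power_mono norm_ge_zero)
  then have "norm (gc k t) \<le> (2 * M)\<^sup>2 * 1"
    unfolding gc_def fc_def by (rule norm_integral_LI_le) auto
  then show ?case by simp
qed

definition rate :: "int \<Rightarrow> real \<Rightarrow> complex"
  where "rate k t = (if k = 0 then \<i> else 0) - fsym k / 2 * gc k t + of_real \<epsilon> * (fsym k ^ 2 * vc k t)"

lemma integrable_vc: "integrable (LI T) (vc k)" and integrable_gc: "integrable (LI T) (gc k)"
  by (rule LI.integrable_const_bound[OF vc_bound vc_measurable])
     (rule LI.integrable_const_bound[OF gc_bound gc_measurable])

lemma integrable_rate: "integrable (LI T) (rate k)"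
  unfolding rate_def
  by (intro Bochner_Integration.integrable_add Bochner_Integration.integrable_diff integrable_mult_right
      integrable_vc integrable_gc) simp

lemma integrable_mult_cutoff:
  assumes N: "N > 0" and g: "integrable (LI T) g"
  shows "integrable (LI T) (\<lambda>t. complex_of_real (cutoff N b j t) * g t)"
proof -
  have c: "continuous_on {0..T} (\<lambda>t. complex_of_real (cutoff N b j t))"
    by (intro continuous_intros continuous_on_cutoff N)
  have "bounded ((\<lambda>t. complex_of_real (cutoff N b j t)) ` {0..T})"
    by (rule compact_imp_bounded[OF compact_continuous_image[OF c compact_Icc]])
  then obtain B where "\<forall>t\<in>{0..T}. norm (complex_of_real (cutoff N b j t)) \<le> B"
    unfolding bounded_iff by blast
  then have "integrable (LI T) (\<lambda>t. g t * complex_of_real (cutoff N b j t))"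
    by (intro integrable_mult_bounded[OF g measurable_LI_continuous[OF c], of B]) auto
  then show ?thesis by (simp add: mult.commute)
qed

lemma integral_mult_Re_fe:
  assumes g: "integrable (LI 1) g"
  shows "(\<integral>x. g x * complex_of_real (Re (z * fe (- k) x)) \<partial>LI 1) = (z * fc g k + cnj z * fc g (- k)) / 2"
proof -
  have e: "complex_of_real (Re (z * fe (- k) x)) = (z * fe (- k) x + cnj z * fe k x) / 2" for x
    by (simp add: complex_eq_iff fe_minus)
  have "(\<integral>x. g x * complex_of_real (Re (z * fe (- k) x)) \<partial>LI 1)
      = (\<integral>x. z / 2 * (g x * fe (- k) x) + cnj z / 2 * (g x * fe k x) \<partial>LI 1)"
    unfolding e by (rule Bochner_Integration.integral_cong) (simp_all add: field_simps)
  also have "\<dots> = z / 2 * (\<integral>x. g x * fe (- k) x \<partial>LI 1) + cnj z / 2 * (\<integral>x. g x * fe k x \<partial>LI 1)"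
    by (simp only: Bochner_Integration.integral_add[OF integrable_mult_right[OF integrable_mult_fe[OF g]]
          integrable_mult_right[OF integrable_mult_fe[OF g]]] integral_mult_right_zero)
  finally show ?thesis by (simp add: fc_def field_simps)
qed

definition tested_mode :: "real \<Rightarrow> real \<Rightarrow> int \<Rightarrow> real \<Rightarrow> complex"
  where "tested_mode N b k t = - (of_real (cutoff N b 1 t) * vc k t) + of_real (cutoff N b 0 t) * (fsym k / 2 * gc k t)
    - of_real (cutoff N b 0 t) * (of_real \<epsilon> * (fsym k ^ 2 * vc k t))"

text \<open>The values \<open>z = 1\<close> and \<open>z = - \<i>\<close> separate the modes \<open>k\<close> and \<open>- k\<close>; the constant \<open>c\<close> adds a
  multiple of the mode \<open>0\<close>. \<open>comb k z c\<close> is what such a test function extracts from a sequence of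
  Fourier coefficients.\<close>

definition tester :: "real \<Rightarrow> real \<Rightarrow> int \<Rightarrow> complex \<Rightarrow> real \<Rightarrow> real \<Rightarrow> real \<Rightarrow> real"
  where "tester N b k z c t x = cutoff N b 0 t * (Re (z * fe (- k) x) + c)"

lemma tester_derivs:
  assumes N: "N > 0"
  shows "smooth_plane (tester N b k z c)"
    and "Dt (tester N b k z c) t x = cutoff N b 1 t * (Re (z * fe (- k) x) + c)"
    and "Dx (Dx (tester N b k z c)) t x = cutoff N b 0 t * (- (2 * pi * k)\<^sup>2 * Re (z * fe (- k) x))"
proof -
  define G where "G j x = Re (z * fsym (- k) ^ j * fe (- k) x) + (if j = 0 then c else 0)" for j x
  have G: "(G j has_real_derivative G (Suc j) x) (at x)" for j x
  proof -
    have "((\<lambda>x. Re (z * fsym (- k) ^ j * fe (- k) x) + (if j = 0 then c else 0)) has_real_derivative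
        Re (z * fsym (- k) ^ j * fsym (- k) * fe (- k) x) + 0) (at x)"
      by (intro DERIV_add DERIV_Re_fe DERIV_const)
    then show ?thesis unfolding G_def by (simp only: power_Suc2 mult.assoc nat.distinct if_False)
  qed
  have eq: "tester N b k z c = (\<lambda>t x. cutoff N b 0 t * G 0 x)"
    by (intro ext) (simp add: tester_def G_def del: times_complex.sel)
  show "smooth_plane (tester N b k z c)"
    unfolding eq by (rule smooth_plane_product[of "cutoff N b" G 0 0]) (rule DERIV_cutoff[OF N], rule G)
  have "Dt (\<lambda>t x. cutoff N b 0 t * G 0 x) t x = cutoff N b 1 t * G 0 x"
    unfolding Dt_def One_nat_def by (intro DERIV_imp_deriv DERIV_cmult_right DERIV_cutoff N)
  then show "Dt (tester N b k z c) t x = cutoff N b 1 t * (Re (z * fe (- k) x) + c)"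
    unfolding eq by (simp add: G_def del: times_complex.sel)
  have "Dx (\<lambda>t x. cutoff N b 0 t * G j x) = (\<lambda>t x. cutoff N b 0 t * G (Suc j) x)" for j
    unfolding Dx_def by (intro ext DERIV_imp_deriv DERIV_cmult G)
  then have "Dx (Dx (tester N b k z c)) t x = cutoff N b 0 t * G 2 x"
    unfolding eq by (simp add: numeral_2_eq_2)
  moreover have "z * fsym (- k) ^ 2 * fe (- k) x = complex_of_real (- (2 * pi * k)\<^sup>2) * (z * fe (- k) x)"
    by (simp add: power2_eq_square)
  then have "G 2 x = - (2 * pi * k)\<^sup>2 * Re (z * fe (- k) x)"
    unfolding G_def
    by (simp only: times_complex.sel Re_complex_of_real Im_complex_of_real mult_zero_left diff_zero) simp
  ultimately show "Dx (Dx (tester N b k z c)) t x = cutoff N b 0 t * (- (2 * pi * k)\<^sup>2 * Re (z * fe (- k) x))"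
    by simp
qed

definition comb :: "int \<Rightarrow> complex \<Rightarrow> real \<Rightarrow> (int \<Rightarrow> complex) \<Rightarrow> complex"
  where "comb k z c f = (z * f k + cnj z * f (- k)) / 2 + of_real c * f 0"

lemma comb_add: "comb k z c (\<lambda>k. f k + g k) = comb k z c f + comb k z c g"
  by (simp add: comb_def distrib_left add_divide_distrib)

lemma integral_mult_tester:
  assumes g: "integrable (LI 1) g"
  shows "(\<integral>x. g x * complex_of_real (Re (z * fe (- k) x) + c) \<partial>LI 1) = comb k z c (fc g)"
    and "integrable (LI 1) (\<lambda>x. g x * complex_of_real (Re (z * fe (- k) x) + c))"
    and "integrable (LI 1) (\<lambda>x. g x * complex_of_real (Re (z * fe (- k) x)))"
proof -
  have em: "(\<lambda>x. complex_of_real (Re (z * fe (- k) x))) \<in> borel_measurable (LI 1)"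
    by (intro measurable_LI_continuous continuous_intros continuous_on_fe)
  have eb: "norm (complex_of_real (Re (z * fe (- k) x))) \<le> norm z" for x
    using abs_Re_le_cmod[of "z * fe (- k) x"] by (simp only: norm_of_real norm_mult norm_fe mult_1_right)
  show i: "integrable (LI 1) (\<lambda>x. g x * complex_of_real (Re (z * fe (- k) x)))"
    by (rule integrable_mult_bounded[OF g em eb])
  have c: "integrable (LI 1) (\<lambda>x. of_real c * g x)" using g by simp
  have e: "g x * complex_of_real (Re (z * fe (- k) x) + c) = g x * complex_of_real (Re (z * fe (- k) x)) + of_real c * g x" for x
    by (simp only: of_real_add distrib_left mult.commute)
  show "integrable (LI 1) (\<lambda>x. g x * complex_of_real (Re (z * fe (- k) x) + c))"
    unfolding e by (rule Bochner_Integration.integrable_add[OF i c])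
  have "fc g 0 = integral\<^sup>L (LI 1) g" by (simp add: fc_def)
  then show "(\<integral>x. g x * complex_of_real (Re (z * fe (- k) x) + c) \<partial>LI 1) = comb k z c (fc g)"
    unfolding e Bochner_Integration.integral_add[OF i c] integral_mult_Re_fe[OF g] integral_mult_right_zero comb_def by simp
qed

lemma tested_slice:
  assumes v: "v t \<in> sobolev_H s" and N: "N > 0"
  shows "(\<integral>x. weak_integrand \<epsilon> v (tester N b k z c) t x \<partial>LI 1)
     = comb k z c (\<lambda>k. tested_mode N b k t)"
proof -
  define e where "e x = complex_of_real (Re (z * fe (- k) x) + c)" for x
  define e0 where "e0 x = complex_of_real (Re (z * fe (- k) x))" for x
  have fsq: "complex_of_real (- (2 * pi * k)\<^sup>2) = fsym k ^ 2" "fsym (- k) ^ 2 = fsym k ^ 2"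
    by (simp_all add: power2_eq_square)
  have iv: "integrable (LI 1) (v t)" by (rule sobolev_H_D(2)[OF v])
  have iw: "integrable (LI 1) (\<lambda>x. v t x * weak_deriv 1 (v t) x)" by (rule fc_mult_weak_deriv(2)[OF v s])
  note i1 = integral_mult_tester(2)[OF iv, of z k c, folded e_def]
    and i2 = integral_mult_tester(2)[OF iw, of z k c, folded e_def]
    and i3 = integral_mult_tester(3)[OF iv, of z k, folded e0_def]
  have "(\<integral>x. weak_integrand \<epsilon> v (tester N b k z c) t x \<partial>LI 1)
      = (\<integral>x. (- of_real (cutoff N b 1 t)) * (v t x * e x) + of_real (cutoff N b 0 t) * (v t x * weak_deriv 1 (v t) x * e x)
      - (of_real \<epsilon> * of_real (cutoff N b 0 t) * fsym k ^ 2) * (v t x * e0 x) \<partial>LI 1)"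
    unfolding tester_derivs(2,3)[OF N] fsq(1)[symmetric]
    by (rule Bochner_Integration.integral_cong[OF refl])
       (simp add: tester_def e_def e0_def del: times_complex.sel of_real_add)
  also have "\<dots> = (- of_real (cutoff N b 1 t)) * (\<integral>x. v t x * e x \<partial>LI 1)
      + of_real (cutoff N b 0 t) * (\<integral>x. v t x * weak_deriv 1 (v t) x * e x \<partial>LI 1)
      - (of_real \<epsilon> * of_real (cutoff N b 0 t) * fsym k ^ 2) * (\<integral>x. v t x * e0 x \<partial>LI 1)"
    by (simp only: Bochner_Integration.integral_diff[OF Bochner_Integration.integrable_add[OF
          integrable_mult_right[OF i1] integrable_mult_right[OF i2]] integrable_mult_right[OF i3]]
        Bochner_Integration.integral_add[OF integrable_mult_right[OF i1] integrable_mult_right[OF i2]]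
        integral_mult_right_zero)
  also have "\<dots> = comb k z c (\<lambda>k. tested_mode N b k t)"
    unfolding e_def e0_def integral_mult_tester(1)[OF iv] integral_mult_tester(1)[OF iw] integral_mult_Re_fe[OF iv] comb_def
      fc_mult_weak_deriv(1)[OF v s]
    unfolding tested_mode_def vc_def[symmetric] gc_def[symmetric] fsq(2) by (simp add: field_simps)
  finally show ?thesis .
qed

lemma integrable_tested_mode:
  assumes N: "N > 0"
  shows "integrable (LI T) (tested_mode N b k)"
  unfolding tested_mode_def
  by (intro Bochner_Integration.integrable_add Bochner_Integration.integrable_diff Bochner_Integration.integrable_minus
      integrable_mult_cutoff N integrable_mult_right integrable_vc integrable_gc)

definition data_mode :: "real \<Rightarrow> real \<Rightarrow> int \<Rightarrow> complex"
  where "data_mode N b k = - (of_real (cutoff N b 0 0) * fc a k) - (if k = 0 then \<i> * (\<integral>t. of_real (cutoff N b 0 t) \<partial>LI T) else 0)"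

text \<open>On the null set of times where \<open>v t\<close> is not in \<open>H\<^sup>s\<close> the time integrand of the weak
  formulation need not be measurable, and its integral is then \<open>0\<close> by convention. So a test function
  gives either the intended identity or the identity without the middle term.\<close>

lemma tested_alternative:
  assumes b: "0 < b" "b < T" and N: "N > 0"
  shows "comb k z c (\<lambda>k. data_mode N b k + integral\<^sup>L (LI T) (tested_mode N b k)) = 0 \<or> comb k z c (data_mode N b) = 0"
proof -
  let ?\<phi> = "tester N b k z c"
  have "spacetime_test_function T ?\<phi>"
    unfolding spacetime_test_function_def periodic1_def
    using b cutoff_after[OF N, of b] tester_derivs(1)[OF N]
    by (intro conjI allI exI[of _ b] impI) (simp_all only: tester_def fe_period mult_zero_left)
  then have eq: "- (\<integral>x. a x * complex_of_real (?\<phi> 0 x) \<partial>LI 1)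
      + (\<integral>t. \<integral>x. weak_integrand \<epsilon> v ?\<phi> t x \<partial>LI 1 \<partial>LI T)
      = (\<integral>t. \<integral>x. \<i> * complex_of_real (?\<phi> t x) \<partial>LI 1 \<partial>LI T)"
    (is "- ?A + (\<integral>t. ?I t \<partial>LI T) = ?R")
    using solution unfolding burgers_solution_def set_lint_LI by blast
  have A: "?A = of_real (cutoff N b 0 0) * comb k z c (fc a)"
  proof -
    have "?A = (\<integral>x. of_real (cutoff N b 0 0) * (a x * complex_of_real (Re (z * fe (- k) x) + c)) \<partial>LI 1)"
      by (rule Bochner_Integration.integral_cong[OF refl]) (simp only: tester_def of_real_mult mult_ac)
    then show ?thesis by (simp only: integral_mult_right_zero integral_mult_tester(1)[OF a])
  qed
  have R: "?R = (\<integral>t. of_real (cutoff N b 0 t) \<partial>LI T) * comb k z c (\<lambda>k. if k = 0 then \<i> else 0)"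
  proof -
    have "(\<integral>x. \<i> * complex_of_real (?\<phi> t x) \<partial>LI 1) = of_real (cutoff N b 0 t) * comb k z c (\<lambda>k. if k = 0 then \<i> else 0)" for t
    proof -
      have "(\<integral>x. \<i> * complex_of_real (?\<phi> t x) \<partial>LI 1)
          = (\<integral>x. of_real (cutoff N b 0 t) * (\<i> * complex_of_real (Re (z * fe (- k) x) + c)) \<partial>LI 1)"
        by (rule Bochner_Integration.integral_cong[OF refl]) (simp only: tester_def of_real_mult mult_ac)
      then show ?thesis
        by (simp only: integral_mult_right_zero[where c="complex_of_real (cutoff N b 0 t)"]
            integral_mult_tester(1)[OF LI.integrable_const] fc_const[abs_def])
    qed
    then show ?thesis by (simp only: integral_mult_left_zero)
  qed
  have YR: "- ?A - ?R = comb k z c (data_mode N b)"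
    unfolding A R comb_def data_mode_def by (simp add: field_simps)
  have ae: "AE t in LI T. ?I t = comb k z c (\<lambda>k. tested_mode N b k t)"
    using bounded by eventually_elim (rule tested_slice[OF _ N], simp)
  have iX: "integrable (LI T) (\<lambda>t. comb k z c (\<lambda>k. tested_mode N b k t))"
    unfolding comb_def using integrable_tested_mode[OF N] by simp
  show ?thesis
  proof (cases "?I \<in> borel_measurable (LI T)")
    case True
    have "(\<integral>t. ?I t \<partial>LI T) = (\<integral>t. comb k z c (\<lambda>k. tested_mode N b k t) \<partial>LI T)"
      by (rule integral_cong_AE[OF True borel_measurable_integrable[OF iX] ae])
    also have "\<dots> = comb k z c (\<lambda>k. integral\<^sup>L (LI T) (tested_mode N b k))"
      unfolding comb_def using integrable_tested_mode[OF N] by simp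
    finally have "comb k z c (data_mode N b) + comb k z c (\<lambda>k. integral\<^sup>L (LI T) (tested_mode N b k)) = 0"
      using eq unfolding YR[symmetric] by (simp add: algebra_simps)
    then show ?thesis unfolding comb_add by (rule disjI1)
  next
    case False
    then have "\<not> integrable (LI T) ?I" by auto
    then have "(\<integral>t. ?I t \<partial>LI T) = 0" by (rule not_integrable_integral_eq)
    then show ?thesis using eq unfolding YR[symmetric] by simp
  qed
qed

lemma cutoff_integral_neg:
  assumes b: "0 < b" "b < T" and N: "N > 0"
  shows "(\<integral>t. cutoff N b 0 t \<partial>LI T) < 0"
proof -
  have c: "continuous_on {0..T} (cutoff N b 0)" by (rule continuous_on_cutoff[OF N])
  have neg: "cutoff N b 0 t \<le> 0" for t
    using N by (cases "t < b") (auto simp: cutoff_def bump_def zero_less_mult_iff)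
  have i: "integrable (LI T) (\<lambda>t. - cutoff N b 0 t)" by (intro integrable_LI_continuous continuous_intros c)
  have "integral\<^sup>L (LI T) (\<lambda>t. - cutoff N b 0 t) \<noteq> 0"
  proof
    assume "integral\<^sup>L (LI T) (\<lambda>t. - cutoff N b 0 t) = 0"
    then have "AE t in LI T. - cutoff N b 0 t = 0"
      using integral_nonneg_eq_0_iff_AE[OF i] neg by auto
    moreover have "AE t in LI T. 0 < t" by (rule AE_LI_gt0)
    ultimately have "AE t in LI T. b \<le> t"
    proof eventually_elim
      case (elim t)
      show ?case
      proof (rule ccontr)
        assume "\<not> b \<le> t"
        then show False using elim N by (simp add: cutoff_def bump_def)
      qed
    qed
    then have "AE t in lborel. t \<notin> {0..b / 2}"
      unfolding AE_LI by eventually_elim (use b in auto)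
    then have "emeasure lborel {0..b / 2} = 0"
      by (subst (asm) AE_iff_measurable[where N="{0..b / 2}"]) auto
    then show False using b by (simp add: emeasure_lborel_Icc_eq ennreal_eq_0_iff)
  qed
  moreover have "0 \<le> integral\<^sup>L (LI T) (\<lambda>t. - cutoff N b 0 t)"
    using neg by (intro Bochner_Integration.integral_nonneg) auto
  ultimately show ?thesis by simp
qed


text \<open>The second alternative fails for the constant mode, because \<open>data_mode N b 0\<close> has a non-zero imaginary
  part. The set of test functions is a vector space, so it is not the union of the kernel of a
  functional and the kernel of a non-zero one, unless the first functional vanishes.\<close>

lemma tested_equation:
  assumes b: "0 < b" "b < T" and N: "N > 0"
  shows "data_mode N b k + integral\<^sup>L (LI T) (tested_mode N b k) = 0"
proof -
  define Z where "Z k = data_mode N b k + integral\<^sup>L (LI T) (tested_mode N b k)" for k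
  have alt: "comb k z c Z = 0 \<or> comb k z c (data_mode N b) = 0" for k z c
    using tested_alternative[OF b N] unfolding Z_def .
  have "Im (data_mode N b 0) = - (\<integral>t. cutoff N b 0 t \<partial>LI T)"
    using a_real by (simp add: data_mode_def)
  then have Y0: "data_mode N b 0 \<noteq> 0" using cutoff_integral_neg[OF b N] by auto
  then have Z0: "Z 0 = 0" using alt[of 0 0 1] by (simp add: comb_def)
  have "z * Z k + cnj z * Z (- k) = 0" for z
  proof -
    have "comb k z 1 (data_mode N b) = comb k z 0 (data_mode N b) + data_mode N b 0" by (simp add: comb_def)
    then obtain c where "comb k z c (data_mode N b) \<noteq> 0" using Y0 by (metis add_0)
    then have "comb k z c Z = 0" using alt by blast
    then show ?thesis using Z0 by (simp add: comb_def)
  qed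
  from this[of 1] this[of "- \<i>"] have "Z k = 0" by (simp add: algebra_simps)
  then show ?thesis by (simp add: Z_def)
qed

lemma cutoff_0_eq:
  assumes b: "b < T" and N: "N > 0" and t: "t \<in> {0..T}"
  shows "complex_of_real (cutoff N b 0 t) = of_real (cutoff N b 0 0) + integral\<^sup>L (LI t) (\<lambda>\<tau>. of_real (cutoff N b 1 \<tau>))"
    and "integral\<^sup>L (LI T) (\<lambda>\<tau>. complex_of_real (cutoff N b 1 \<tau>)) = - of_real (cutoff N b 0 0)"
proof -
  have *: "integral\<^sup>L (LI t) (\<lambda>\<tau>. complex_of_real (cutoff N b 1 \<tau>)) = of_real (cutoff N b 0 t) - of_real (cutoff N b 0 0)"
    if t: "t \<in> {0..T}" for t
  proof -
    have h: "((\<lambda>\<tau>. complex_of_real (cutoff N b 1 \<tau>)) has_integral (of_real (cutoff N b 0 t) - of_real (cutoff N b 0 0))) {0..t}"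
    proof (rule fundamental_theorem_of_calculus)
      fix x
      show "((\<lambda>\<tau>. complex_of_real (cutoff N b 0 \<tau>)) has_vector_derivative complex_of_real (cutoff N b 1 x)) (at x within {0..t})"
        by (rule has_vector_derivative_of_real, rule has_field_derivative_at_within)
           (use DERIV_cutoff[OF N, of b 0] in simp)
    qed (use t in auto)
    have c: "continuous_on {0..t} (\<lambda>\<tau>. complex_of_real (cutoff N b 1 \<tau>))"
      by (intro continuous_intros continuous_on_cutoff N)
    show ?thesis by (rule trans[OF integral_LI_HK[OF c] integral_unique[OF h]])
  qed
  show "complex_of_real (cutoff N b 0 t) = of_real (cutoff N b 0 0) + integral\<^sup>L (LI t) (\<lambda>\<tau>. of_real (cutoff N b 1 \<tau>))"
    unfolding *[OF t] by simp
  show "integral\<^sup>L (LI T) (\<lambda>\<tau>. complex_of_real (cutoff N b 1 \<tau>)) = - of_real (cutoff N b 0 0)"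
    using T cutoff_after[OF N, of b T] b by (subst *) auto
qed

text \<open>After an integration by parts in time, the tested equation says that the defect \<open>F\<close> of the
  integrated equation is orthogonal to the derivatives of all cut-offs, hence to all indicators
  of \<open>{0..b}\<close>.\<close>

lemma coefficient_equation: "AE t in LI T. vc k t = fc a k + integral\<^sup>L (LI t) (rate k)"
proof -
  define P where "P t = integral\<^sup>L (LI t) (rate k)" for t
  define F where "F t = vc k t - fc a k - P t" for t
  have iq: "integrable (LI T) (\<lambda>\<tau>. complex_of_real (cutoff N b 1 \<tau>))" if "N > 0" for N b
    by (intro integrable_LI_continuous continuous_intros continuous_on_cutoff that)
  have iP: "integrable (LI T) P"
  proof -
    have "integrable (LI T) (\<lambda>\<tau>. P \<tau> * 1)"
      unfolding P_def by (rule product_of_integrals(2)[OF integrable_rate]) simp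
    then show ?thesis by simp
  qed
  have iF: "integrable (LI T) F"
    unfolding F_def by (intro Bochner_Integration.integrable_diff integrable_vc iP) simp
  have zero: "(\<integral>t. of_real (cutoff N b 1 t) * F t \<partial>LI T) = 0" if b: "0 < b" "b < T" and N: "N > 0" for N b
  proof -
    have arith: "x = - y" if "r * - e = x - e * r + y" for r e x y :: complex
      using that by (simp add: algebra_simps eq_neg_iff_add_eq_0)
    let ?\<eta> = "\<lambda>t. complex_of_real (cutoff N b 0 t)" and ?\<eta>' = "\<lambda>t. complex_of_real (cutoff N b 1 t)"
    note iq' = iq[OF N, of b]
    have qT: "integral\<^sup>L (LI T) ?\<eta>' = - ?\<eta> 0"
      by (rule cutoff_0_eq(2)[OF b(2) N, of T]) (use T in simp)
    have ir: "integrable (LI T) (\<lambda>t. ?\<eta> t * rate k t)" by (rule integrable_mult_cutoff[OF N integrable_rate])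
    have iPq: "integrable (LI T) (\<lambda>t. P t * ?\<eta>' t)"
      using integrable_mult_cutoff[OF N iP, of b 1] by (simp add: mult.commute)
    have "integral\<^sup>L (LI T) (rate k) * integral\<^sup>L (LI T) ?\<eta>'
        = (\<integral>t. rate k t * integral\<^sup>L (LI t) ?\<eta>' + P t * ?\<eta>' t \<partial>LI T)"
      unfolding P_def by (rule product_of_integrals(1)[OF integrable_rate iq'])
    also have "\<dots> = (\<integral>t. (?\<eta> t * rate k t - ?\<eta> 0 * rate k t) + P t * ?\<eta>' t \<partial>LI T)"
    proof (rule Bochner_Integration.integral_cong[OF refl])
      fix t assume "t \<in> space (LI T)"
      then have t: "t \<in> {0..T}" by simp
      have J: "integral\<^sup>L (LI t) ?\<eta>' = ?\<eta> t - ?\<eta> 0"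
        unfolding cutoff_0_eq(1)[OF b(2) N t] by (rule add_diff_cancel_left'[symmetric])
      show "rate k t * integral\<^sup>L (LI t) ?\<eta>' + P t * ?\<eta>' t = (?\<eta> t * rate k t - ?\<eta> 0 * rate k t) + P t * ?\<eta>' t"
        unfolding J by (simp only: right_diff_distrib mult.commute)
    qed
    also have "\<dots> = (\<integral>t. ?\<eta> t * rate k t \<partial>LI T) - ?\<eta> 0 * integral\<^sup>L (LI T) (rate k) + (\<integral>t. P t * ?\<eta>' t \<partial>LI T)"
      using ir iPq integrable_rate by simp
    finally have "integral\<^sup>L (LI T) (rate k) * - ?\<eta> 0 = (\<integral>t. ?\<eta> t * rate k t \<partial>LI T)
        - ?\<eta> 0 * integral\<^sup>L (LI T) (rate k) + (\<integral>t. P t * ?\<eta>' t \<partial>LI T)"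
      unfolding qT .
    from arith[OF this] have parts: "(\<integral>t. ?\<eta> t * rate k t \<partial>LI T) = - (\<integral>t. P t * ?\<eta>' t \<partial>LI T)"
      .
    have i1: "integrable (LI T) (\<lambda>t. ?\<eta>' t * vc k t)" by (rule integrable_mult_cutoff[OF N integrable_vc])
    have i0: "integrable (LI T) (\<lambda>t. ?\<eta> t * (if k = 0 then \<i> else 0))" by (rule integrable_mult_cutoff[OF N LI.integrable_const])
    have Xe: "tested_mode N b k t = - (?\<eta>' t * vc k t) - (?\<eta> t * rate k t - ?\<eta> t * (if k = 0 then \<i> else 0))" for t
      by (simp add: tested_mode_def rate_def algebra_simps)
    have "integral\<^sup>L (LI T) (tested_mode N b k) = - (\<integral>t. ?\<eta>' t * vc k t \<partial>LI T) - ((\<integral>t. ?\<eta> t * rate k t \<partial>LI T)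
        - (\<integral>t. ?\<eta> t * (if k = 0 then \<i> else 0) \<partial>LI T))"
      unfolding Xe using i0 i1 ir by (simp del: integral_mult_left_zero)
    also have "(\<integral>t. ?\<eta> t * (if k = 0 then \<i> else 0) \<partial>LI T) = (if k = 0 then \<i> * (\<integral>t. ?\<eta> t \<partial>LI T) else 0)"
      by (simp only: integral_mult_left_zero mult.commute) simp
    finally have "(\<integral>t. ?\<eta>' t * vc k t \<partial>LI T) = - (?\<eta> 0 * fc a k) + (\<integral>t. P t * ?\<eta>' t \<partial>LI T)"
      using tested_equation[OF b N, of k] unfolding parts data_mode_def by (simp add: algebra_simps)
    moreover have "(\<integral>t. ?\<eta>' t * F t \<partial>LI T) = (\<integral>t. ?\<eta>' t * vc k t - ?\<eta>' t * fc a k - P t * ?\<eta>' t \<partial>LI T)"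
      by (rule Bochner_Integration.integral_cong[OF refl]) (simp add: F_def algebra_simps)
    moreover have "\<dots> = (\<integral>t. ?\<eta>' t * vc k t \<partial>LI T) - integral\<^sup>L (LI T) ?\<eta>' * fc a k - (\<integral>t. P t * ?\<eta>' t \<partial>LI T)"
      using i1 iq' iPq by simp
    ultimately show ?thesis unfolding qT by simp
  qed
  have "AE t in LI T. F t = 0"
  proof (rule AE_zero_if_integrals_zero[OF iF])
    fix b assume b: "0 < b" "b < T"
    have "(\<lambda>n. \<integral>t. of_real (cutoff (real (Suc n)) b 1 t) * F t \<partial>LI T) \<longlonglongrightarrow> (\<integral>t. of_bool (t < b) * F t \<partial>LI T)"
    proof (rule integral_dominated_convergence[where w="\<lambda>t. norm (F t)"])
      show m: "(\<lambda>t. of_bool (t < b) * F t) \<in> borel_measurable (LI T)"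
        by (rule borel_measurable_times[OF measurable_LI borel_measurable_integrable[OF iF]]) measurable
      show "(\<lambda>t. of_real (cutoff (real (Suc n)) b 1 t) * F t) \<in> borel_measurable (LI T)" for n
        by (rule borel_measurable_integrable[OF integrable_mult_cutoff[OF _ iF]]) simp
      have "\<bar>cutoff (real (Suc n)) b 1 t\<bar> * norm (F t) \<le> 1 * norm (F t)" for n t
        by (intro mult_right_mono cutoff_deriv_bound) auto
      then show "AE t in LI T. norm (of_real (cutoff (real (Suc n)) b 1 t) * F t) \<le> norm (F t)" for n
        by (intro AE_I2) (simp add: norm_mult)
      show "AE t in LI T. (\<lambda>n. of_real (cutoff (real (Suc n)) b 1 t) * F t) \<longlonglongrightarrow> of_bool (t < b) * F t"
      proof (rule AE_I2, rule tendsto_mult_right)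
        fix t
        have "(\<lambda>n. complex_of_real (cutoff (real (Suc n)) b 1 t)) \<longlonglongrightarrow> complex_of_real (of_bool (t < b))"
          by (rule tendsto_of_real[OF cutoff_deriv_tendsto])
        moreover have "complex_of_real (of_bool (t < b)) = of_bool (t < b)" by (simp add: of_bool_def)
        ultimately show "(\<lambda>n. complex_of_real (cutoff (real (Suc n)) b 1 t)) \<longlonglongrightarrow> of_bool (t < b)" by (simp only:)
      qed
    qed (use iF in auto)
    moreover have "(\<integral>t. of_real (cutoff (real (Suc n)) b 1 t) * F t \<partial>LI T) = 0" for n
      by (rule zero[OF b]) simp
    ultimately have "(\<lambda>n. 0) \<longlonglongrightarrow> (\<integral>t. of_bool (t < b) * F t \<partial>LI T)" by simp
    then have "(\<integral>t. of_bool (t < b) * F t \<partial>LI T) = 0"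
      using LIMSEQ_unique tendsto_const by blast
    also have "(\<integral>t. of_bool (t < b) * F t \<partial>LI T) = integral\<^sup>L (LI b) F"
      by (rule integral_LI_restrict[OF _ borel_measurable_integrable[OF iF]]) (use b in auto)
    finally show "integral\<^sup>L (LI b) F = 0" .
  qed
  then show ?thesis by eventually_elim (simp add: F_def P_def algebra_simps)
qed

end

lemma measurable_norm_sq: "f \<in> borel_measurable M \<Longrightarrow> (\<lambda>x. (cmod (f x))\<^sup>2) \<in> borel_measurable M"
  by measurable

subsection \<open>The energy estimate for the difference of two solutions\<close>

lemma integrable_LI_mono:
  fixes f :: "real \<Rightarrow> 'a::{banach,second_countable_topology}"
  assumes "integrable (LI T) f" "t \<le> T"
  shows "integrable (LI t) f"
  unfolding set_integrable_LI[symmetric]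
  by (rule set_integrable_subset[where A="{0..T}"]) (use assms in \<open>simp_all add: set_integrable_LI\<close>)

lemma AE_LI_mono: "AE x in LI T. P x \<Longrightarrow> t \<le> T \<Longrightarrow> AE x in LI t. P x"
  unfolding AE_LI by (auto elim!: eventually_mono)

text \<open>Iterating the inequality \<open>n\<close> times gains the factor \<open>(C t)\<^sup>n / n!\<close>.\<close>

lemma gronwall_zero:
  fixes m :: "real \<Rightarrow> real"
  assumes m: "m \<in> borel_measurable (LI T)" and K: "AE t in LI T. 0 \<le> m t \<and> m t \<le> K"
    and C: "0 \<le> C" "AE t in LI T. m t \<le> C * integral\<^sup>L (LI t) m"
  shows "AE t in LI T. m t = 0"
proof -
  have im: "integrable (LI T) m"
  proof (rule LI.integrable_const_bound[where B=K, OF _ m])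
    show "AE t in LI T. norm (m t) \<le> K" using K by eventually_elim simp
  qed
  have pow: "integral\<^sup>L (LI t) (\<lambda>\<tau>. \<tau> ^ n) = t ^ Suc n / real (Suc n)" if "0 \<le> t" for t n
  proof -
    have "((\<lambda>\<tau>. \<tau> ^ n) has_integral (t ^ Suc n / real (Suc n) - 0 ^ Suc n / real (Suc n))) {0..t}"
    proof (rule fundamental_theorem_of_calculus[OF that])
      fix x
      have "((\<lambda>\<tau>. \<tau> ^ Suc n / real (Suc n)) has_real_derivative (real (Suc n) * x ^ n) / real (Suc n)) (at x within {0..t})"
        by (rule DERIV_cdivide) (auto intro!: derivative_eq_intros simp del: power_Suc of_nat_Suc)
      then show "((\<lambda>\<tau>. \<tau> ^ Suc n / real (Suc n)) has_vector_derivative x ^ n) (at x within {0..t})"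
        unfolding has_real_derivative_iff_has_vector_derivative by simp
    qed
    then show ?thesis by (subst integral_LI_HK) (auto intro!: continuous_intros simp: integral_unique)
  qed
  have step: "AE t in LI T. m t \<le> K * C ^ n * t ^ n / fact n" for n
  proof (induction n)
    case 0
    then show ?case using K by auto
  next
    case (Suc n)
    show ?case
      using C(2) AE_space
    proof eventually_elim
      case (elim t)
      then have t: "0 \<le> t" "t \<le> T" by auto
      have "integral\<^sup>L (LI t) m \<le> integral\<^sup>L (LI t) (\<lambda>\<tau>. (K * C ^ n / fact n) * \<tau> ^ n)"
      proof (rule integral_mono_AE[OF integrable_LI_mono[OF im t(2)]])
        show "integrable (LI t) (\<lambda>\<tau>. (K * C ^ n / fact n) * \<tau> ^ n)"
          by (intro integrable_LI_continuous continuous_intros)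
        show "AE \<tau> in LI t. m \<tau> \<le> (K * C ^ n / fact n) * \<tau> ^ n"
          using AE_LI_mono[OF Suc t(2)] by eventually_elim simp
      qed
      also have "\<dots> = (K * C ^ n / fact n) * (t ^ Suc n / real (Suc n))"
        by (simp only: integral_mult_right_zero pow[OF t(1)])
      finally have "C * integral\<^sup>L (LI t) m \<le> C * ((K * C ^ n / fact n) * (t ^ Suc n / real (Suc n)))"
        by (intro mult_left_mono C)
      also have "\<dots> = K * C ^ Suc n * t ^ Suc n / fact (Suc n)"
        by (simp add: fact_Suc mult_ac)
      finally show ?case using elim(1) by linarith
    qed
  qed
  have "AE t in LI T. \<forall>n. m t \<le> K * C ^ n * t ^ n / fact n"
    using step by (subst AE_all_countable) blast
  then show ?thesis using K
  proof eventually_elim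
    case (elim t)
    have "(\<lambda>n. inverse (fact n) * (C * t) ^ n) \<longlonglongrightarrow> 0"
      by (rule summable_LIMSEQ_zero[OF summable_exp])
    then have "(\<lambda>n. K * (inverse (fact n) * (C * t) ^ n)) \<longlonglongrightarrow> K * 0"
      by (intro tendsto_intros)
    moreover have "K * (inverse (fact n) * (C * t) ^ n) = K * C ^ n * t ^ n / fact n" for n
      by (simp add: power_mult_distrib divide_inverse mult_ac)
    ultimately have "(\<lambda>n. K * C ^ n * t ^ n / fact n) \<longlonglongrightarrow> 0" by simp
    then have "m t \<le> 0" by (rule LIMSEQ_le_const) (use elim(1) in blast)
    then show ?case using elim(2) by simp
  qed
qed

text \<open>The viscosity absorbs the derivative in front of \<open>h\<close>, at the price of a factor \<open>1 / (8 \<epsilon>)\<close>.\<close>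

lemma dissipation_absorbs:
  assumes "0 < \<epsilon>"
  shows "2 * Re (cnj d * (of_real \<epsilon> * (fsym k ^ 2 * d) - fsym k / 2 * h)) \<le> (cmod h)\<^sup>2 / (8 * \<epsilon>)"
proof -
  define x where "x = 2 * pi * \<bar>real_of_int k\<bar> * cmod d"
  have xsq: "x\<^sup>2 = (2 * pi * real_of_int k)\<^sup>2 * (cmod d)\<^sup>2"
    by (simp add: x_def power_mult_distrib)
  have "fsym k ^ 2 = complex_of_real (- (2 * pi * real_of_int k)\<^sup>2)"
    by (simp add: power2_eq_square)
  then have "cnj d * (of_real \<epsilon> * (fsym k ^ 2 * d)) = complex_of_real (- \<epsilon> * (2 * pi * real_of_int k)\<^sup>2) * (d * cnj d)"
    by (simp add: mult_ac)
  also have "\<dots> = complex_of_real (- \<epsilon> * (2 * pi * real_of_int k)\<^sup>2 * (cmod d)\<^sup>2)"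
    unfolding complex_norm_square[symmetric] of_real_mult[symmetric] ..
  finally have 1: "Re (cnj d * (of_real \<epsilon> * (fsym k ^ 2 * d))) = - \<epsilon> * x\<^sup>2"
    by (simp only: Re_complex_of_real xsq mult.assoc)
  have "- Re (cnj d * (fsym k / 2 * h)) \<le> cmod (cnj d * (fsym k / 2 * h))"
    using complex_Re_le_cmod[of "- (cnj d * (fsym k / 2 * h))"] by (simp only: uminus_complex.sel norm_minus_cancel)
  also have "\<dots> = x * cmod h / 2"
    unfolding norm_mult[of "cnj d"] norm_mult[of "fsym k / 2"] norm_divide norm_fsym complex_mod_cnj x_def by simp
  finally have 2: "- Re (cnj d * (fsym k / 2 * h)) \<le> x * cmod h / 2" .
  have "0 \<le> (4 * \<epsilon> * x - cmod h)\<^sup>2" by simp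
  then have "x * cmod h - 2 * \<epsilon> * x\<^sup>2 \<le> (cmod h)\<^sup>2 / (8 * \<epsilon>)"
    using assms by (simp add: field_simps power2_eq_square)
  moreover have "Re (cnj d * (of_real \<epsilon> * (fsym k ^ 2 * d) - fsym k / 2 * h))
      = Re (cnj d * (of_real \<epsilon> * (fsym k ^ 2 * d))) - Re (cnj d * (fsym k / 2 * h))"
    unfolding right_diff_distrib by (simp only: minus_complex.sel)
  ultimately show ?thesis using 1 2 by simp
qed

lemma damped_mode_bound:
  assumes eps: "0 < \<epsilon>" and ir: "integrable (LI T) r" and ih2: "integrable (LI T) (\<lambda>t. (cmod (h t))\<^sup>2)"
    and r: "\<And>t. r t = of_real \<epsilon> * (fsym k ^ 2 * d t) - fsym k / 2 * h t"
    and dR: "AE t in LI T. d t = integral\<^sup>L (LI t) r"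
  shows "AE t in LI T. (cmod (d t))\<^sup>2 \<le> (\<integral>\<tau>. (cmod (h \<tau>))\<^sup>2 / (8 * \<epsilon>) \<partial>LI t)"
proof -
  define R where "R t = integral\<^sup>L (LI t) r" for t
  have RR: "(cmod (R t))\<^sup>2 \<le> (\<integral>\<tau>. (cmod (h \<tau>))\<^sup>2 / (8 * \<epsilon>) \<partial>LI t)" if t: "t \<in> {0..T}" for t
  proof -
    have irt: "integrable (LI t) r" and ict: "integrable (LI t) (\<lambda>\<tau>. cnj (r \<tau>))"
      using integrable_LI_mono[OF ir] t by auto
    have Rc: "integral\<^sup>L (LI \<tau>) (\<lambda>\<tau>. cnj (r \<tau>)) = cnj (R \<tau>)" for \<tau>
      unfolding R_def by (rule Bochner_Integration.integral_cnj)
    have "integrable (LI t) (\<lambda>\<tau>. R \<tau> * cnj (r \<tau>))" "integrable (LI t) (\<lambda>\<tau>. cnj (R \<tau>) * r \<tau>)"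
      using product_of_integrals(2)[OF irt ict] product_of_integrals(2)[OF ict irt] unfolding Rc
      by (simp_all only: R_def)
    then have i: "integrable (LI t) (\<lambda>\<tau>. r \<tau> * cnj (R \<tau>) + R \<tau> * cnj (r \<tau>))"
      by (simp add: mult.commute)
    have "complex_of_real ((cmod (R t))\<^sup>2) = (\<integral>\<tau>. r \<tau> * cnj (R \<tau>) + R \<tau> * cnj (r \<tau>) \<partial>LI t)"
      using product_of_integrals(1)[OF irt ict] unfolding Rc R_def[symmetric] complex_norm_square .
    then have "(cmod (R t))\<^sup>2 = Re (\<integral>\<tau>. r \<tau> * cnj (R \<tau>) + R \<tau> * cnj (r \<tau>) \<partial>LI t)"
      by (metis Re_complex_of_real)
    also have "\<dots> = (\<integral>\<tau>. Re (r \<tau> * cnj (R \<tau>) + R \<tau> * cnj (r \<tau>)) \<partial>LI t)"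
      by (rule integral_Re[OF i, symmetric])
    also have "\<dots> \<le> (\<integral>\<tau>. (cmod (h \<tau>))\<^sup>2 / (8 * \<epsilon>) \<partial>LI t)"
    proof (rule integral_mono_AE[OF integrable_Re[OF i]])
      show "integrable (LI t) (\<lambda>\<tau>. (cmod (h \<tau>))\<^sup>2 / (8 * \<epsilon>))"
        using integrable_LI_mono[OF ih2] t by auto
      have "AE \<tau> in LI t. d \<tau> = R \<tau>" unfolding R_def by (rule AE_LI_mono[OF dR]) (use t in auto)
      then show "AE \<tau> in LI t. Re (r \<tau> * cnj (R \<tau>) + R \<tau> * cnj (r \<tau>)) \<le> (cmod (h \<tau>))\<^sup>2 / (8 * \<epsilon>)"
      proof eventually_elim
        case (elim \<tau>)
        have "Re (r \<tau> * cnj (R \<tau>) + R \<tau> * cnj (r \<tau>)) = 2 * Re (cnj (d \<tau>) * r \<tau>)"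
          unfolding elim by simp
        also have "\<dots> \<le> (cmod (h \<tau>))\<^sup>2 / (8 * \<epsilon>)"
          unfolding r by (rule dissipation_absorbs[OF eps])
        finally show ?case .
      qed
    qed
    finally show ?thesis .
  qed
  show ?thesis using dR AE_space by eventually_elim (use RR in \<open>auto simp: R_def\<close>)
qed

lemma sobolev_difference:
  assumes f: "f \<in> sobolev_H s" "sobolev_norm s f \<le> M" and g: "g \<in> sobolev_H s" "sobolev_norm s g \<le> M" and s: "s \<ge> 1"
  defines "m \<equiv> (\<integral>x. (cmod (f x - g x))\<^sup>2 \<partial>LI 1)"
  shows "finite K \<Longrightarrow> (\<Sum>k\<in>K. (cmod (fc (\<lambda>x. (f x)\<^sup>2) k - fc (\<lambda>x. (g x)\<^sup>2) k))\<^sup>2) \<le> (4 * M)\<^sup>2 * m"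
    and "m = (\<Sum>\<^sub>\<infinity>k. (cmod (fc f k - fc g k))\<^sup>2)" and "(\<lambda>k. (cmod (fc f k - fc g k))\<^sup>2) summable_on UNIV"
    and "0 \<le> m" and "m \<le> (4 * M)\<^sup>2"
proof -
  have v: "torus_L2 f" "torus_L2 g" using f g sobolev_H_D(1) by auto
  have mf: "f \<in> borel_measurable (LI 1)" "g \<in> borel_measurable (LI 1)" using v torus_L2_D(2) by auto
  have isq: "integrable (LI 1) (\<lambda>x. (f x)\<^sup>2)" if "f \<in> sobolev_H s" "sobolev_norm s f \<le> M" for f
  proof (rule LI.integrable_const_bound[where B="(2 * M)\<^sup>2"])
    show "AE x in LI 1. norm ((f x)\<^sup>2) \<le> (2 * M)\<^sup>2"
      using sobolev_AE_bound[OF that s] by eventually_elim (simp only: norm_power power_mono norm_ge_zero)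
    show "(\<lambda>x. (f x)\<^sup>2) \<in> borel_measurable (LI 1)"
      by (intro borel_measurable_power torus_L2_D(2) sobolev_H_D(1)[OF that(1)])
  qed
  have d: "AE x in LI 1. cmod (f x + g x) \<le> 4 * M \<and> cmod (f x - g x) \<le> 4 * M"
    using sobolev_AE_bound[OF f s] sobolev_AE_bound[OF g s]
  proof eventually_elim
    case (elim x)
    then show ?case using norm_triangle_ineq[of "f x" "g x"] norm_triangle_ineq4[of "f x" "g x"] by auto
  qed
  then have d2: "AE x in LI 1. norm ((cmod (f x - g x))\<^sup>2) \<le> (4 * M)\<^sup>2"
    by eventually_elim (simp only: real_norm_def abs_power2 power_mono norm_ge_zero)
  have id: "integrable (LI 1) (\<lambda>x. (cmod (f x - g x))\<^sup>2)"
    by (rule LI.integrable_const_bound[OF d2]) (intro measurable_norm_sq borel_measurable_diff mf)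
  show "0 \<le> m" unfolding m_def by (rule Bochner_Integration.integral_nonneg) simp
  moreover have "norm m \<le> (4 * M)\<^sup>2 * 1" unfolding m_def by (rule norm_integral_LI_le[OF d2]) auto
  ultimately show "m \<le> (4 * M)\<^sup>2" by simp

  define p where "p x = (f x)\<^sup>2 - (g x)\<^sup>2" for x
  have ip: "integrable (LI 1) p" unfolding p_def using isq[OF f] isq[OF g] by simp
  have pb: "AE x in LI 1. (cmod (p x))\<^sup>2 \<le> (4 * M)\<^sup>2 * (cmod (f x - g x))\<^sup>2"
    using d
  proof eventually_elim
    case (elim x)
    have "p x = (f x + g x) * (f x - g x)" by (simp add: p_def power2_eq_square algebra_simps)
    then have "cmod (p x) = cmod (f x + g x) * cmod (f x - g x)" by (simp add: norm_mult)
    also have "\<dots> \<le> (4 * M) * cmod (f x - g x)" using elim by (intro mult_right_mono) auto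
    finally show ?case unfolding power_mult_distrib[of "4 * M", symmetric] by (intro power_mono) auto
  qed
  have ip2: "integrable (LI 1) (\<lambda>x. (cmod (p x))\<^sup>2)"
  proof (rule Bochner_Integration.integrable_bound)
    show "integrable (LI 1) (\<lambda>x. (4 * M)\<^sup>2 * (cmod (f x - g x))\<^sup>2)" using id by simp
    show "(\<lambda>x. (cmod (p x))\<^sup>2) \<in> borel_measurable (LI 1)"
      by (rule measurable_norm_sq[OF borel_measurable_integrable[OF ip]])
    show "AE x in LI 1. norm ((cmod (p x))\<^sup>2) \<le> norm ((4 * M)\<^sup>2 * (cmod (f x - g x))\<^sup>2)"
      using pb by eventually_elim (simp add: abs_mult)
  qed
  have "(\<integral>x. (cmod (p x))\<^sup>2 \<partial>LI 1) \<le> (\<integral>x. (4 * M)\<^sup>2 * (cmod (f x - g x))\<^sup>2 \<partial>LI 1)"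
    by (rule integral_mono_AE[OF ip2 _ pb]) (use id in simp)
  then have "(\<integral>x. (cmod (p x))\<^sup>2 \<partial>LI 1) \<le> (4 * M)\<^sup>2 * m" by (simp only: m_def integral_mult_right_zero)
  moreover have "fc (\<lambda>x. (f x)\<^sup>2) k - fc (\<lambda>x. (g x)\<^sup>2) k = fc p k" for k
    unfolding p_def by (rule fc_diff[OF isq[OF f] isq[OF g], symmetric])
  ultimately show "(\<Sum>k\<in>K. (cmod (fc (\<lambda>x. (f x)\<^sup>2) k - fc (\<lambda>x. (g x)\<^sup>2) k))\<^sup>2) \<le> (4 * M)\<^sup>2 * m" if "finite K"
    using Bessel[OF borel_measurable_integrable[OF ip] ip2 ip that] by simp

  note s1 = sobolev_fc_summable(1)[OF f(1) s] and s2 = sobolev_fc_summable(1)[OF g(1) s]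
  have ds: "(\<lambda>k. norm (fc f k - fc g k)) summable_on UNIV"
    by (rule infsum_norm_mono(1)[OF _ summable_on_add[OF s1 s2]]) (rule norm_triangle_ineq4)
  have "m = (\<integral>x. (cmod (fs (\<lambda>k. fc f k - fc g k) x))\<^sup>2 \<partial>LI 1)"
    unfolding m_def
  proof (rule integral_cong_AE)
    show "AE x in LI 1. (cmod (f x - g x))\<^sup>2 = (cmod (fs (\<lambda>k. fc f k - fc g k) x))\<^sup>2"
      unfolding AE_LI using AE_eq_fs[OF v(1) s1] AE_eq_fs[OF v(2) s2]
      by eventually_elim (simp add: fs_diff[OF s1 s2])
  qed (intro measurable_norm_sq borel_measurable_diff mf torus_L2_D(2) torus_L2_fs[OF ds])+
  then show "m = (\<Sum>\<^sub>\<infinity>k. (cmod (fc f k - fc g k))\<^sup>2)" "(\<lambda>k. (cmod (fc f k - fc g k))\<^sup>2) summable_on UNIV"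
    using integral_norm_fs[OF ds] by simp_all
qed

text \<open>Let \<open>d\<close> be the difference of the modes and \<open>h\<close> that of the modes of the squares. Dissipation bounds
  \<open>\<bar>d\<bar>\<^sup>2\<close> by the time integral of \<open>\<bar>h\<bar>\<^sup>2 / (8 \<epsilon>)\<close> for each mode; Bessel's inequality for \<open>v1\<^sup>2 - v2\<^sup>2\<close> and
  Parseval's identity for \<open>v1 - v2\<close> sum these bounds up to a Gronwall inequality for the squared
  \<open>L\<^sup>2\<close> distance.\<close>

lemma weak_solution_unique:
  assumes 1: "weak_solution s \<epsilon> T a v1 M" and 2: "weak_solution s \<epsilon> T a v2 M"
  shows "AE t in LI T. AE x in lborel. v1 t x = v2 t x"
proof -
  interpret A: weak_solution s \<epsilon> T a v1 M by (rule 1)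
  interpret B: weak_solution s \<epsilon> T a v2 M by (rule 2)
  define d where "d k t = A.vc k t - B.vc k t" for k t
  define h where "h k t = A.gc k t - B.gc k t" for k t
  define m where "m t = (\<integral>x. (cmod (v1 t x - v2 t x))\<^sup>2 \<partial>LI 1)" for t
  define C where "C = (4 * M)\<^sup>2 / (8 * \<epsilon>)"
  have m_meas: "m \<in> borel_measurable (LI T)"
  proof (rule measurable_cong[THEN iffD1])
    have "(\<lambda>z. (cmod (A.V z - B.V z))\<^sup>2) \<in> borel_measurable borel" by measurable
    then show "(\<lambda>t. \<integral>x. (cmod (A.V (t, x) - B.V (t, x)))\<^sup>2 \<partial>LI 1) \<in> borel_measurable (LI T)"
      by (intro measurable_LI measurable_param_integral)
  qed (simp add: m_def A.V_eq B.V_eq)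
  have m: "AE t in LI T. m t = (\<Sum>\<^sub>\<infinity>k. (cmod (d k t))\<^sup>2) \<and> (\<lambda>k. (cmod (d k t))\<^sup>2) summable_on UNIV
      \<and> 0 \<le> m t \<and> m t \<le> (4 * M)\<^sup>2 \<and> torus_L2 (v1 t) \<and> torus_L2 (v2 t)
      \<and> (\<forall>K. finite K \<longrightarrow> (\<Sum>k\<in>K. (cmod (h k t))\<^sup>2) \<le> (4 * M)\<^sup>2 * m t)"
    using A.bounded B.bounded
  proof eventually_elim
    case (elim t)
    then have H: "v1 t \<in> sobolev_H s" "sobolev_norm s (v1 t) \<le> M" "v2 t \<in> sobolev_H s" "sobolev_norm s (v2 t) \<le> M"
      by auto
    show ?case
      unfolding m_def d_def h_def A.vc_def B.vc_def A.gc_def B.gc_def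
      by (intro conjI allI impI sobolev_difference[OF H A.s] sobolev_H_D(1)[OF H(1)] sobolev_H_D(1)[OF H(3)])
  qed
  have im: "integrable (LI T) m"
  proof (rule LI.integrable_const_bound[where B="(4 * M)\<^sup>2", OF _ m_meas])
    show "AE t in LI T. norm (m t) \<le> (4 * M)\<^sup>2" using m by eventually_elim simp
  qed
  have ih2: "integrable (LI T) (\<lambda>t. (cmod (h k t))\<^sup>2)" for k
  proof (rule Bochner_Integration.integrable_bound)
    show "integrable (LI T) (\<lambda>t. (4 * M)\<^sup>2 * m t)" using im by simp
    show "(\<lambda>t. (cmod (h k t))\<^sup>2) \<in> borel_measurable (LI T)"
      unfolding h_def by (intro measurable_norm_sq borel_measurable_diff A.gc_measurable B.gc_measurable)
    show "AE t in LI T. norm ((cmod (h k t))\<^sup>2) \<le> norm ((4 * M)\<^sup>2 * m t)"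
      using m
    proof eventually_elim
      case (elim t)
      then have "(\<Sum>k\<in>{k}. (cmod (h k t))\<^sup>2) \<le> (4 * M)\<^sup>2 * m t" by blast
      then show ?case by simp
    qed
  qed
  have mode: "AE t in LI T. (cmod (d k t))\<^sup>2 \<le> (\<integral>\<tau>. (cmod (h k \<tau>))\<^sup>2 / (8 * \<epsilon>) \<partial>LI t)" for k
  proof (rule damped_mode_bound[OF A.eps _ ih2])
    show "integrable (LI T) (\<lambda>t. A.rate k t - B.rate k t)"
      by (intro Bochner_Integration.integrable_diff A.integrable_rate B.integrable_rate)
    show "A.rate k t - B.rate k t = of_real \<epsilon> * (fsym k ^ 2 * d k t) - fsym k / 2 * h k t" for t
      by (simp add: A.rate_def B.rate_def d_def h_def algebra_simps)
    show "AE t in LI T. d k t = (\<integral>t. A.rate k t - B.rate k t \<partial>LI t)"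
      using A.coefficient_equation[of k] B.coefficient_equation[of k] AE_space
    proof eventually_elim
      case (elim t)
      then have t: "t \<le> T" by simp
      show ?case
        using elim(1,2) integrable_LI_mono[OF A.integrable_rate t, of k] integrable_LI_mono[OF B.integrable_rate t, of k]
        by (simp add: d_def)
    qed
  qed
  have "AE t in LI T. \<forall>k. (cmod (d k t))\<^sup>2 \<le> (\<integral>\<tau>. (cmod (h k \<tau>))\<^sup>2 / (8 * \<epsilon>) \<partial>LI t)"
    using mode by (subst AE_all_countable) blast
  then have G: "AE t in LI T. m t \<le> C * integral\<^sup>L (LI t) m"
    using m AE_space
  proof eventually_elim
    case (elim t)
    then have t: "t \<le> T" by simp
    have i: "integrable (LI t) (\<lambda>\<tau>. (cmod (h k \<tau>))\<^sup>2 / (8 * \<epsilon>))" for k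
      using integrable_LI_mono[OF ih2 t] by simp
    have "(\<Sum>k\<in>K. (cmod (d k t))\<^sup>2) \<le> C * integral\<^sup>L (LI t) m" if K: "finite K" for K
    proof -
      have "(\<Sum>k\<in>K. (cmod (d k t))\<^sup>2) \<le> (\<Sum>k\<in>K. \<integral>\<tau>. (cmod (h k \<tau>))\<^sup>2 / (8 * \<epsilon>) \<partial>LI t)"
        using elim(1) by (intro sum_mono) blast
      also have "\<dots> = (\<integral>\<tau>. (\<Sum>k\<in>K. (cmod (h k \<tau>))\<^sup>2 / (8 * \<epsilon>)) \<partial>LI t)"
        by (rule Bochner_Integration.integral_sum[symmetric]) (rule i)
      also have "\<dots> \<le> (\<integral>\<tau>. C * m \<tau> \<partial>LI t)"
      proof (rule integral_mono_AE)
        show "integrable (LI t) (\<lambda>\<tau>. \<Sum>k\<in>K. (cmod (h k \<tau>))\<^sup>2 / (8 * \<epsilon>))"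
          by (intro Bochner_Integration.integrable_sum i)
        show "integrable (LI t) (\<lambda>\<tau>. C * m \<tau>)"
          by (rule integrable_mult_right) (rule integrable_LI_mono[OF im t])
        show "AE \<tau> in LI t. (\<Sum>k\<in>K. (cmod (h k \<tau>))\<^sup>2 / (8 * \<epsilon>)) \<le> C * m \<tau>"
          using AE_LI_mono[OF m t]
        proof eventually_elim
          case (elim \<tau>)
          then have "(\<Sum>k\<in>K. (cmod (h k \<tau>))\<^sup>2) / (8 * \<epsilon>) \<le> ((4 * M)\<^sup>2 * m \<tau>) / (8 * \<epsilon>)"
            using A.eps K by (intro divide_right_mono) auto
          then show ?case by (simp only: C_def sum_divide_distrib times_divide_eq_left)
        qed
      qed
      finally show ?thesis by (simp only: integral_mult_right_zero)
    qed
    then have "(\<Sum>\<^sub>\<infinity>k. (cmod (d k t))\<^sup>2) \<le> C * integral\<^sup>L (LI t) m"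
      using elim(2) by (intro infsum_le_finite_sums) auto
    then show ?case using elim(2) by simp
  qed
  have "AE t in LI T. m t = 0"
  proof (rule gronwall_zero[OF m_meas _ _ G])
    show "AE t in LI T. 0 \<le> m t \<and> m t \<le> (4 * M)\<^sup>2" using m by eventually_elim blast
    show "0 \<le> C" using A.eps by (simp add: C_def)
  qed
  then show ?thesis using m
  proof eventually_elim
    case (elim t)
    have "(cmod (d k t))\<^sup>2 = 0" for k
      by (rule nonneg_infsum_le_0D[of "\<lambda>k. (cmod (d k t))\<^sup>2" UNIV]) (use elim in auto)
    then have "fc (v1 t) k = fc (v2 t) k" for k by (simp add: d_def A.vc_def B.vc_def)
    then show ?case by (intro AE_eq_if_fc_eq) (use elim in auto)
  qed
qed

section \<open>Well-posedness and monotonicity of the norm\<close>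

theorem mainTheorem3:
  fixes s :: nat
  assumes "s \<ge> 1"
  shows "\<exists>C>0. \<forall>\<epsilon> T :: real. \<forall>a :: real \<Rightarrow> real.
    \<epsilon> > 0 \<longrightarrow> 0 < T \<longrightarrow> T < 2 * pi * \<epsilon> \<longrightarrow>
    (\<lambda>x. complex_of_real (a x)) \<in> sobolev_H s \<longrightarrow>
    sobolev_norm s (\<lambda>x. complex_of_real (a x - torus_mean a)) \<le> C * (2 * pi * \<epsilon> - T) \<longrightarrow>
    (\<exists>u. burgers_solution s \<epsilon> T (\<lambda>x. complex_of_real (a x)) u \<and>
         L2_continuous_in_time T u \<and>
         (AE x in lborel. u 0 x = complex_of_real (a x)) \<and>
         (\<forall>t\<in>{0..T}. u t \<in> sobolev_H s \<and>
            sobolev_norm s (\<lambda>x. u t x - \<i> * complex_of_real t - complex_of_real (torus_mean a))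
              \<le> sobolev_norm s (\<lambda>x. complex_of_real (a x - torus_mean a))) \<and>
         (\<forall>v. burgers_solution s \<epsilon> T (\<lambda>x. complex_of_real (a x)) v \<longrightarrow>
            (AE t in lborel. t \<in> {0..T} \<longrightarrow> (AE x in lborel. v t x = u t x))))"
  \<comment> \<open>The sum of the moduli of the Fourier coefficients of \<open>a - torus_mean a\<close> is at most the \<open>H\<^sup>s\<close> norm; the iteration
    needs it below \<open>\<delta> / 8\<close> and the energy estimate below \<open>\<delta> / 2\<^bsup>s+1\<^esup>\<close>.\<close>
proof (intro exI[of _ "1 / 2 ^ (s + 3)"] conjI allI impI)
  fix \<epsilon> T :: real and a :: "real \<Rightarrow> real"
  assume eps: "\<epsilon> > 0" and T: "0 < T" "T < 2 * pi * \<epsilon>"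
    and aH: "(\<lambda>x. complex_of_real (a x)) \<in> sobolev_H s"
    and a_small: "sobolev_norm s (\<lambda>x. complex_of_real (a x - torus_mean a)) \<le> 1 / 2 ^ (s + 3) * (2 * pi * \<epsilon> - T)"
  define \<delta> where "\<delta> = 2 * pi * \<epsilon> - T"
  define ac where "ac x = complex_of_real (a x)" for x
  define m where "m = torus_mean a"
  define w0 where "w0 x = complex_of_real (a x - m)" for x
  define E where "E = sobolev_norm s w0"
  have acH: "ac \<in> sobolev_H s" using aH by (simp add: ac_def[abs_def])
  have w0: "w0 = (\<lambda>x. ac x - of_real m)" by (rule ext) (simp add: w0_def ac_def)
  have w0H: "w0 \<in> sobolev_H s" unfolding w0 by (rule sobolev_H_diff_const[OF acH])
  have ai: "integrable (LI 1) ac" by (rule sobolev_H_D(2)[OF acH])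
  have fca: "fc ac 0 = of_real m"
  proof -
    have "fc ac 0 = (\<integral>x. complex_of_real (a x) \<partial>LI 1)" by (simp add: fc_def ac_def)
    also have "\<dots> = of_real (integral\<^sup>L (LI 1) a)" by (rule integral_complex_of_real)
    finally show ?thesis by (simp add: m_def torus_mean_def set_lint_LI)
  qed
  have fc0: "fc w0 0 = 0" unfolding w0 by (subst fc_diff[OF ai]) (simp_all add: fca fc_const)
  have A: "(\<Sum>\<^sub>\<infinity>k. norm (fc w0 k)) \<le> E"
    unfolding E_def by (rule sobolev_fc_summable(3)[OF w0H assms fc0])
  have Es: "2 ^ (s + 3) * E \<le> \<delta>"
    using a_small by (simp add: E_def \<delta>_def w0_def[abs_def] m_def field_simps)
  have E0: "0 \<le> E" unfolding E_def by (rule sobolev_norm_nonneg)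
  interpret burgers_coeffs \<epsilon> T \<delta> m "fc w0" s E
  proof
    show "(\<lambda>k. norm (fc w0 k)) summable_on UNIV" by (rule sobolev_fc_summable(1)[OF w0H assms])
    have "8 * E \<le> 2 ^ (s + 3) * E"
      using E0 power_increasing[of 3 "s + 3" "2::real"] by (intro mult_right_mono) auto
    then show "8 * (\<Sum>\<^sub>\<infinity>k. norm (fc w0 k)) \<le> \<delta>" using A Es by linarith
    have "2 ^ (s + 1) * (\<Sum>\<^sub>\<infinity>k. norm (fc w0 k)) \<le> 2 ^ (s + 3) * E"
      using A E0 by (intro mult_mono power_increasing) (auto intro!: infsum_nonneg)
    then show "2 ^ (s + 1) * (\<Sum>\<^sub>\<infinity>k. norm (fc w0 k)) \<le> \<delta>" using Es by linarith
    show "(\<Sum>k\<in>K. sweight s k * (cmod (fc w0 k))\<^sup>2) \<le> E\<^sup>2" if "finite K" for K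
      unfolding E_def by (rule sobolev_Bessel[OF w0H that])
  qed (use eps T E0 assms fc0 in \<open>auto simp: \<delta>_def\<close>)
  have T0: "(0::real) \<in> {0..T}" using T by simp
  have w0_AE: "AE x in lborel. u 0 x - of_real m = w0 x"
    using AE_eq_fs[OF sobolev_H_D(1)[OF w0H] sobolev_fc_summable(1)[OF w0H assms]]
    by eventually_elim (simp add: u_eq[OF T0] w_init)
  then have u0: "AE x in lborel. u 0 x = ac x"
    by eventually_elim (simp add: w0 algebra_simps)
  have u0_cong: "u 0 \<in> sobolev_H s" "sobolev_norm s (\<lambda>x. u 0 x - of_real m) = E"
  proof -
    show "u 0 \<in> sobolev_H s"
      using sobolev_cong_AE(1)[OF u_torus_L2[OF T0] sobolev_H_D(1)[OF acH] u0] acH by simp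
    show "sobolev_norm s (\<lambda>x. u 0 x - of_real m) = E"
      unfolding E_def
      by (rule sobolev_cong_AE(2)[OF torus_L2_diff_const[OF u_torus_L2[OF T0]] sobolev_H_D(1)[OF w0H] w0_AE])
  qed
  have u_solution: "burgers_solution s \<epsilon> T ac u"
    unfolding burgers_solution_def set_lint_LI
  proof (intro conjI allI impI u_Linf_sobolev)
    fix \<phi> assume \<phi>: "spacetime_test_function T \<phi>"
    have init: "(\<integral>x. ac x * complex_of_real (\<phi> 0 x) \<partial>LI 1) = (\<integral>x. u 0 x * complex_of_real (\<phi> 0 x) \<partial>LI 1)"
    proof (rule integral_cong_AE)
      have c: "(\<lambda>x. complex_of_real (\<phi> 0 x)) \<in> borel_measurable (LI 1)"
        by (rule measurable_LI_continuous[OF continuous_on_of_real[OF continuous_slices(1)[OF smooth_plane_D(1)]]])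
           (use \<phi> in \<open>simp add: spacetime_test_function_def\<close>)
      show "(\<lambda>x. ac x * complex_of_real (\<phi> 0 x)) \<in> borel_measurable (LI 1)"
        by (rule borel_measurable_times[OF borel_measurable_integrable[OF ai] c])
      show "(\<lambda>x. u 0 x * complex_of_real (\<phi> 0 x)) \<in> borel_measurable (LI 1)"
        by (rule borel_measurable_times[OF torus_L2_D(2)[OF u_torus_L2[OF T0]] c])
      show "AE x in LI 1. ac x * complex_of_real (\<phi> 0 x) = u 0 x * complex_of_real (\<phi> 0 x)"
        unfolding AE_LI using u0 by eventually_elim simp
    qed
    show "- (\<integral>x. ac x * complex_of_real (\<phi> 0 x) \<partial>LI 1)
        + (\<integral>t. \<integral>x. weak_integrand \<epsilon> u \<phi> t x \<partial>LI 1 \<partial>LI T)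
        = (\<integral>t. \<integral>x. \<i> * complex_of_real (\<phi> t x) \<partial>LI 1 \<partial>LI T)"
      unfolding init by (rule weak_form[OF \<phi>])
  qed
  show "\<exists>u. burgers_solution s \<epsilon> T (\<lambda>x. complex_of_real (a x)) u \<and>
         L2_continuous_in_time T u \<and>
         (AE x in lborel. u 0 x = complex_of_real (a x)) \<and>
         (\<forall>t\<in>{0..T}. u t \<in> sobolev_H s \<and>
            sobolev_norm s (\<lambda>x. u t x - \<i> * complex_of_real t - complex_of_real (torus_mean a))
              \<le> sobolev_norm s (\<lambda>x. complex_of_real (a x - torus_mean a))) \<and>
         (\<forall>v. burgers_solution s \<epsilon> T (\<lambda>x. complex_of_real (a x)) v \<longrightarrow>
            (AE t in lborel. t \<in> {0..T} \<longrightarrow> (AE x in lborel. v t x = u t x)))"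
  proof (intro exI[of _ u] conjI ballI allI impI)
    show "burgers_solution s \<epsilon> T (\<lambda>x. complex_of_real (a x)) u"
      using u_solution unfolding ac_def[abs_def] .
    show "L2_continuous_in_time T u" by (rule u_L2_continuous)
    show "AE x in lborel. u 0 x = complex_of_real (a x)" using u0 unfolding ac_def .
    fix t assume t: "t \<in> {0..T}"
    show "u t \<in> sobolev_H s" using u0_cong u_sobolev(1)[of t] t by (cases "t = 0") auto
    have "sobolev_norm s (\<lambda>x. u t x - \<i> * complex_of_real t - complex_of_real m) \<le> E"
      using u0_cong u_sobolev(2)[of t] t by (cases "t = 0") auto
    then show "sobolev_norm s (\<lambda>x. u t x - \<i> * complex_of_real t - complex_of_real (torus_mean a))
        \<le> sobolev_norm s (\<lambda>x. complex_of_real (a x - torus_mean a))"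
      unfolding E_def w0_def[abs_def] m_def .
  next
    fix v assume "burgers_solution s \<epsilon> T (\<lambda>x. complex_of_real (a x)) v"
    then have v: "burgers_solution s \<epsilon> T ac v" unfolding ac_def[abs_def] .
    obtain M1 where M1: "AE t in LI T. v t \<in> sobolev_H s \<and> sobolev_norm s (v t) \<le> M1"
      using v unfolding burgers_solution_def Linf_sobolev_def AE_LI by auto
    obtain M2 where M2: "AE t in LI T. u t \<in> sobolev_H s \<and> sobolev_norm s (u t) \<le> M2"
      using u_Linf_sobolev unfolding Linf_sobolev_def AE_LI by auto
    define M where "M = max 0 (max M1 M2)"
    have common: "weak_solution s \<epsilon> T ac w M" if "burgers_solution s \<epsilon> T ac w"
      "AE t in LI T. w t \<in> sobolev_H s \<and> sobolev_norm s (w t) \<le> M" for w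
      by unfold_locales (use that assms eps T ai fca in \<open>auto simp: M_def\<close>)
    have bv: "AE t in LI T. v t \<in> sobolev_H s \<and> sobolev_norm s (v t) \<le> M"
      using M1 by eventually_elim (auto simp: M_def)
    have bu: "AE t in LI T. u t \<in> sobolev_H s \<and> sobolev_norm s (u t) \<le> M"
      using M2 by eventually_elim (auto simp: M_def)
    have "AE t in LI T. AE x in lborel. v t x = u t x"
      by (rule weak_solution_unique[OF common[OF v bv] common[OF u_solution bu]])
    then show "AE t in lborel. t \<in> {0..T} \<longrightarrow> (AE x in lborel. v t x = u t x)"
      unfolding AE_LI .
  qed
qed simp

end
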